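(* Let $X$ be a compact computable metric space with computable metric $d_X$, let $f:X\to X$ be a computable map, and let $\Phi\in C(X,\mathbb{R}^m)$ be a computable potential. Let $\kappa:\mathbb{N}\to\mathbb{N}$ be a computable global modulus of continuity of $\Phi$. Suppose there exists a Turing machine $\psi$ such that for every $n\in\mathbb{N}$, $\psi(n)$ consists of (Turing machines which compute): (1) a finite set of computable points $p_1,\dots,p_k\in X$, and (2) a finite set of pairs $(q_1,m_1),\dots,(q_l,m_l)$ where $q_j$ is a computable periodic point of $f$ with period $m_j$, such that there exists a partition $\mathcal{P}=\{P_1,\dots,P_k\}$ of $X$ into Borel sets with the following properties: (a) for each $i$, $p_i\in P_i$; (b) for each $i$, $\operatorname{diam}(P_i)<2^{-\kappa(n+1)-1}$; and (c) for all $\mu\in\mathcal{M}$ there is some $\nu\in\operatorname{conv}(\mu_{q_1},\dots,\mu_{q_l})$ such that $\sum_{i=1}^k|\mu(P_i)-\nu(P_i)|<2^{-n}$. Then $\mathrm{Rot}(\Phi)$ is a computable compact subset of $\mathbb{R}^m$.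
   Context: Dynamics. $\mathcal{M}$ is the set of $f$-invariant Borel probability measures on $X$. $\mathrm{Rot}(\Phi)=\{\int\Phi\,d\mu:\mu\in\mathcal{M}\}\subset\mathbb{R}^m$ (integral componentwise). For a periodic point $q$ with period $p$, $\mu_q=\frac1p(\delta_q+\delta_{f(q)}+\dots+\delta_{f^{p-1}(q)})$. The sets $P_i$ (and $k,l,p_i,q_j,m_j$) may depend on $n$; the $P_i$ are not required to be computable. Computability. A computable metric space is a separable metric space $(X,d_X)$ with a fixed dense sequence $(s_1,s_2,\dots)$ (an injective function $\mathbb{N}\to X$ with dense image); $\mathbb{R}^m$ carries (an enumeration of) $\mathbb{Q}^m$. An oracle for $\alpha\in X$ is a function $\phi:\mathbb{N}\to\mathbb{N}$ with $d_X(\alpha,s_{\phi(n)})<2^{-n}$ for all $n$; $\alpha$ is computable if some Turing machine is an oracle for it. A function $g:S\to Y$, $S\subset X$, $Y$ a computable metric space with dense sequence $(t_i)$, is computable if there is an oracle Turing machine $\psi$ such that for every $\alpha\in S$, every oracle $\phi$ for $\alpha$ and every $n$, $d_Y(t_{\psi(\phi,n)},g(\alpha))<2^{-n}$ (for several arguments, one oracle per argument; natural number arguments are given exactly). A computable global modulus of continuity of $\Phi$ is a computable function $\kappa:\mathbb{N}\to\mathbb{N}$ such that $d_X(\alpha,\beta)<2^{-\kappa(k)}$ implies $\|\Phi(\alpha)-\Phi(\beta)\|<2^{-k}$ for all $\alpha,\beta\in X$, $k\in\mathbb{N}$. A compact $S\subset\mathbb{R}^m$ is computable if there is a Turing machine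 which on input $n$ outputs a finite list of pairs $(c_i,l_i)\in\mathbb{Q}^m\times\mathbb{Z}$ such that the Hausdorff distance between $\bigcup_i\overline{B}(c_i,2^{-l_i})$ and $S$ is less than $2^{-n}$. *)

theory Defs
  imports "HOL-Probability.Probability" "HOL-Library.Nat_Bijection" "HOL-Library.Countable_Set"
begin

section \<open>Oracle Turing machines\<close>

text \<open>
  Deterministic multi-tape machines over the alphabet of natural numbers with blank \<open>0\<close>; a
  program is a finite list of rules, so only finitely many states and symbols matter.
  A tape \<open>(l, r)\<close> is two-way infinite: \<open>r\<close> holds the scanned cell followed by the cells to its
  right, \<open>l\<close> the cells to the left of the head, nearest first, and all other cells are blank.
\<close>

type_synonym tape = "nat list \<times> nat list"

datatype move = MLeft | MStay | MRight

fun tape_read :: "tape \<Rightarrow> nat" where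
  "tape_read (l, []) = 0"
| "tape_read (l, a # r) = a"

fun tape_write :: "nat \<Rightarrow> tape \<Rightarrow> tape" where
  "tape_write a (l, r) = (l, a # tl r)"

fun tape_move :: "move \<Rightarrow> tape \<Rightarrow> tape" where
  "tape_move MStay t = t"
| "tape_move MLeft ([], r) = ([], 0 # r)"
| "tape_move MLeft (a # l, r) = (l, a # r)"
| "tape_move MRight (l, r) = (tape_read (l, r) # l, tl r)"

text \<open>Numbers are written on tapes in unary, starting at the scanned cell.\<close>

definition tape_of_nat :: "nat \<Rightarrow> tape" where
  "tape_of_nat n = ([], replicate n 1)"

definition nat_of_tape :: "tape \<Rightarrow> nat" where
  "nat_of_tape t = length (takeWhile (\<lambda>a. a = 1) (snd t))"

text \<open>
  \<open>Step q as q' ws\<close>: in state \<open>q\<close> scanning the symbols \<open>as\<close>, go to state \<open>q'\<close> and write and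
  move on each tape as told by \<open>ws\<close>.
  \<open>Query q j q'\<close>: in state \<open>q\<close>, replace the number \<open>x\<close> on the query tape by the value at \<open>x\<close>
  of the \<open>j\<close>-th oracle and go to \<open>q'\<close>.
\<close>

datatype rule =
    Step nat "nat list" nat "(nat \<times> move) list"
  | Query nat nat nat

text \<open>
  \<open>TM k rs\<close> has \<open>k + 1\<close> tapes: tape 0 carries input and output, tape 1 is the query tape.
\<close>

datatype tm = TM (work_tapes: nat) (program: "rule list")

type_synonym config = "nat \<times> tape list"

text \<open>
  A rule that does not apply yields \<open>None\<close>. A query to an oracle that is not supplied never
  applies, so a machine run with the empty list of oracles is an ordinary Turing machine.
\<close>

fun apply_rule :: "(nat \<Rightarrow> nat) list \<Rightarrow> rule \<Rightarrow> config \<Rightarrow> config option" where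
  "apply_rule os (Step q as q' ws) (p, ts) =
     (if p = q \<and> map tape_read ts = as \<and> length ws = length ts
      then Some (q', map2 (\<lambda>(a, d) t. tape_move d (tape_write a t)) ws ts)
      else None)"
| "apply_rule os (Query q j q') (p, ts) =
     (if p = q \<and> j < length os \<and> 1 < length ts
      then Some (q', ts[1 := tape_of_nat ((os ! j) (nat_of_tape (ts ! 1)))])
      else None)"

text \<open>The first applicable rule fires.\<close>

fun first_rule :: "(nat \<Rightarrow> nat) list \<Rightarrow> rule list \<Rightarrow> config \<Rightarrow> config option" where
  "first_rule os [] c = None"
| "first_rule os (r # rs) c =
     (case apply_rule os r c of None \<Rightarrow> first_rule os rs c | Some c' \<Rightarrow> Some c')"

definition tm_step :: "(nat \<Rightarrow> nat) list \<Rightarrow> tm \<Rightarrow> config \<Rightarrow> config option" where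
  "tm_step os M = first_rule os (program M)"

definition init_config :: "tm \<Rightarrow> nat \<Rightarrow> config" where
  "init_config M n = (0, tape_of_nat n # replicate (work_tapes M) ([], []))"

definition outputs :: "(nat \<Rightarrow> nat) list \<Rightarrow> tm \<Rightarrow> nat \<Rightarrow> nat \<Rightarrow> bool" where
  "outputs os M n m \<longleftrightarrow>
     (\<exists>c. (\<lambda>c d. tm_step os M c = Some d)\<^sup>*\<^sup>* (init_config M n) c
        \<and> tm_step os M c = None \<and> nat_of_tape (snd c ! 0) = m)"

lemma outputs_unique:
  assumes "outputs os M n m" "outputs os M n m'"
  shows "m = m'"
proof -
  let ?R = "\<lambda>c d. tm_step os M c = Some d"
  have det: "c = d" if "?R\<^sup>*\<^sup>* a c" "?R\<^sup>*\<^sup>* a d" "tm_step os M c = None" "tm_step os M d = None"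
    for a c d
    using that
  proof (induction rule: converse_rtranclp_induct)
    case base
    from base.prems(1) show ?case using base.prems(2)
      by (cases rule: converse_rtranclpE) simp_all
  next
    case (step y z)
    note IH = step.IH and prems = step.prems and hyps = step.hyps
    from prems(1) show ?case
    proof (cases rule: converse_rtranclpE)
      case base
      then show ?thesis using prems(3) hyps(1) by simp
    next
      case (step w)
      then have "w = z" using hyps(1) by simp
      then show ?thesis using IH prems(2,3) step(2) by blast
    qed
  qed
  show ?thesis using assms det unfolding outputs_def by blast
qed

text \<open>Goedel numbers of machines, so that machines can be output by machines.\<close>

fun move_encode :: "move \<Rightarrow> nat" where
  "move_encode MLeft = 0"
| "move_encode MStay = 1"
| "move_encode MRight = 2"

fun rule_encode :: "rule \<Rightarrow> nat" where
  "rule_encode (Step q as q' ws) =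
     list_encode [0, q, list_encode as, q',
       list_encode (map (\<lambda>(a, d). prod_encode (a, move_encode d)) ws)]"
| "rule_encode (Query q j q') = list_encode [1, q, j, q']"

definition tm_encode :: "tm \<Rightarrow> nat" where
  "tm_encode M = prod_encode (work_tapes M, list_encode (map rule_encode (program M)))"

lemma move_encode_inject: "move_encode a = move_encode b \<longleftrightarrow> a = b"
  by (cases a; cases b) auto

lemma inj_rule_encode: "inj rule_encode"
proof -
  have *: "inj (\<lambda>(a, d). prod_encode (a, move_encode d))"
    by (auto simp: inj_def move_encode_inject)
  show ?thesis
  proof (rule injI)
    fix r r' show "rule_encode r = rule_encode r' \<Longrightarrow> r = r'"
      by (cases r; cases r') (auto simp: list_encode_eq inj_map_eq_map[OF *])
  qed
qed

lemma inj_tm_encode: "inj tm_encode"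
proof (rule injI)
  fix M N show "tm_encode M = tm_encode N \<Longrightarrow> M = N"
    by (cases M; cases N)
      (simp add: tm_encode_def list_encode_eq inj_map_eq_map[OF inj_rule_encode])
qed


section \<open>Computable metric spaces\<close>

definition computable_nat_fun :: "(nat \<Rightarrow> nat) \<Rightarrow> bool" where
  "computable_nat_fun F \<longleftrightarrow> (\<exists>M. \<forall>n. outputs [] M n (F n))"

text \<open>The metric of the space is the class operation \<open>dist\<close>.\<close>

definition dense_sequence :: "(nat \<Rightarrow> 'a::metric_space) \<Rightarrow> bool" where
  "dense_sequence s \<longleftrightarrow> inj s \<and> closure (range s) = UNIV"

definition is_oracle :: "(nat \<Rightarrow> 'a::metric_space) \<Rightarrow> 'a \<Rightarrow> (nat \<Rightarrow> nat) \<Rightarrow> bool" where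
  "is_oracle s \<alpha> \<phi> \<longleftrightarrow> (\<forall>n. dist \<alpha> (s (\<phi> n)) < 1 / 2 ^ n)"

definition computes_point :: "(nat \<Rightarrow> 'a::metric_space) \<Rightarrow> tm \<Rightarrow> 'a \<Rightarrow> bool" where
  "computes_point s M \<alpha> \<longleftrightarrow> (\<exists>\<phi>. (\<forall>n. outputs [] M n (\<phi> n)) \<and> is_oracle s \<alpha> \<phi>)"

definition computable_on ::
  "(nat \<Rightarrow> 'a::metric_space) \<Rightarrow> (nat \<Rightarrow> 'b::metric_space) \<Rightarrow> 'a set \<Rightarrow> ('a \<Rightarrow> 'b) \<Rightarrow> bool" where
  "computable_on s t S g \<longleftrightarrow>
     (\<exists>M. \<forall>\<alpha>\<in>S. \<forall>\<phi>. is_oracle s \<alpha> \<phi> \<longrightarrow>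
        (\<forall>n. \<exists>m. outputs [\<phi>] M n m \<and> dist (t m) (g \<alpha>) < 1 / 2 ^ n))"

definition computable2_on ::
  "(nat \<Rightarrow> 'a::metric_space) \<Rightarrow> (nat \<Rightarrow> 'b::metric_space) \<Rightarrow> (nat \<Rightarrow> 'c::metric_space)
   \<Rightarrow> ('a \<times> 'b) set \<Rightarrow> ('a \<Rightarrow> 'b \<Rightarrow> 'c) \<Rightarrow> bool" where
  "computable2_on s s' t S g \<longleftrightarrow>
     (\<exists>M. \<forall>(\<alpha>, \<beta>)\<in>S. \<forall>\<phi> \<psi>. is_oracle s \<alpha> \<phi> \<longrightarrow> is_oracle s' \<beta> \<psi> \<longrightarrow>
        (\<forall>n. \<exists>m. outputs [\<phi>, \<psi>] M n m \<and> dist (t m) (g \<alpha> \<beta>) < 1 / 2 ^ n))"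


section \<open>Enumerations of the rational points\<close>

text \<open>
  The effective surjection \<open>nat_to_rat_surj\<close> with its repetitions skipped.
\<close>

definition first_occurrences :: "nat set" where
  "first_occurrences = {n. \<forall>m<n. nat_to_rat_surj m \<noteq> nat_to_rat_surj n}"

definition rat_enum :: "nat \<Rightarrow> rat" where
  "rat_enum n = nat_to_rat_surj (enumerate first_occurrences n)"

lemma bij_rat_enum: "bij rat_enum"
proof -
  have inj: "inj_on nat_to_rat_surj first_occurrences"
    unfolding inj_on_def first_occurrences_def
    by (metis (mono_tags, lifting) linorder_neqE_nat mem_Collect_eq)
  have img: "nat_to_rat_surj ` first_occurrences = UNIV"
  proof -
    have "r \<in> nat_to_rat_surj ` first_occurrences" for r
    proof -
      obtain n0 where n0: "nat_to_rat_surj n0 = r" using surj_nat_to_rat_surj by (metis surjD)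
      define n where "n = (LEAST n. nat_to_rat_surj n = r)"
      have "nat_to_rat_surj n = r" unfolding n_def by (rule LeastI, rule n0)
      moreover have "n \<in> first_occurrences"
        unfolding first_occurrences_def using \<open>nat_to_rat_surj n = r\<close> not_less_Least n_def by auto
      ultimately show ?thesis by blast
    qed
    then show ?thesis by blast
  qed
  have "infinite first_occurrences"
  proof
    assume "finite first_occurrences"
    then have "finite (UNIV :: rat set)" using img by (metis finite_imageI)
    then show False by (simp add: infinite_UNIV_char_0)
  qed
  then have "bij_betw (enumerate first_occurrences) UNIV first_occurrences"
    by (rule bij_enumerate)
  moreover have "bij_betw nat_to_rat_surj first_occurrences UNIV"
    using inj img by (simp add: bij_betw_def)
  ultimately have "bij_betw (nat_to_rat_surj \<circ> enumerate first_occurrences) UNIV UNIV"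
    by (rule bij_betw_trans)
  then show ?thesis by (simp add: rat_enum_def[abs_def] comp_def)
qed

definition real_seq :: "nat \<Rightarrow> real" where
  "real_seq n = of_rat (rat_enum n)"

fun tuple_decode :: "nat \<Rightarrow> nat \<Rightarrow> nat list" where
  "tuple_decode 0 n = []"
| "tuple_decode (Suc 0) n = [n]"
| "tuple_decode (Suc (Suc k)) n =
     fst (prod_decode n) # tuple_decode (Suc k) (snd (prod_decode n))"

text \<open>
  \<open>to_nat_on UNIV\<close> numbers the coordinates by \<open>{..<CARD('m)}\<close>. Which numbering it is does not
  matter for computability, since two of them differ by a fixed permutation of a finite set.
\<close>

definition vec_seq :: "nat \<Rightarrow> real ^ 'm::finite" where
  "vec_seq n = (\<chi> i. real_seq (tuple_decode CARD('m) n ! to_nat_on (UNIV :: 'm set) i))"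

lemma length_tuple_decode [simp]: "length (tuple_decode k n) = k"
  by (induction k n rule: tuple_decode.induct) auto

lemma inj_tuple_decode: "0 < k \<Longrightarrow> tuple_decode k n = tuple_decode k n' \<Longrightarrow> n = n'"
proof (induction k n arbitrary: n' rule: tuple_decode.induct)
  case (3 k n)
  then have "fst (prod_decode n) = fst (prod_decode n')"
    "snd (prod_decode n) = snd (prod_decode n')" by auto
  then show ?case by (metis prod_eqI prod_decode_eq)
qed auto

lemma surj_tuple_decode: "0 < k \<Longrightarrow> length xs = k \<Longrightarrow> \<exists>n. tuple_decode k n = xs"
proof (induction k arbitrary: xs)
  case (Suc k)
  show ?case
  proof (cases k)
    case 0
    then show ?thesis using Suc.prems by (cases xs) auto
  next
    case (Suc k')
    obtain x ys where xs: "xs = x # ys" using Suc.prems by (cases xs) auto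
    obtain n where "tuple_decode k n = ys" using Suc.IH[of ys] Suc Suc.prems xs by auto
    then have "tuple_decode (Suc k) (prod_encode (x, n)) = xs" using Suc xs by simp
    then show ?thesis by blast
  qed
qed simp

lemma inj_real_seq: "inj real_seq"
proof (rule injI)
  fix a b assume "real_seq a = real_seq b"
  then have "rat_enum a = rat_enum b" by (simp add: real_seq_def)
  then show "a = b" using bij_is_inj[OF bij_rat_enum] by (simp add: inj_eq)
qed

lemma range_real_seq: "range real_seq = \<rat>"
proof -
  have "range real_seq = of_rat ` range rat_enum" by (auto simp: real_seq_def)
  also have "range rat_enum = UNIV" using bij_rat_enum by (rule bij_is_surj)
  finally show ?thesis by (simp add: Rats_def)
qed

lemma to_nat_on_UNIV_less: "to_nat_on (UNIV :: 'm::finite set) i < CARD('m)"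
  using to_nat_on_finite[of "UNIV :: 'm set"] by (auto simp: bij_betw_def)

lemma inj_vec_seq: "inj (vec_seq :: nat \<Rightarrow> real ^ 'm::finite)"
proof (rule injI)
  fix a b assume "(vec_seq a :: real ^ 'm) = vec_seq b"
  then have "tuple_decode CARD('m) a ! to_nat_on (UNIV :: 'm set) i
    = tuple_decode CARD('m) b ! to_nat_on (UNIV :: 'm set) i" for i
    using inj_real_seq by (simp add: vec_seq_def vec_eq_iff inj_eq)
  then have "tuple_decode CARD('m) a ! j = tuple_decode CARD('m) b ! j" if "j < CARD('m)" for j
    using to_nat_on_finite[of "UNIV :: 'm set"] that unfolding bij_betw_def
    by (metis finite imageE lessThan_iff)
  then have "tuple_decode CARD('m) a = tuple_decode CARD('m) b"
    by (simp add: list_eq_iff_nth_eq)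
  then show "a = b" by (rule inj_tuple_decode[rotated]) simp
qed

lemma range_vec_seq: "range (vec_seq :: nat \<Rightarrow> real ^ 'm::finite) = {v. \<forall>i. v $ i \<in> \<rat>}"
proof (intro equalityI subsetI)
  fix v :: "real ^ 'm" assume "v \<in> range vec_seq"
  then show "v \<in> {v. \<forall>i. v $ i \<in> \<rat>}"
    by (auto simp: vec_seq_def range_real_seq[symmetric])
next
  fix v :: "real ^ 'm" assume "v \<in> {v. \<forall>i. v $ i \<in> \<rat>}"
  then have "\<forall>i. \<exists>n. v $ i = real_seq n" by (auto simp: range_real_seq[symmetric] image_iff)
  then obtain h where h: "\<And>i. v $ i = real_seq (h i)" by metis
  let ?xs = "map (\<lambda>j. h (from_nat_into UNIV j)) [0..<CARD('m)]"
  obtain n where n: "tuple_decode CARD('m) n = ?xs"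
    using surj_tuple_decode[of "CARD('m)" ?xs] by auto
  have "vec_seq n = v"
    by (simp add: vec_seq_def n h vec_eq_iff to_nat_on_UNIV_less countable_finite)
  then show "v \<in> range vec_seq" by blast
qed

lemma dense_sequence_real_seq: "dense_sequence real_seq"
  by (simp add: dense_sequence_def inj_real_seq range_real_seq Rats_closure_real)

lemma dense_sequence_vec_seq: "dense_sequence (vec_seq :: nat \<Rightarrow> real ^ 'm::finite)"
proof -
  have "v \<in> closure (range vec_seq)" for v :: "real ^ 'm"
    unfolding closure_approachable
  proof (intro allI impI)
    fix e :: real assume e: "0 < e"
    have "\<forall>i. \<exists>q\<in>\<rat>. \<bar>q - v $ i\<bar> < e / CARD('m)"
    proof
      fix i
      have "v $ i \<in> closure \<rat>" by (simp add: Rats_closure_real)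
      moreover have "0 < e / CARD('m)" using e by simp
      ultimately show "\<exists>q\<in>\<rat>. \<bar>q - v $ i\<bar> < e / CARD('m)"
        unfolding closure_approachable dist_real_def by blast
    qed
    then obtain q where q: "\<And>i. q i \<in> \<rat>" "\<And>i. \<bar>q i - v $ i\<bar> < e / CARD('m)" by metis
    have "dist (\<chi> i. q i) v \<le> (\<Sum>i\<in>UNIV. \<bar>q i - v $ i\<bar>)"
      using norm_le_l1_cart[of "(\<chi> i. q i) - v"] by (simp add: dist_norm)
    also have "\<dots> < (\<Sum>i\<in>(UNIV :: 'm set). e / CARD('m))"
      by (rule sum_strict_mono) (auto simp: q)
    also have "\<dots> = e" by simp
    finally show "\<exists>y\<in>range vec_seq. dist y v < e"
      unfolding range_vec_seq using q(1) by (intro bexI[of _ "\<chi> i. q i"]) auto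
  qed
  then show ?thesis by (auto simp: dense_sequence_def inj_vec_seq)
qed


section \<open>Computable compact sets\<close>

text \<open>
  Extended-valued: the distance of the empty set to a nonempty set is \<open>\<infinity>\<close>.
\<close>

definition hausdorff_dist :: "'a::metric_space set \<Rightarrow> 'a set \<Rightarrow> ennreal" where
  "hausdorff_dist A B =
     max (SUP x\<in>A. INF y\<in>B. ennreal (dist x y)) (SUP y\<in>B. INF x\<in>A. ennreal (dist x y))"

text \<open>A pair \<open>(c, l)\<close> stands for the ball with centre \<open>vec_seq c\<close> and radius \<open>2\<^sup>-\<^sup>l\<close>.\<close>

definition computable_compact :: "(real ^ 'm::finite) set \<Rightarrow> bool" where
  "computable_compact S \<longleftrightarrow> compact S \<and>
     (\<exists>M. \<forall>n. \<exists>bs :: (nat \<times> int) list.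
        outputs [] M n (list_encode (map (\<lambda>(c, l). prod_encode (c, int_encode l)) bs)) \<and>
        hausdorff_dist (\<Union>(c, l)\<in>set bs. cball (vec_seq c) (2 powi (- l))) S < ennreal (1 / 2 ^ n))"


section \<open>Invariant measures and rotation sets\<close>

definition invariant_measures :: "('a::topological_space \<Rightarrow> 'a) \<Rightarrow> 'a measure set" where
  "invariant_measures f =
     {\<mu>. prob_space \<mu> \<and> sets \<mu> = sets borel \<and>
         (\<forall>A\<in>sets borel. f -` A \<in> sets borel \<and> emeasure \<mu> (f -` A) = emeasure \<mu> A)}"

definition rotation_set :: "('a::topological_space \<Rightarrow> 'a) \<Rightarrow> ('a \<Rightarrow> real ^ 'm) \<Rightarrow> (real ^ 'm) set"
  where "rotation_set f \<Phi> = {\<chi> i. (\<integral>x. \<Phi> x $ i \<partial>\<mu>) | \<mu>. \<mu> \<in> invariant_measures f}"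

definition periodic_point :: "('a \<Rightarrow> 'a) \<Rightarrow> 'a \<Rightarrow> nat \<Rightarrow> bool" where
  "periodic_point f q p \<longleftrightarrow> 0 < p \<and> (f ^^ p) q = q"

definition periodic_measure :: "('a::topological_space \<Rightarrow> 'a) \<Rightarrow> 'a \<Rightarrow> nat \<Rightarrow> 'a measure" where
  "periodic_measure f q p = distr (uniform_count_measure {..<p}) borel (\<lambda>i. (f ^^ i) q)"

lemma measure_periodic_measure:
  assumes "0 < p" "A \<in> sets borel"
  shows "measure (periodic_measure f q p) A = (\<Sum>i<p. indicator A ((f ^^ i) q)) / real p"
proof -
  have "measure (periodic_measure f q p) A
      = measure (uniform_count_measure {..<p}) {i. i < p \<and> (f ^^ i) q \<in> A}"
    unfolding periodic_measure_def using assms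
    by (subst measure_distr) (auto simp: space_uniform_count_measure sets_uniform_count_measure
        measurable_def Int_def intro!: arg_cong[where f = "measure _"])
  also have "\<dots> = card {i. i < p \<and> (f ^^ i) q \<in> A} / p"
    using assms by (subst measure_uniform_count_measure) auto
  also have "real (card {i. i < p \<and> (f ^^ i) q \<in> A}) = (\<Sum>i<p. indicator A ((f ^^ i) q))"
    by (simp add: indicator_def sum.If_cases Int_def)
  finally show ?thesis .
qed

definition conv_measures :: "'a::topological_space measure list \<Rightarrow> 'a measure set" where
  "conv_measures \<mu>s =
     {\<nu>. sets \<nu> = sets borel \<and>
         (\<exists>w :: nat \<Rightarrow> real. (\<forall>j<length \<mu>s. 0 \<le> w j) \<and> (\<Sum>j<length \<mu>s. w j) = 1 \<and>
            (\<forall>A\<in>sets borel. emeasure \<nu> A = (\<Sum>j<length \<mu>s. ennreal (w j) * emeasure (\<mu>s ! j) A)))}"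

definition modulus_of_continuity ::
  "('a::metric_space \<Rightarrow> 'b::real_normed_vector) \<Rightarrow> (nat \<Rightarrow> nat) \<Rightarrow> bool" where
  "modulus_of_continuity \<Phi> \<kappa> \<longleftrightarrow>
     (\<forall>\<alpha> \<beta> k. dist \<alpha> \<beta> < 1 / 2 ^ \<kappa> k \<longrightarrow> norm (\<Phi> \<alpha> - \<Phi> \<beta>) < 1 / 2 ^ k)"

end

theory Submission
  imports Defs
begin

text \<open>
  The averages of \<open>\<Phi>\<close> over the given periodic orbits lie in the convex set \<open>Rot(\<Phi>)\<close>, and by the
  partition property every rotation vector is close to their convex hull. A point of the hull is in
  turn close to an average of \<open>K\<close> of its vertices, where \<open>K\<close> depends only on the precision and on a
  bound for \<open>\<Phi>\<close>, so small balls around all such averages approximate \<open>Rot(\<Phi>)\<close>.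

  These averages are found by simulating the given machines with a step bound, the oracles for the
  points of an orbit being finite tables that are filled one from the other. If the bound suffices for
  all orbits at hand then the values are correct, and some bound does suffice; so everything is
  primitive recursive up to searches that succeed. Total functions built from such operations are
  computed by programs for a counter machine, whose registers are blocks of ones on the tapes of a
  Turing machine.

  Compactness of \<open>Rot(\<Phi>)\<close> is weak compactness of the set of invariant measures, obtained from Helly's
  theorem by coding the points of \<open>X\<close> as real numbers.
\<close>

section \<open>Counter programs on Turing machines\<close>

text \<open>The obstacle is that the partition and the convex weights of hypothesis (c) are only
  known to exist, so they can serve in estimates but not in the algorithm. Hence no weights are
  computed: all tuples of \<open>K\<close> orbit averages are taken, with repetitions. Convexity of
  the rotation set puts their means into it, which settles one half of the Hausdorff distance. For
  the other half, the hull estimate is combined with an error \<open>D / sqrt K\<close> that depends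
  on the diameter bound \<open>D\<close> but not on the number of orbits, which varies with
  \<open>n\<close>. Equality of points of \<open>X\<close> or of reals cannot be decided from
  oracles, so the algorithm decides nothing about them; its searches look for halting simulations
  and for numbers with decidable properties. Coordinates are handled as natural numbers, shifted by
  a bound \<open>B\<close> and scaled by \<open>2 ^ k\<close>, and rounding errors are counted in
  units of \<open>1 / 2 ^ k\<close>. Compactness needs weak limits of invariant measures to be
  invariant, hence \<open>f\<close> continuous. Continuity is extracted from computability: an
  output depends on finitely many oracle values.\<close>

datatype com = Skip | Inc nat | Dec nat | Seq com com | Cond nat com com | While nat com

inductive big :: "com \<Rightarrow> (nat \<Rightarrow> nat) \<Rightarrow> (nat \<Rightarrow> nat) \<Rightarrow> bool" where
  big_Skip: "big Skip s s"
| big_Inc: "big (Inc r) s (s(r := Suc (s r)))"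
| big_Dec: "big (Dec r) s (s(r := s r - 1))"
| big_Seq: "big c s s' \<Longrightarrow> big d s' s'' \<Longrightarrow> big (Seq c d) s s''"
| big_If1: "0 < s r \<Longrightarrow> big c s s' \<Longrightarrow> big (Cond r c d) s s'"
| big_If0: "s r = 0 \<Longrightarrow> big d s s' \<Longrightarrow> big (Cond r c d) s s'"
| big_While0: "s r = 0 \<Longrightarrow> big (While r c) s s"
| big_While1: "0 < s r \<Longrightarrow> big c s s' \<Longrightarrow> big (While r c) s' s'' \<Longrightarrow> big (While r c) s s''"

fun regs :: "com \<Rightarrow> nat set" where
  "regs Skip = {}"
| "regs (Inc r) = {r}"
| "regs (Dec r) = {r}"
| "regs (Seq c d) = regs c \<union> regs d"
| "regs (Cond r c d) = insert r (regs c \<union> regs d)"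
| "regs (While r c) = insert r (regs c)"

lemma finite_regs: "finite (regs c)"
  by (induction c) auto

text \<open>
  \<open>Trans r x y\<close> acts on tape \<open>r\<close> only: \<open>x\<close> is the symbol written, the move and the next state
  if the scanned symbol is not \<open>1\<close>, and \<open>y\<close> is the same for the scanned symbol \<open>1\<close>.
\<close>

datatype trans = Trans nat "nat \<times> move \<times> nat" "nat \<times> move \<times> nat"

fun csize :: "com \<Rightarrow> nat" where
  "csize Skip = 0"
| "csize (Inc r) = 2"
| "csize (Dec r) = 1"
| "csize (Seq c d) = csize c + csize d"
| "csize (Cond r c d) = csize c + csize d + 2"
| "csize (While r c) = csize c + 2"

text \<open>
  Register \<open>r\<close> is held by tape \<open>r\<close> as the block of ones starting at the head, and the cells to the
  left of the head are arbitrary. So \<open>Inc\<close> steps left and writes a one, \<open>Dec\<close> steps right.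
\<close>

fun code :: "com \<Rightarrow> nat \<Rightarrow> trans list" where
  "code Skip q = []"
| "code (Inc r) q =
     [Trans r (0, MLeft, q + 1) (1, MLeft, q + 1), Trans r (1, MStay, q + 2) (1, MStay, q + 2)]"
| "code (Dec r) q = [Trans r (0, MStay, q + 1) (1, MRight, q + 1)]"
| "code (Seq c d) q = code c q @ code d (q + csize c)"
| "code (Cond r c d) q =
     [Trans r (0, MStay, q + csize c + 2) (1, MStay, q + 1)] @ code c (q + 1) @
     [Trans r (0, MStay, q + csize c + csize d + 2) (1, MStay, q + csize c + csize d + 2)] @
     code d (q + csize c + 2)"
| "code (While r c) q =
     [Trans r (0, MStay, q + csize c + 2) (1, MStay, q + 1)] @ code c (q + 1) @
     [Trans r (0, MStay, q) (1, MStay, q)]"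

lemma length_code [simp]: "length (code c q) = csize c"
  by (induction c arbitrary: q) auto

text \<open>A rule of the machine fixes the symbols on all tapes at once, so one transition expands
  into a rule for every vector of bits. The idle tapes rewrite their own symbol and stay.\<close>

fun trans_rules :: "nat \<Rightarrow> nat \<Rightarrow> trans \<Rightarrow> rule list" where
  "trans_rules k q (Trans r x y) =
     map (\<lambda>as. let (w, d, n) = if as ! r = 1 then y else x
                in Step q as n (map (\<lambda>i. if i = r then (w, d) else (as ! i, MStay)) [0..<k + 1]))
       (List.n_lists (k + 1) [0, 1])"

definition code_tm :: "nat \<Rightarrow> trans list \<Rightarrow> tm" where
  "code_tm k cs = TM k (concat (map (\<lambda>q. trans_rules k q (cs ! q)) [0..<length cs]))"

lemma first_rule_None: "\<forall>r\<in>set rs. apply_rule os r c = None \<Longrightarrow> first_rule os rs c = None"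
  by (induction rs) auto

text \<open>The order of the rules is irrelevant once all applicable rules agree, which spares
  locating a rule inside the concatenated program.\<close>

lemma first_rule_unique:
  "r \<in> set rs \<Longrightarrow> apply_rule os r c = Some d \<Longrightarrow>
    \<forall>r\<in>set rs. apply_rule os r c \<in> {None, Some d} \<Longrightarrow> first_rule os rs c = Some d"
  by (induction rs) (auto split: option.splits)

text \<open>The invariant under which every vector of scanned symbols is among those for which
  \<open>trans_rules\<close> provides a rule.\<close>

definition binary_tape :: "tape \<Rightarrow> bool" where
  "binary_tape t \<longleftrightarrow> set (fst t) \<subseteq> {0, 1} \<and> set (snd t) \<subseteq> {0, 1}"

lemma binary_tape_read: "binary_tape t \<Longrightarrow> tape_read t \<in> {0, 1}"
  by (cases t rule: tape_read.cases) (auto simp: binary_tape_def)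

lemma binary_tape_write: "binary_tape t \<Longrightarrow> w \<in> {0, 1} \<Longrightarrow> binary_tape (tape_write w t)"
  by (cases t; cases "snd t") (auto simp: binary_tape_def)

lemma binary_tape_move: "binary_tape t \<Longrightarrow> binary_tape (tape_move d t)"
  by (cases "(d, t)" rule: tape_move.cases; cases "snd t") (auto simp: binary_tape_def)

lemma tape_read_zero_iff: "binary_tape t \<Longrightarrow> nat_of_tape t = 0 \<longleftrightarrow> tape_read t \<noteq> 1"
  by (cases t rule: tape_read.cases) (auto simp: binary_tape_def nat_of_tape_def)

text \<open>Rewriting the scanned symbol turns an empty right half into \<open>[0]\<close>, so an
  idle tape is preserved only as a number, not literally.\<close>

lemma nat_of_tape_rewrite: "nat_of_tape (tape_write (tape_read t) t) = nat_of_tape t"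
  by (cases t rule: tape_read.cases) (auto simp: nat_of_tape_def)

lemma nat_of_tape_left_write:
  "nat_of_tape (tape_write 1 (tape_move MLeft (tape_write (tape_read t) t))) = Suc (nat_of_tape t)"
  by (cases t rule: tape_read.cases; cases "fst t") (auto simp: nat_of_tape_def)

lemma nat_of_tape_right:
  "tape_read t = 1 \<Longrightarrow> nat_of_tape (tape_move MRight (tape_write 1 t)) = nat_of_tape t - 1"
  by (cases t rule: tape_read.cases) (auto simp: nat_of_tape_def)

fun trans_act :: "trans \<Rightarrow> tape list \<Rightarrow> nat \<times> move \<times> nat" where
  "trans_act (Trans r x y) ts = (if tape_read (ts ! r) = 1 then y else x)"

fun trans_reg :: "trans \<Rightarrow> nat" where
  "trans_reg (Trans r x y) = r"

abbreviation reaches :: "nat \<Rightarrow> trans list \<Rightarrow> config \<Rightarrow> config \<Rightarrow> bool" where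
  "reaches k cs \<equiv> (\<lambda>c d. tm_step [] (code_tm k cs) c = Some d)\<^sup>*\<^sup>*"

lemma code_tm_step:
  assumes ts: "length ts = k + 1" "\<forall>t\<in>set ts. binary_tape t"
    and q: "q < length cs" and r: "trans_reg (cs ! q) \<le> k"
    and act: "trans_act (cs ! q) ts = (w, d, n)"
  shows "tm_step [] (code_tm k cs) (q, ts) =
    Some (n, map (\<lambda>i. if i = trans_reg (cs ! q) then tape_move d (tape_write w (ts ! i))
                       else tape_write (tape_read (ts ! i)) (ts ! i)) [0..<k + 1])"
    (is "_ = Some ?c")
proof -
  obtain r x y where tr: "cs ! q = Trans r x y" by (cases "cs ! q")
  let ?as = "map tape_read ts"
  let ?rs = "concat (map (\<lambda>q. trans_rules k q (cs ! q)) [0..<length cs])"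
  have asin: "?as \<in> set (List.n_lists (k + 1) [0, 1])"
    unfolding set_n_lists using ts binary_tape_read by (auto simp: subset_iff)
  let ?r = "Step q ?as n (map (\<lambda>i. if i = r then (w, d) else (?as ! i, MStay)) [0..<k + 1])"
  have "?r \<in> set (trans_rules k q (cs ! q))"
    using asin act r tr ts unfolding tr trans_rules.simps set_map
    by (intro image_eqI[where x = ?as]) (auto simp: Let_def split: if_splits)
  then have mem: "?r \<in> set ?rs" using q by auto
  have app: "apply_rule [] ?r (q, ts) = Some ?c"
    using ts by (auto simp: tr simp del: upt_Suc intro!: nth_equalityI)
  have "apply_rule [] r' (q, ts) \<in> {None, Some ?c}" if "r' \<in> set ?rs" for r'
  proof -
    obtain q' where q': "q' < length cs" "r' \<in> set (trans_rules k q' (cs ! q'))" using \<open>r' \<in> set ?rs\<close> by auto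
    obtain r2 x2 y2 where tr2: "cs ! q' = Trans r2 x2 y2" by (cases "cs ! q'")
    from q'(2) obtain as where as: "r' = (let (w, d, n) = if as ! r2 = 1 then y2 else x2
                in Step q' as n (map (\<lambda>i. if i = r2 then (w, d) else (as ! i, MStay)) [0..<k + 1]))"
      by (auto simp: tr2)
    show ?thesis
    proof (cases "q' = q \<and> as = ?as")
      case True
      then have "r' = ?r" using as tr tr2 act r ts by (auto simp: Let_def split: if_splits)
      then show ?thesis using app by simp
    next
      case False
      then show ?thesis using as by (auto simp: Let_def split: prod.splits)
    qed
  qed
  then have "first_rule [] ?rs (q, ts) = Some ?c"
    using mem app by (intro first_rule_unique) auto
  then show ?thesis by (simp add: tm_step_def code_tm_def)
qed

definition holds_regs :: "nat \<Rightarrow> (nat \<Rightarrow> nat) \<Rightarrow> tape list \<Rightarrow> bool" where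
  "holds_regs k s ts \<longleftrightarrow> length ts = k + 1 \<and> (\<forall>t\<in>set ts. binary_tape t) \<and>
     (\<forall>i\<le>k. nat_of_tape (ts ! i) = s i)"

text \<open>Jump targets in \<open>code c q\<close> are absolute, so fragments are followed in place
  inside one fixed program \<open>cs\<close>.\<close>

definition code_at :: "trans list \<Rightarrow> nat \<Rightarrow> trans list \<Rightarrow> bool" where
  "code_at cs q ds \<longleftrightarrow> q + length ds \<le> length cs \<and> (\<forall>i<length ds. cs ! (q + i) = ds ! i)"

lemma code_at_append: "code_at cs q (ds @ es) \<longleftrightarrow> code_at cs q ds \<and> code_at cs (q + length ds) es"
proof
  assume *: "code_at cs q (ds @ es)"
  then have **: "i < length ds + length es \<Longrightarrow> cs ! (q + i) = (ds @ es) ! i" for i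
    by (auto simp: code_at_def)
  have "cs ! (q + length ds + i) = es ! i" if "i < length es" for i
    using **[of "length ds + i"] that by (simp add: add.assoc)
  moreover have "cs ! (q + i) = ds ! i" if "i < length ds" for i
    using **[of i] that by (simp add: nth_append)
  ultimately show "code_at cs q ds \<and> code_at cs (q + length ds) es"
    using * by (auto simp: code_at_def)
next
  assume *: "code_at cs q ds \<and> code_at cs (q + length ds) es"
  have "cs ! (q + i) = (ds @ es) ! i" if "i < length ds + length es" for i
  proof (cases "i < length ds")
    case False
    then obtain j where "i = length ds + j" using le_Suc_ex not_less by blast
    then show ?thesis using * that by (auto simp: code_at_def add.assoc)
  qed (use * in \<open>auto simp: code_at_def nth_append\<close>)
  then show "code_at cs q (ds @ es)" using * by (auto simp: code_at_def)
qed

lemma code_at_Cons: "code_at cs q (d # ds) \<longleftrightarrow> q < length cs \<and> cs ! q = d \<and> code_at cs (Suc q) ds"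
  using code_at_append[of cs q "[d]" ds] by (auto simp: code_at_def)

text \<open>The conclusion retains the exact tape \<open>r\<close>, because the left half, which
  \<open>Inc\<close> moves into, is not visible in the register contents.\<close>

lemma code_tm_step':
  assumes ts: "holds_regs k s ts" and q: "code_at cs q [Trans r (w0, d0, n0) (w1, d1, n1)]" and r: "r \<le> k"
    and act: "if s r = 0 then (w, d, n) = (w0, d0, n0) else (w, d, n) = (w1, d1, n1)"
    and w: "w \<in> {0, 1}" and s': "s' r = nat_of_tape (tape_move d (tape_write w (ts ! r)))" "\<And>i. i \<noteq> r \<Longrightarrow> s' i = s i"
  shows "\<exists>ts'. tm_step [] (code_tm k cs) (q, ts) = Some (n, ts') \<and> holds_regs k s' ts' \<and>
    ts' ! r = tape_move d (tape_write w (ts ! r))"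
proof -
  have bt: "binary_tape (ts ! i)" if "i \<le> k" for i
    using ts that by (auto simp: holds_regs_def)
  have "s r = 0 \<longleftrightarrow> tape_read (ts ! r) \<noteq> 1"
    using tape_read_zero_iff[OF bt[OF r]] ts r by (simp add: holds_regs_def)
  then have act': "trans_act (cs ! q) ts = (w, d, n)" using q act by (auto simp: code_at_def split: if_splits)
  have "trans_reg (cs ! q) = r" "q < length cs" using q by (auto simp: code_at_def)
  let ?t = "\<lambda>i. if i = r then tape_move d (tape_write w (ts ! i))
                   else tape_write (tape_read (ts ! i)) (ts ! i)"
  let ?ts' = "map ?t [0..<k + 1]"
  have nth: "?ts' ! i = ?t i" if "i \<le> k" for i
    using that nth_map_upt[of i "k + 1" 0 ?t] by simp
  have "tm_step [] (code_tm k cs) (q, ts) = Some (n, ?ts')"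
    using code_tm_step[OF _ _ _ _ act', where k = k] ts r \<open>trans_reg (cs ! q) = r\<close> \<open>q < length cs\<close>
    by (simp add: holds_regs_def del: upt_Suc)
  moreover have "binary_tape (?t i)" if "i \<le> k" for i
    using bt[OF that] w binary_tape_read[OF bt[OF that]]
    by (auto intro!: binary_tape_write binary_tape_move)
  then have "\<forall>t\<in>set ?ts'. binary_tape t"
    unfolding set_map ball_simps by (simp del: upt_Suc if_image_distrib)
  moreover have "nat_of_tape (?ts' ! i) = s' i" if "i \<le> k" for i
    unfolding nth[OF that] using s' ts that by (auto simp: nat_of_tape_rewrite holds_regs_def)
  ultimately show ?thesis using nth[OF r]
    by (intro exI[of _ ?ts'] conjI) (auto simp: holds_regs_def simp del: upt_Suc)
qed

lemma code_tm_jump: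
  assumes "holds_regs k s ts" "code_at cs q [Trans r (0, MStay, n0) (1, MStay, n1)]" "r \<le> k"
  shows "\<exists>ts'. tm_step [] (code_tm k cs) (q, ts) = Some (if s r = 0 then n0 else n1, ts') \<and> holds_regs k s ts'"
proof -
  have bt: "binary_tape (ts ! r)" "nat_of_tape (ts ! r) = s r"
    using assms by (auto simp: holds_regs_def)
  let ?w = "if s r = 0 then 0 else 1"
  have "tape_read (ts ! r) = ?w" using tape_read_zero_iff[OF bt(1)] binary_tape_read[OF bt(1)] bt(2) by auto
  then show ?thesis
    using code_tm_step'[OF assms, of ?w MStay "if s r = 0 then n0 else n1" s]
      nat_of_tape_rewrite[of "ts ! r"] bt(2) by auto
qed

text \<open>The induction is on the run and not on the program: a further round of a loop re-enters
  the same code at the same address \<open>q\<close>.\<close>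

lemma code_correct:
  assumes "big c s s'" "regs c \<subseteq> {..k}" "code_at cs q (code c q)" "holds_regs k s ts"
  shows "\<exists>ts'. holds_regs k s' ts' \<and>
    reaches k cs (q, ts) (q + csize c, ts')"
  using assms
proof (induction arbitrary: q ts rule: big.induct)
  case (big_Skip s)
  then show ?case by auto
next
  case (big_Inc r s)
  then have r: "r \<le> k" and c1: "code_at cs q [Trans r (0, MLeft, q + 1) (1, MLeft, q + 1)]"
    and c2: "code_at cs (q + 1) [Trans r (1, MStay, q + 2) (1, MStay, q + 2)]"
    by (auto simp: code_at_Cons code_at_def[of _ _ "[]"])
  have bt: "binary_tape (ts ! r)" "nat_of_tape (ts ! r) = s r"
    using big_Inc r by (auto simp: holds_regs_def)
  let ?t = "tape_move MLeft (tape_write (tape_read (ts ! r)) (ts ! r))"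
  define w where "w = tape_read (ts ! r)"
  have w: "w \<in> {0, 1}" "w = (if s r = 0 then 0 else 1)" using bt binary_tape_read[OF bt(1)] tape_read_zero_iff[OF bt(1)] by (auto simp: w_def)
  have act: "if s r = 0 then (w, MLeft, q + 1) = (0, MLeft, q + 1) else (w, MLeft, q + 1) = (1, MLeft, q + 1)"
    using w(2) by simp
  \<comment> \<open>After the move to the left the block may have absorbed an unknown cell. The
    content of register \<open>r\<close> is therefore only named here; the write that follows makes
    it \<open>Suc (s r)\<close>.\<close>
  have "\<exists>ts1. tm_step [] (code_tm k cs) (q, ts) = Some (q + 1, ts1) \<and>
      holds_regs k (s(r := nat_of_tape ?t)) ts1 \<and> ts1 ! r = tape_move MLeft (tape_write w (ts ! r))"
    by (rule code_tm_step'[OF big_Inc(3) c1 r act w(1)]) (auto simp: w_def)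
  then obtain ts1 where ts1: "tm_step [] (code_tm k cs) (q, ts) = Some (q + 1, ts1)"
    "holds_regs k (s(r := nat_of_tape ?t)) ts1" "ts1 ! r = ?t"
    unfolding w_def by blast
  obtain ts2 where ts2: "tm_step [] (code_tm k cs) (q + 1, ts1) = Some (q + 2, ts2)"
    "holds_regs k (s(r := Suc (s r))) ts2"
    using code_tm_step'[OF ts1(2) c2 r, of 1 MStay "q + 2" "s(r := Suc (s r))"] ts1(3)
      nat_of_tape_left_write[of "ts ! r"] bt(2)
    by auto
  show ?case using ts1(1) ts2
    by (intro exI[of _ ts2] conjI) (simp_all add: converse_rtranclp_into_rtranclp del: fun_upd_apply)
next
  case (big_Dec r s)
  then have r: "r \<le> k" and c1: "code_at cs q [Trans r (0, MStay, q + 1) (1, MRight, q + 1)]"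
    by (auto simp: code_at_Cons)
  have bt: "binary_tape (ts ! r)" "nat_of_tape (ts ! r) = s r"
    using big_Dec r by (auto simp: holds_regs_def)
  note rd = tape_read_zero_iff[OF bt(1)] binary_tape_read[OF bt(1)]
  have "\<exists>ts'. tm_step [] (code_tm k cs) (q, ts) = Some (q + 1, ts') \<and> holds_regs k (s(r := s r - 1)) ts'"
  proof (cases "s r = 0")
    case True
    then have "nat_of_tape (tape_write 0 (ts ! r)) = 0"
      using nat_of_tape_rewrite[of "ts ! r"] rd bt(2) by auto
    then show ?thesis
      using code_tm_step'[OF big_Dec(3) c1 r, of 0 MStay "q + 1" "s(r := s r - 1)"] True by auto
  next
    case False
    then show ?thesis
      using code_tm_step'[OF big_Dec(3) c1 r, of 1 MRight "q + 1" "s(r := s r - 1)"]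
        nat_of_tape_right[of "ts ! r"] rd bt(2) by auto
  qed
  then obtain ts' where "tm_step [] (code_tm k cs) (q, ts) = Some (q + 1, ts')" "holds_regs k (s(r := s r - 1)) ts'"
    by blast
  then show ?case by (intro exI[of _ ts'] conjI) (simp_all add: r_into_rtranclp del: fun_upd_apply)
next
  case (big_Seq c s s' d s'')
  then have c1: "code_at cs q (code c q)" and c2: "code_at cs (q + csize c) (code d (q + csize c))"
    by (auto simp: code_at_append)
  obtain ts1 where ts1: "holds_regs k s' ts1"
    "reaches k cs (q, ts) (q + csize c, ts1)"
    using big_Seq.IH(1)[OF _ c1 big_Seq.prems(3)] big_Seq.prems(1) by auto
  obtain ts2 where ts2: "holds_regs k s'' ts2"
    "reaches k cs (q + csize c, ts1) (q + csize c + csize d, ts2)"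
    using big_Seq.IH(2)[OF _ c2 ts1(1)] big_Seq.prems(1) by auto
  show ?case using rtranclp_trans[OF ts1(2) ts2(2)] ts2(1) by (auto simp: add.assoc)
next
  case (big_If1 s r c s' d)
  have c1: "code_at cs q [Trans r (0, MStay, q + csize c + 2) (1, MStay, q + 1)]" "r \<le> k"
    and c2: "code_at cs (q + 1) (code c (q + 1))"
    and c3: "code_at cs (q + csize c + 1)
       [Trans r (0, MStay, q + csize c + csize d + 2) (1, MStay, q + csize c + csize d + 2)]"
    using big_If1.prems by (auto simp: code_at_append code_at_Cons code_at_def[of _ _ "[]"] add.commute add.left_commute)
  obtain ts1 where ts1: "tm_step [] (code_tm k cs) (q, ts) = Some (q + 1, ts1)" "holds_regs k s ts1"
    using code_tm_jump[OF big_If1.prems(3) c1] big_If1.hyps by auto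
  obtain ts2 where ts2: "holds_regs k s' ts2"
    "reaches k cs (q + 1, ts1) (q + 1 + csize c, ts2)"
    using big_If1.IH[OF _ c2 ts1(2)] big_If1.prems by auto
  obtain ts3 where ts3: "tm_step [] (code_tm k cs) (q + csize c + 1, ts2) = Some (q + csize c + csize d + 2, ts3)"
    "holds_regs k s' ts3"
    using code_tm_jump[OF ts2(1) c3 c1(2)] by auto
  have "reaches k cs (q + 1, ts1) (q + csize c + csize d + 2, ts3)"
    using ts2(2) ts3(1) by (auto intro: rtranclp.rtrancl_into_rtrancl)
  then show ?case using ts1(1) ts3
    by (intro exI[of _ ts3]) (auto intro!: converse_rtranclp_into_rtranclp[of _ "(q, ts)"] simp: add_ac)
next
  case (big_If0 s r d s' c)
  have c1: "code_at cs q [Trans r (0, MStay, q + csize c + 2) (1, MStay, q + 1)]" "r \<le> k"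
    and c2: "code_at cs (q + csize c + 2) (code d (q + csize c + 2))"
    using big_If0.prems by (auto simp: code_at_append code_at_Cons code_at_def[of _ _ "[]"] add.commute add.left_commute)
  obtain ts1 where ts1: "tm_step [] (code_tm k cs) (q, ts) = Some (q + csize c + 2, ts1)" "holds_regs k s ts1"
    using code_tm_jump[OF big_If0.prems(3) c1] big_If0.hyps by auto
  obtain ts2 where ts2: "holds_regs k s' ts2"
    "reaches k cs (q + csize c + 2, ts1) (q + csize c + 2 + csize d, ts2)"
    using big_If0.IH[OF _ c2 ts1(2)] big_If0.prems by auto
  show ?case using ts1(1) ts2
    by (intro exI[of _ ts2]) (auto intro!: converse_rtranclp_into_rtranclp[of _ "(q, ts)"] simp: add_ac)
next
  case (big_While0 s r c)
  have c1: "code_at cs q [Trans r (0, MStay, q + csize c + 2) (1, MStay, q + 1)]" "r \<le> k"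
    using big_While0.prems by (auto simp: code_at_append code_at_Cons code_at_def[of _ _ "[]"])
  show ?case
    using code_tm_jump[OF big_While0.prems(3) c1] big_While0.hyps by (auto simp: add_ac)
next
  case (big_While1 s r c s' s'')
  have c1: "code_at cs q [Trans r (0, MStay, q + csize c + 2) (1, MStay, q + 1)]" "r \<le> k"
    and c2: "code_at cs (q + 1) (code c (q + 1))"
    and c3: "code_at cs (q + csize c + 1) [Trans r (0, MStay, q) (1, MStay, q)]"
    using big_While1.prems by (auto simp: code_at_append code_at_Cons code_at_def[of _ _ "[]"])
  obtain ts1 where ts1: "tm_step [] (code_tm k cs) (q, ts) = Some (q + 1, ts1)" "holds_regs k s ts1"
    using code_tm_jump[OF big_While1.prems(3) c1] big_While1.hyps by auto
  obtain ts2 where ts2: "holds_regs k s' ts2"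
    "reaches k cs (q + 1, ts1) (q + 1 + csize c, ts2)"
    using big_While1.IH(1)[OF _ c2 ts1(2)] big_While1.prems by auto
  obtain ts3 where ts3: "tm_step [] (code_tm k cs) (q + csize c + 1, ts2) = Some (q, ts3)"
    "holds_regs k s' ts3"
    using code_tm_jump[OF ts2(1) c3 c1(2)] by auto
  obtain ts4 where ts4: "holds_regs k s'' ts4"
    "reaches k cs (q, ts3) (q + csize (While r c), ts4)"
    using big_While1.IH(2)[OF big_While1.prems(1,2) ts3(2)] by auto
  have "reaches k cs (q + 1, ts1) (q, ts3)"
    using ts2(2) ts3(1) by (auto intro: rtranclp.rtrancl_into_rtrancl)
  then show ?case using ts1(1) ts4
    by (intro exI[of _ ts4]) (auto intro!: converse_rtranclp_into_rtranclp[of _ "(q, ts)"])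
qed

lemma computable_nat_funI:
  assumes "\<And>n. \<exists>s. big c ((\<lambda>_. 0)(0 := n)) s \<and> s 0 = F n"
  shows "computable_nat_fun F"
proof -
  obtain k where k: "regs c \<subseteq> {..k}" using finite_regs[of c] finite_nat_iff_bounded_le by auto
  let ?M = "code_tm k (code c 0)"
  have "outputs [] ?M n (F n)" for n
  proof -
    obtain s where s: "big c ((\<lambda>_. 0)(0 := n)) s" "s 0 = F n" using assms by blast
    obtain ts where ts: "init_config ?M n = (0, ts)" "holds_regs k ((\<lambda>_. 0)(0 := n)) ts"
    proof
      have "takeWhile (\<lambda>a. a = 1) (replicate n (1 :: nat)) = replicate n 1"
        by (induction n) auto
      then show "holds_regs k ((\<lambda>_. 0)(0 := n)) (tape_of_nat n # replicate k ([], []))"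
        by (auto simp: holds_regs_def binary_tape_def tape_of_nat_def nat_of_tape_def nth_Cons split: nat.splits)
    qed (simp add: init_config_def code_tm_def)
    have "code_at (code c 0) 0 (code c 0)" by (simp add: code_at_def)
    from code_correct[OF s(1) k this ts(2)] obtain ts' where ts': "holds_regs k s ts'"
      "(\<lambda>c d. tm_step [] ?M c = Some d)\<^sup>*\<^sup>* (0, ts) (csize c, ts')" by auto
    \<comment> \<open>The state \<open>csize c\<close> lies just behind the program and has no
      rules.\<close>
    have "tm_step [] ?M (csize c, ts') = None"
      unfolding tm_step_def code_tm_def tm.sel
    proof (rule first_rule_None, clarsimp)
      fix r q
      show "r \<in> set (trans_rules k q (code c 0 ! q)) \<Longrightarrow> q < csize c \<Longrightarrow>
        apply_rule [] r (csize c, ts') = None"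
        by (cases "code c 0 ! q") (auto simp: Let_def split: prod.splits)
    qed
    then show ?thesis unfolding outputs_def ts(1) using ts' s(2)
      by (intro exI[of _ "(csize c, ts')"]) (simp add: holds_regs_def)
  qed
  then show ?thesis by (auto simp: computable_nat_fun_def)
qed

section \<open>Functions computed by counter programs\<close>

text \<open>
  A program is relative to a base register \<open>b\<close> for argument and result. The registers above \<open>b\<close> are
  its scratch space, clean before and after the run, so programs can be nested by raising \<open>b\<close>.
\<close>

definition computes :: "(nat \<Rightarrow> com) \<Rightarrow> (nat \<Rightarrow> nat) \<Rightarrow> bool" where
  "computes p F \<longleftrightarrow> (\<forall>b s. (\<forall>r>b. s r = 0) \<longrightarrow> big (p b) s (s(b := F (s b))))"

definition recursive :: "(nat \<Rightarrow> nat) \<Rightarrow> bool" where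
  "recursive F \<longleftrightarrow> (\<exists>p. computes p F)"

lemma computesD: "computes p F \<Longrightarrow> (\<And>r. b < r \<Longrightarrow> s r = 0) \<Longrightarrow> s' = s(b := F (s b)) \<Longrightarrow> big (p b) s s'"
  by (auto simp: computes_def)

lemma recursiveI:
  assumes "\<And>b s. (\<And>r. b < r \<Longrightarrow> s r = 0) \<Longrightarrow> big (p b) s (s(b := F (s b)))"
  shows "recursive F"
  using assms by (auto simp: recursive_def computes_def)

lemma recursive_imp_computable_nat_fun:
  assumes "recursive F"
  shows "computable_nat_fun F"
proof -
  obtain p where "computes p F" using assms by (auto simp: recursive_def)
  then have "big (p 0) ((\<lambda>_. 0)(0 := n)) ((\<lambda>_. 0)(0 := F n))" for n
    by (rule computesD) auto
  then have "\<exists>s. big (p 0) ((\<lambda>_. 0)(0 := n)) s \<and> s 0 = F n" for n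
    by (intro exI[of _ "(\<lambda>_. 0)(0 := F n)"]) simp
  then show ?thesis by (rule computable_nat_funI)
qed

section \<open>Moving, copying, pairing and unpairing of registers\<close>

lemma big_IncI: "s' = s(r := Suc (s r)) \<Longrightarrow> big (Inc r) s s'"
  by (simp add: big_Inc)

lemma big_DecI: "s' = s(r := s r - 1) \<Longrightarrow> big (Dec r) s s'"
  using big_Dec by simp

definition clear :: "nat \<Rightarrow> com" where
  "clear r = While r (Dec r)"

lemma big_clear: "s' = s(r := 0) \<Longrightarrow> big (clear r) s s'"
proof (induction "s r" arbitrary: s)
  case 0
  then show ?case unfolding clear_def by (simp add: fun_upd_idem big_While0)
next
  case (Suc n)
  have "big (While r (Dec r)) (s(r := s r - 1)) s'"
    unfolding clear_def[symmetric] by (rule Suc.hyps) (use Suc in auto)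
  then show ?case unfolding clear_def by (rule big_While1[OF _ big_Dec, rotated]) (use Suc(2) in simp)
qed

definition move_reg :: "nat \<Rightarrow> nat \<Rightarrow> com" where
  "move_reg a b = While a (Seq (Dec a) (Inc b))"

lemma big_move_reg: "a \<noteq> b \<Longrightarrow> s' = s(a := 0, b := s b + s a) \<Longrightarrow> big (move_reg a b) s s'"
proof (induction "s a" arbitrary: s)
  case 0
  then show ?case unfolding move_reg_def by (simp add: fun_upd_idem big_While0)
next
  case (Suc n)
  let ?s = "s(a := s a - 1, b := Suc (s b))"
  have loop: "big (While a (Seq (Dec a) (Inc b))) ?s s'"
    unfolding move_reg_def[symmetric] by (rule Suc.hyps) (use Suc in \<open>auto simp: fun_eq_iff\<close>)
  have step: "big (Seq (Dec a) (Inc b)) s ?s"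
    using big_Seq[OF big_Dec[of a s] big_Inc[of b]] Suc.prems(1) by simp
  show ?case unfolding move_reg_def by (rule big_While1[OF _ step loop]) (use Suc(2) in simp)
qed

definition move2_reg :: "nat \<Rightarrow> nat \<Rightarrow> nat \<Rightarrow> com" where
  "move2_reg a b c = While a (Seq (Dec a) (Seq (Inc b) (Inc c)))"

lemma big_move2_reg:
  "distinct [a, b, c] \<Longrightarrow> s' = s(a := 0, b := s b + s a, c := s c + s a) \<Longrightarrow> big (move2_reg a b c) s s'"
proof (induction "s a" arbitrary: s)
  case 0
  then show ?case unfolding move2_reg_def by (simp add: fun_upd_idem big_While0)
next
  case (Suc n)
  let ?s = "s(a := s a - 1, b := Suc (s b), c := Suc (s c))"
  have loop: "big (While a (Seq (Dec a) (Seq (Inc b) (Inc c)))) ?s s'"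
    unfolding move2_reg_def[symmetric] by (rule Suc.hyps) (use Suc in \<open>auto simp: fun_eq_iff\<close>)
  have step: "big (Seq (Dec a) (Seq (Inc b) (Inc c))) s ?s"
    using big_Seq[OF big_Dec[of a s] big_Seq[OF big_Inc[of b] big_Inc[of c]]] Suc.prems(1) by simp
  show ?case unfolding move2_reg_def by (rule big_While1[OF _ step loop]) (use Suc(2) in simp)
qed

definition copy_reg :: "nat \<Rightarrow> nat \<Rightarrow> nat \<Rightarrow> com" where
  "copy_reg a b c = Seq (move2_reg a b c) (move_reg c a)"

lemma big_copy_reg:
  "distinct [a, b, c] \<Longrightarrow> s c = 0 \<Longrightarrow> s' = s(b := s b + s a) \<Longrightarrow> big (copy_reg a b c) s s'"
  unfolding copy_reg_def
  by (rule big_Seq[OF big_move2_reg[OF _ refl] big_move_reg]) (auto simp: fun_eq_iff)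

text \<open>Needed for pairing, as \<open>prod_encode (m, n)\<close> is
  \<open>triangle (m + n) + m\<close>. A triangular number is the sum of a countdown.\<close>

definition add_triangle :: "nat \<Rightarrow> nat \<Rightarrow> nat \<Rightarrow> com" where
  "add_triangle z a t = While z (Seq (copy_reg z a t) (Dec z))"

lemma big_add_triangle:
  "distinct [z, a, t] \<Longrightarrow> s t = 0 \<Longrightarrow> s' = s(z := 0, a := s a + triangle (s z)) \<Longrightarrow>
    big (add_triangle z a t) s s'"
proof (induction "s z" arbitrary: s)
  case 0
  then show ?case unfolding add_triangle_def by (simp add: fun_upd_idem big_While0)
next
  case (Suc n)
  let ?s = "s(z := s z - 1, a := s a + s z)"
  have tr: "triangle (s z) = triangle n + s z" using Suc(2) triangle_Suc[of n] by simp
  have loop: "big (While z (Seq (copy_reg z a t) (Dec z))) ?s s'"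
    unfolding add_triangle_def[symmetric]
    by (rule Suc.hyps) (use Suc.prems Suc(2)[symmetric] tr in \<open>auto simp: fun_eq_iff\<close>)
  have step: "big (Seq (copy_reg z a t) (Dec z)) s ?s"
    by (rule big_Seq[OF big_copy_reg[OF _ _ refl]], use Suc.prems in simp, use Suc.prems in simp)
      (use big_Dec[of z "s(a := s a + s z)"] Suc.prems in \<open>simp add: fun_upd_twist\<close>)
  show ?case unfolding add_triangle_def by (rule big_While1[OF _ step loop]) (use Suc(2) in simp)
qed

definition encode_reg :: "nat \<Rightarrow> nat \<Rightarrow> nat \<Rightarrow> nat \<Rightarrow> nat \<Rightarrow> com" where
  "encode_reg m n a z t = Seq (move2_reg m a z) (Seq (move_reg n z) (add_triangle z a t))"

lemma big_encode_reg:
  "distinct [m, n, a, z, t] \<Longrightarrow> s a = 0 \<Longrightarrow> s z = 0 \<Longrightarrow> s t = 0 \<Longrightarrow>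
    s' = s(m := 0, n := 0, a := prod_encode (s m, s n)) \<Longrightarrow> big (encode_reg m n a z t) s s'"
  unfolding encode_reg_def
  by (rule big_Seq[OF big_move2_reg[OF _ refl] big_Seq[OF big_move_reg[OF _ refl] big_add_triangle]])
    (auto simp: fun_eq_iff prod_encode_def)

text \<open>The pairing runs along antidiagonals, and from the end \<open>(m, 0)\<close> of one it
  passes to the start \<open>(0, Suc m)\<close> of the next. So decoding can count upwards instead
  of inverting \<open>triangle\<close>.\<close>

lemma prod_decode_Suc:
  "prod_decode (Suc x) = (case prod_decode x of (m, n) \<Rightarrow> if n = 0 then (0, Suc m) else (Suc m, n - 1))"
proof -
  obtain m n where mn: "prod_decode x = (m, n)" by fastforce
  then have x: "x = prod_encode (m, n)" by (metis prod_decode_inverse)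
  have "prod_encode (if n = 0 then (0, Suc m) else (Suc m, n - 1)) = Suc x"
    by (cases n) (auto simp: x prod_encode_def)
  then show ?thesis by (metis mn prod_encode_inverse case_prod_conv)
qed

text \<open>Each round replaces the pair in \<open>m\<close>, \<open>n\<close> by its successor in the numbering of pairs.\<close>

definition decode_reg :: "nat \<Rightarrow> nat \<Rightarrow> nat \<Rightarrow> com" where
  "decode_reg x m n =
     While x (Seq (Dec x) (Cond n (Seq (Inc m) (Dec n)) (Seq (move_reg m n) (Inc n))))"

lemma big_decode_reg_aux:
  "distinct [x, m, n] \<Longrightarrow> prod_decode y = (s m, s n) \<Longrightarrow> prod_decode (y + s x) = (m', n') \<Longrightarrow>
    s' = s(x := 0, m := m', n := n') \<Longrightarrow> big (decode_reg x m n) s s'"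
proof (induction "s x" arbitrary: s y)
  case 0
  then have "s' = s" by (auto simp: fun_eq_iff)
  then show ?case unfolding decode_reg_def using 0 by (simp add: big_While0)
next
  case (Suc k)
  let ?s = "if s n = 0 then s(x := k, m := 0, n := Suc (s m)) else s(x := k, m := Suc (s m), n := s n - 1)"
  have "prod_decode (Suc y) = (?s m, ?s n)"
    using Suc.prems(1,2) by (auto simp: prod_decode_Suc)
  then have loop: "big (decode_reg x m n) ?s s'"
    by (intro Suc.hyps(1)[where y = "Suc y"]) (use Suc.prems Suc.hyps(2)[symmetric] in \<open>auto simp: fun_eq_iff\<close>)
  have step: "big (Cond n (Seq (Inc m) (Dec n)) (Seq (move_reg m n) (Inc n))) (s(x := s x - 1)) ?s"
  proof (cases "s n = 0")
    case True
    have "big (Seq (move_reg m n) (Inc n)) (s(x := s x - 1)) ?s"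
      by (rule big_Seq[OF big_move_reg[OF _ refl] big_IncI])
        (use Suc.prems(1) True Suc.hyps(2)[symmetric] in \<open>auto simp: fun_eq_iff\<close>)
    then show ?thesis by (rule big_If0[rotated]) (use True Suc.prems(1) in simp)
  next
    case False
    have "big (Seq (Inc m) (Dec n)) (s(x := s x - 1)) ?s"
      by (rule big_Seq[OF big_IncI[OF refl] big_DecI])
        (use Suc.prems(1) False Suc.hyps(2)[symmetric] in \<open>auto simp: fun_eq_iff\<close>)
    then show ?thesis by (rule big_If1[rotated]) (use False Suc.prems(1) in simp)
  qed
  show ?case unfolding decode_reg_def
    by (rule big_While1[OF _ big_Seq[OF big_Dec step] loop[unfolded decode_reg_def]]) (use Suc(2) in simp)
qed

lemma big_decode_reg:
  "distinct [x, m, n] \<Longrightarrow> s m = 0 \<Longrightarrow> s n = 0 \<Longrightarrow>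
    s' = s(x := 0, m := fst (prod_decode (s x)), n := snd (prod_decode (s x))) \<Longrightarrow>
    big (decode_reg x m n) s s'"
  by (rule big_decode_reg_aux[of _ _ _ 0]) (auto simp: prod_decode_def prod_decode_aux.simps)

section \<open>Closure properties of recursive functions\<close>

lemma recursive_id: "recursive (\<lambda>x. x)"
  by (rule recursiveI[of "\<lambda>b. Skip"]) (simp add: big_Skip)

lemma recursive_zero: "recursive (\<lambda>x. 0)"
  by (rule recursiveI[of clear]) (simp add: big_clear)

lemma recursive_Suc: "recursive Suc"
  by (rule recursiveI[of Inc]) (simp add: big_Inc)

lemma recursive_pred: "recursive (\<lambda>x. x - 1)"
  by (rule recursiveI[of Dec]) (rule big_Dec)

lemma recursive_comp:
  assumes "recursive F" "recursive G"
  shows "recursive (\<lambda>x. F (G x))"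
proof -
  obtain p q where p: "computes p F" and q: "computes q G" using assms by (auto simp: recursive_def)
  show ?thesis
    by (rule recursiveI[of "\<lambda>b. Seq (q b) (p b)"])
      (rule big_Seq[OF computesD[OF q _ refl] computesD[OF p]], auto)
qed

lemma recursive_const: "recursive (\<lambda>x. n)"
  by (induction n) (auto intro: recursive_zero recursive_comp[OF recursive_Suc])

lemma recursive_fst: "recursive (\<lambda>x. fst (prod_decode x))"
  by (rule recursiveI[of "\<lambda>b. Seq (decode_reg b (b + 1) (b + 2)) (Seq (move_reg (b + 1) b) (clear (b + 2)))"],
      rule big_Seq[OF big_decode_reg[OF _ _ _ refl] big_Seq[OF big_move_reg[OF _ refl] big_clear]])
    (auto simp: fun_eq_iff)

lemma recursive_snd: "recursive (\<lambda>x. snd (prod_decode x))"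
  by (rule recursiveI[of "\<lambda>b. Seq (decode_reg b (b + 1) (b + 2)) (Seq (move_reg (b + 2) b) (clear (b + 1)))"],
      rule big_Seq[OF big_decode_reg[OF _ _ _ refl] big_Seq[OF big_move_reg[OF _ refl] big_clear]])
    (auto simp: fun_eq_iff)

lemma recursive_pair:
  assumes "recursive F" "recursive G"
  shows "recursive (\<lambda>x. prod_encode (F x, G x))"
proof -
  obtain p q where p: "computes p F" and q: "computes q G" using assms by (auto simp: recursive_def)
  \<comment> \<open>The value of \<open>G\<close> waits in \<open>b + 1\<close> while
    \<open>p\<close> runs at base \<open>b + 2\<close>, to which the argument has been moved;
    registers above the base are then clean for both programs.\<close>
  show ?thesis
    by (rule recursiveI[of "\<lambda>b. Seq (copy_reg b (b + 1) (b + 2)) (Seq (q (b + 1))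
          (Seq (move_reg b (b + 2)) (Seq (p (b + 2)) (encode_reg (b + 2) (b + 1) b (b + 3) (b + 4)))))"],
        rule big_Seq[OF big_copy_reg[OF _ _ refl] big_Seq[OF computesD[OF q _ refl]
          big_Seq[OF big_move_reg[OF _ refl] big_Seq[OF computesD[OF p _ refl] big_encode_reg]]]])
      (auto simp: fun_eq_iff)
qed

lemma recursive_if:
  assumes "recursive F" "recursive G" "recursive H"
  shows "recursive (\<lambda>x. if F x = 0 then G x else H x)"
proof -
  obtain p q r where p: "computes p F" and q: "computes q G" and r: "computes r H"
    using assms by (auto simp: recursive_def)
  show ?thesis
  proof (rule recursiveI[of "\<lambda>b. Seq (copy_reg b (b + 1) (b + 2)) (Seq (p (b + 1))
          (Cond (b + 1) (Seq (clear (b + 1)) (r b)) (q b)))"],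
        rule big_Seq[OF big_copy_reg[OF _ _ refl] big_Seq[OF computesD[OF p _ refl]]])
    fix b :: nat and s assume s: "\<And>r. b < r \<Longrightarrow> s r = (0 :: nat)"
    let ?s = "s(b + 1 := s (b + 1) + s b)"
    let ?t = "?s(b + 1 := F (?s (b + 1)))"
    show "big (Cond (b + 1) (Seq (clear (b + 1)) (r b)) (q b)) ?t
      (s(b := if F (s b) = 0 then G (s b) else H (s b)))"
    proof (cases "F (s b) = 0")
      case True
      then show ?thesis
        by (intro big_If0 computesD[OF q]) (auto simp: s fun_eq_iff)
    next
      case False
      then show ?thesis
        by (intro big_If1 big_Seq[OF big_clear[OF refl] computesD[OF r]]) (auto simp: s fun_eq_iff)
    qed
  qed auto
qed

text \<open>Halting is required at every number, since \<open>computes\<close> asks for a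
  terminating run from each argument. The test consumes its argument, so it works on a copy in
  \<open>b + 1\<close>.\<close>

lemma recursive_while:
  assumes "recursive F" "recursive N" "recursive I" and halts: "\<And>x. \<exists>k. F ((N ^^ k) (I x)) = 0"
  shows "recursive (\<lambda>x. (N ^^ (LEAST k. F ((N ^^ k) (I x)) = 0)) (I x))"
proof -
  obtain p q i where p: "computes p F" and q: "computes q N" and i: "computes i I"
    using assms by (auto simp: recursive_def)
  let ?test = "\<lambda>b. Seq (copy_reg b (b + 1) (b + 2)) (p (b + 1))"
  let ?loop = "\<lambda>b. While (b + 1) (Seq (clear (b + 1)) (Seq (q b) (?test b)))"
  have test: "big (?test b) s s'"
    if "\<And>r. b < r \<Longrightarrow> s r = 0" "s' = s(b + 1 := F (s b))" for b :: nat and s s'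
    by (rule big_Seq[OF big_copy_reg[OF _ _ refl] computesD[OF p]]) (auto simp: that)
  have loop: "big (?loop b) s (s(b := (N ^^ (LEAST k. F ((N ^^ k) (s b)) = 0)) (s b), b + 1 := 0))"
    if "\<And>r. b + 1 < r \<Longrightarrow> s r = 0" "s (b + 1) = F (s b)" "\<exists>k. F ((N ^^ k) (s b)) = 0"
    for b :: nat and s
    using that
  proof (induction "LEAST k. F ((N ^^ k) (s b)) = 0" arbitrary: s)
    case 0
    then have "F (s b) = 0" using LeastI_ex[OF "0.prems"(3)] by simp
    then show ?case using 0 by (auto simp: fun_upd_idem intro!: big_While0)
  next
    case (Suc k)
    let ?s = "s(b := N (s b), b + 1 := F (N (s b)))"
    let ?P = "\<lambda>k. F ((N ^^ k) (s b)) = 0"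
    have nz: "F (s b) \<noteq> 0"
    proof
      assume "F (s b) = 0"
      then have "(LEAST k. ?P k) = 0" by (intro Least_eq_0) simp
      then show False using Suc.hyps(2) by simp
    qed
    obtain k' where k': "?P k'" using Suc.prems(3) by blast
    then have "(LEAST k. ?P k) = Suc (LEAST k. ?P (Suc k))"
      by (rule Least_Suc) (use nz in simp)
    then have k: "k = (LEAST k. F ((N ^^ k) (N (s b))) = 0)"
      "(LEAST k. F ((N ^^ k) (s b)) = 0) = Suc k"
      using Suc.hyps(2) by (simp_all add: funpow_swap1)
    have "F ((N ^^ (k' - 1)) (N (s b))) = 0"
      using k' nz by (cases k') (auto simp: funpow_swap1)
    then have "big (?loop b) ?s (?s(b := (N ^^ (LEAST k. F ((N ^^ k) (?s b)) = 0)) (?s b), b + 1 := 0))"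
      by (intro Suc.hyps(1)) (use Suc.prems k in auto)
    also have "?s(b := (N ^^ (LEAST k. F ((N ^^ k) (?s b)) = 0)) (?s b), b + 1 := 0)
        = s(b := (N ^^ (LEAST k. F ((N ^^ k) (s b)) = 0)) (s b), b + 1 := 0)"
      unfolding k(2) using k(1)[symmetric] by (auto simp: fun_eq_iff funpow_swap1)
    finally have loop: "big (?loop b) ?s \<dots>" .
    have step: "big (Seq (clear (b + 1)) (Seq (q b) (?test b))) s ?s"
      by (rule big_Seq[OF big_clear[OF refl] big_Seq[OF computesD[OF q _ refl] test]])
        (use Suc.prems in \<open>auto simp: fun_eq_iff\<close>)
    show ?case by (rule big_While1[OF _ step loop]) (use nz Suc.prems(2) in simp)
  qed
  show ?thesis
  proof (rule recursiveI[of "\<lambda>b. Seq (i b) (Seq (?test b) (?loop b))"],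
      rule big_Seq[OF computesD[OF i _ refl] big_Seq[OF test[OF _ refl]]])
    fix b :: nat and s assume s: "\<And>r. b < r \<Longrightarrow> s r = (0 :: nat)"
    let ?t = "s(b := I (s b))"
    let ?s = "?t(b + 1 := F (?t b))"
    have "big (?loop b) ?s (?s(b := (N ^^ (LEAST k. F ((N ^^ k) (?s b)) = 0)) (?s b), b + 1 := 0))"
      by (rule loop) (auto simp: s halts)
    also have "?s(b := (N ^^ (LEAST k. F ((N ^^ k) (?s b)) = 0)) (?s b), b + 1 := 0)
      = s(b := (N ^^ (LEAST k. F ((N ^^ k) (I (s b))) = 0)) (I (s b)))"
      by (auto simp: fun_eq_iff s)
    finally show "big (?loop b) ?s \<dots>" .
  qed auto
qed

section \<open>Effective functions on encodable types\<close>

class encodable =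
  fixes enc :: "'a \<Rightarrow> nat"
  assumes enc_inject: "enc x = enc y \<Longrightarrow> x = y"

lemma enc_eq_iff [simp]: "enc x = enc y \<longleftrightarrow> x = y"
  using enc_inject by blast

lemma inj_enc: "inj enc"
  by (simp add: inj_def)

instantiation nat :: encodable begin
definition enc_nat :: "nat \<Rightarrow> nat" where [simp]: "enc_nat n = n"
instance by standard simp
end

instantiation bool :: encodable begin
definition enc_bool :: "bool \<Rightarrow> nat" where "enc_bool b = (if b then 1 else 0)"
instance by standard (auto simp: enc_bool_def split: if_splits)
end

instantiation prod :: (encodable, encodable) encodable begin
definition enc_prod :: "'a \<times> 'b \<Rightarrow> nat" where "enc_prod z = prod_encode (enc (fst z), enc (snd z))"
instance by standard (auto simp: enc_prod_def prod_eq_iff)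
end

instantiation option :: (encodable) encodable begin
definition enc_option :: "'a option \<Rightarrow> nat" where
  "enc_option z = (case z of None \<Rightarrow> 0 | Some y \<Rightarrow> Suc (enc y))"
instance by standard (auto simp: enc_option_def split: option.splits)
end

instantiation list :: (encodable) encodable begin
definition enc_list :: "'a list \<Rightarrow> nat" where "enc_list xs = list_encode (map enc xs)"
instance by standard (simp add: enc_list_def list_encode_eq inj_map_eq_map[OF inj_enc])
end

instantiation move :: encodable begin
definition enc_move :: "move \<Rightarrow> nat" where "enc_move = move_encode"
instance by standard (auto simp: enc_move_def move_encode_inject)
end

instantiation rule :: encodable begin
definition enc_rule :: "rule \<Rightarrow> nat" where "enc_rule = rule_encode"
instance by standard (auto simp: enc_rule_def inj_rule_encode inj_eq)
end

text \<open>With the given Goedel numbers as encodings, the outputs of \<open>\<psi>\<close> are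
  values of \<open>enc\<close>, and the machines they name can be handled by effective
  functions.\<close>

instantiation tm :: encodable begin
definition enc_tm :: "tm \<Rightarrow> nat" where "enc_tm = tm_encode"
instance by standard (auto simp: enc_tm_def inj_tm_encode inj_eq)
end

lemma enc_bool_simps [simp]: "enc True = 1" "enc False = 0"
  by (simp_all add: enc_bool_def)

lemma enc_Pair [simp]: "enc (x, y) = prod_encode (enc x, enc y)"
  by (simp add: enc_prod_def)

lemma enc_option_simps [simp]: "enc None = 0" "enc (Some x) = Suc (enc x)"
  by (simp_all add: enc_option_def)

lemma enc_list_simps [simp]: "enc [] = 0" "enc (x # xs) = Suc (prod_encode (enc x, enc xs))"
  by (simp_all add: enc_list_def)

text \<open>Bounds the rounds of a loop over a list by the code of the list, so that folds become
  bounded iterations.\<close>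

lemma length_le_enc: "length xs \<le> enc xs"
  by (induction xs) (auto intro: order.trans[OF _ le_prod_encode_2])

lemma surj_enc_nat: "surj (enc :: nat \<Rightarrow> nat)"
  by (simp add: enc_nat_def[abs_def])

lemma surj_enc_prod:
  assumes "surj (enc :: 'a::encodable \<Rightarrow> nat)" "surj (enc :: 'b::encodable \<Rightarrow> nat)"
  shows "surj (enc :: 'a \<times> 'b \<Rightarrow> nat)"
proof (rule surjI)
  fix n
  show "enc (inv (enc :: 'a \<Rightarrow> nat) (fst (prod_decode n)), inv (enc :: 'b \<Rightarrow> nat) (snd (prod_decode n))) = n"
    using assms by (simp add: surj_f_inv_f)
qed

lemma surj_enc_list:
  assumes "surj (enc :: 'a::encodable \<Rightarrow> nat)"
  shows "surj (enc :: 'a list \<Rightarrow> nat)"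
proof (rule surjI)
  fix n
  show "enc (map (inv (enc :: 'a \<Rightarrow> nat)) (list_decode n)) = n"
    using assms by (simp add: enc_list_def surj_f_inv_f comp_def)
qed

text \<open>Encodings need not be onto, and at numbers that are not codes \<open>F\<close> is
  arbitrary, though still total.\<close>

definition effective :: "('a::encodable \<Rightarrow> 'b::encodable) \<Rightarrow> bool" where
  "effective f \<longleftrightarrow> (\<exists>F. recursive F \<and> (\<forall>x. F (enc x) = enc (f x)))"

text \<open>Closure rules in pointwise form, so that \<open>intro eff\<close> follows the structure
  of a term. Bodies of loops are functions of a pair of the outer parameter and the loop
  variable.\<close>

named_theorems eff

lemma effectiveI: "recursive F \<Longrightarrow> (\<And>x. F (enc x) = enc (f x)) \<Longrightarrow> effective f"
  by (auto simp: effective_def)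

lemma effectiveE:
  assumes "effective f"
  obtains F where "recursive F" "\<And>x. F (enc x) = enc (f x)"
  using assms by (auto simp: effective_def)

lemma effective_imp_computable_nat_fun: "effective F \<Longrightarrow> computable_nat_fun F"
proof (erule effectiveE)
  fix F' assume "recursive F'" "\<And>x. F' (enc x) = enc (F x)"
  then have "F' = F" by auto
  with \<open>recursive F'\<close> show ?thesis by (simp add: recursive_imp_computable_nat_fun)
qed

lemma effective_compose: "effective f \<Longrightarrow> effective g \<Longrightarrow> effective (\<lambda>x. f (g x))"
proof -
  assume "effective f" "effective g"
  then obtain F G where "recursive F" "\<And>x. F (enc x) = enc (f x)" "recursive G" "\<And>x. G (enc x) = enc (g x)"
    unfolding effective_def by blast
  then show ?thesis by (intro effectiveI[OF recursive_comp[of F G]]) simp_all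
qed

text \<open>For a parameter used inside the body of a loop, where it appears as
  \<open>f (fst z)\<close> and the assumption on \<open>f\<close> does not match directly.\<close>

lemma effective_compose_fst: "effective f \<Longrightarrow> effective (\<lambda>z. f (fst z))"
  by (rule effective_compose[of f], assumption, rule effectiveI[OF recursive_fst]) (auto simp: enc_prod_def)

text \<open>Only codes matter, so a function may be replaced by one of another result type whose
  values have the same codes.\<close>

lemma effective_recode: "effective f \<Longrightarrow> (\<And>x. enc (g x) = enc (f x)) \<Longrightarrow> effective g"
  by (auto elim!: effectiveE intro!: effectiveI)

section \<open>Pairs, case distinctions, connectives and iteration\<close>

lemma effective_id [eff]: "effective (\<lambda>x. x)"
  by (rule effectiveI[OF recursive_id]) simp

lemma effective_const [eff]: "effective (\<lambda>x. c)"
  by (rule effectiveI[OF recursive_const[of "enc c"]]) simp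

lemma effective_enc [eff]: "effective f \<Longrightarrow> effective (\<lambda>x. enc (f x))"
  by (rule effective_recode) auto

lemma effective_Pair [eff]: "effective f \<Longrightarrow> effective g \<Longrightarrow> effective (\<lambda>x. (f x, g x))"
proof -
  assume "effective f" "effective g"
  then obtain F G where "recursive F" "\<And>x. F (enc x) = enc (f x)" "recursive G" "\<And>x. G (enc x) = enc (g x)"
    unfolding effective_def by blast
  then show ?thesis by (intro effectiveI[OF recursive_pair[of F G]]) simp_all
qed

lemma effective_fst [eff]: "effective f \<Longrightarrow> effective (\<lambda>x. fst (f x))"
  by (rule effective_compose[of fst], rule effectiveI[OF recursive_fst]) (auto simp: enc_prod_def)

lemma effective_snd [eff]: "effective f \<Longrightarrow> effective (\<lambda>x. snd (f x))"
  by (rule effective_compose[of snd], rule effectiveI[OF recursive_snd]) (auto simp: enc_prod_def)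

lemma effective_Suc [eff]: "effective f \<Longrightarrow> effective (\<lambda>x. Suc (f x))"
  by (rule effective_compose[of Suc], rule effectiveI[OF recursive_Suc]) auto

lemma effective_if [eff]:
  assumes "effective P" "effective f" "effective g"
  shows "effective (\<lambda>x. if P x then f x else g x)"
proof -
  from assms obtain P' F G where "recursive P'" "\<And>x. P' (enc x) = enc (P x)"
    "recursive F" "\<And>x. F (enc x) = enc (f x)" "recursive G" "\<And>x. G (enc x) = enc (g x)"
    unfolding effective_def by blast
  then show ?thesis
    by (intro effectiveI[OF recursive_if[of P' G F]]) (auto simp: enc_bool_def)
qed

lemma effective_eq_0 [eff]:
  assumes "effective f"
  shows "effective (\<lambda>x. f x = (0 :: nat))"
proof -
  from assms obtain F where "recursive F" "\<And>x. F (enc x) = f x"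
    unfolding effective_def by auto
  then show ?thesis
    by (intro effectiveI[OF recursive_if[of F "\<lambda>_. 1" "\<lambda>_. 0"]]) (auto simp: recursive_const)
qed

lemma effective_not [eff]: "effective P \<Longrightarrow> effective (\<lambda>x. \<not> P x)"
  by (rule effective_recode[OF effective_if[of P "\<lambda>_. False" "\<lambda>_. True"]]) (auto intro: effective_const)

lemma effective_conj [eff]: "effective P \<Longrightarrow> effective Q \<Longrightarrow> effective (\<lambda>x. P x \<and> Q x)"
  by (rule effective_recode[OF effective_if[of P Q "\<lambda>_. False"]]) (auto intro: effective_const)

lemma effective_disj [eff]: "effective P \<Longrightarrow> effective Q \<Longrightarrow> effective (\<lambda>x. P x \<or> Q x)"
  by (rule effective_recode[OF effective_if[of P "\<lambda>_. True" Q]]) (auto intro: effective_const)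

text \<open>Bounded iteration is a while loop on pairs of a countdown and a state; it ends when the
  countdown reaches \<open>0\<close>.\<close>

lemma recursive_funpow:
  assumes "recursive F"
  shows "recursive (\<lambda>z. (F ^^ fst (prod_decode z)) (snd (prod_decode z)))"
proof -
  let ?N = "\<lambda>z. prod_encode (fst (prod_decode z) - 1, F (snd (prod_decode z)))"
  have N: "(?N ^^ j) z = prod_encode (fst (prod_decode z) - j, (F ^^ j) (snd (prod_decode z)))" for j z
    by (induction j) auto
  have "(LEAST j. fst (prod_decode ((?N ^^ j) z)) = 0) = fst (prod_decode z)" for z
    unfolding N by (rule Least_equality) auto
  moreover have "\<exists>j. fst (prod_decode ((?N ^^ j) z)) = 0" for z
    unfolding N by auto
  then have "recursive (\<lambda>z. snd (prod_decode ((?N ^^ (LEAST j. fst (prod_decode ((?N ^^ j) z)) = 0)) z)))"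
    by (intro recursive_comp[OF recursive_snd] recursive_while recursive_id recursive_fst recursive_pair
        recursive_comp[OF recursive_pred recursive_fst] recursive_comp[OF assms recursive_snd])
  ultimately show ?thesis by (simp only: N prod_encode_inverse fst_conv snd_conv)
qed

lemma effective_funpow [eff]:
  fixes g :: "'a::encodable \<Rightarrow> 's::encodable \<Rightarrow> 's"
  assumes g: "effective (\<lambda>z. g (fst z) (snd z))" and n: "effective n" and a: "effective a"
  shows "effective (\<lambda>x. ((\<lambda>s. g x s) ^^ n x) (a x))"
proof -
  from g have "effective (\<lambda>z. (fst z, g (fst z) (snd z)))" by (intro eff)
  then obtain G where G: "recursive G" "\<And>z. G (enc z) = enc (fst z, g (fst z) (snd z))"
    by (rule effectiveE) blast
  have G': "(G ^^ k) (enc (x, s)) = enc (x, (g x ^^ k) s)" for k x s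
  proof (induction k)
    case (Suc k)
    then show ?case using G(2)[of "(x, (g x ^^ k) s)"] by (simp del: enc_Pair)
  qed simp
  have "effective (\<lambda>x. (n x, (x, a x)))" using n a by (intro eff)
  then obtain H where H: "recursive H" "\<And>x. H (enc x) = enc (n x, (x, a x))"
    by (rule effectiveE) blast
  show ?thesis
    by (rule effectiveI[OF recursive_comp[OF recursive_snd recursive_comp[OF recursive_funpow[OF G(1)] H(1)]]])
      (simp only: H(2) enc_Pair prod_encode_inverse fst_conv snd_conv enc_nat_def G'[unfolded enc_Pair])
qed

lemma effective_rec_nat [eff]:
  assumes a: "effective a" and g: "effective (\<lambda>z. g (fst z) (fst (snd z)) (snd (snd z)))" and n: "effective n"
  shows "effective (\<lambda>x. rec_nat (a x) (\<lambda>k r. g x k r) (n x))"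
proof -
  have "((\<lambda>s. (Suc (fst s), g x (fst s) (snd s))) ^^ k) (0, a x) = (k, rec_nat (a x) (\<lambda>k r. g x k r) k)" for x k
    by (induction k) auto
  then have *: "rec_nat (a x) (\<lambda>k r. g x k r) (n x) =
      snd (((\<lambda>s. (Suc (fst s), g x (fst s) (snd s))) ^^ n x) (0, a x))" for x by simp
  show ?thesis unfolding * using assms by (intro eff)
qed

section \<open>Arithmetic, comparisons and unbounded search\<close>

lemma effective_add [eff]: "effective f \<Longrightarrow> effective g \<Longrightarrow> effective (\<lambda>x. f x + g x :: nat)"
proof -
  assume "effective f" "effective g"
  then have "effective (\<lambda>x. ((\<lambda>s. Suc s) ^^ g x) (f x))" by (intro eff)
  moreover have "((\<lambda>s. Suc s) ^^ k) m = m + k" for k m by (induction k) auto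
  ultimately show ?thesis by (simp add: add.commute)
qed

lemma effective_diff [eff]: "effective f \<Longrightarrow> effective g \<Longrightarrow> effective (\<lambda>x. f x - g x :: nat)"
proof -
  assume fg: "effective f" "effective g"
  have "effective (\<lambda>x. x - 1 :: nat)" by (rule effectiveI[OF recursive_pred]) simp
  then have "effective (\<lambda>z. snd (z :: 'a \<times> nat) - 1)" by (rule effective_compose) (intro eff)
  with fg have "effective (\<lambda>x. ((\<lambda>s. s - 1) ^^ g x) (f x))" by (intro eff)
  moreover have "((\<lambda>s. s - 1) ^^ k) m = m - k" for k and m :: nat by (induction k) auto
  ultimately show ?thesis by simp
qed

lemma effective_mult [eff]: "effective f \<Longrightarrow> effective g \<Longrightarrow> effective (\<lambda>x. f x * g x :: nat)"
proof -
  assume "effective f" "effective g"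
  then have "effective (\<lambda>x. ((\<lambda>s. s + f x) ^^ g x) 0)"
    by (intro eff effective_compose_fst[of f])
  moreover have "((\<lambda>s. s + m) ^^ k) 0 = m * k" for k m :: nat by (induction k) auto
  ultimately show ?thesis by simp
qed

lemma effective_power [eff]: "effective f \<Longrightarrow> effective g \<Longrightarrow> effective (\<lambda>x. f x ^ g x :: nat)"
proof -
  assume "effective f" "effective g"
  then have "effective (\<lambda>x. ((\<lambda>s. s * f x) ^^ g x) 1)"
    by (intro eff effective_compose_fst[of f])
  moreover have "((\<lambda>s. s * m) ^^ k) 1 = m ^ k" for k m :: nat by (induction k) auto
  ultimately show ?thesis by simp
qed

lemma effective_le [eff]: "effective f \<Longrightarrow> effective g \<Longrightarrow> effective (\<lambda>x. f x \<le> (g x :: nat))"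
  by (rule effective_recode[of "\<lambda>x. f x - g x = 0"], intro eff) auto

lemma effective_less [eff]: "effective f \<Longrightarrow> effective g \<Longrightarrow> effective (\<lambda>x. f x < (g x :: nat))"
  by (rule effective_recode[of "\<lambda>x. Suc (f x) \<le> g x"], intro eff) auto

lemma effective_eq [eff]:
  assumes "effective f" "effective g"
  shows "effective (\<lambda>x. f x = g x)"
proof -
  have *: "f x = g x \<longleftrightarrow> enc (f x) \<le> enc (g x) \<and> enc (g x) \<le> enc (f x)" for x
    using enc_inject[of "f x" "g x"] by auto
  show ?thesis unfolding * using assms by (intro eff)
qed

text \<open>The underlying loop must halt at every number. As the encoding is onto, each number is
  the code of some \<open>x\<close>, for which \<open>ex\<close> ends the search.\<close>

lemma effective_Least:
  assumes P: "effective (\<lambda>z. P (fst z) (snd z))" and ex: "\<And>x :: 'a::encodable. \<exists>t :: nat. P x t"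
    and surj: "surj (enc :: 'a \<Rightarrow> nat)"
  shows "effective (\<lambda>x. LEAST t. P x t)"
proof -
  obtain F where F: "recursive F" "\<And>z. F (enc z) = enc (\<not> P (fst z) (snd z))"
    using effective_not[OF P] by (rule effectiveE) blast
  let ?N = "\<lambda>z. prod_encode (fst (prod_decode z), Suc (snd (prod_decode z)))"
  have N: "(?N ^^ j) z = prod_encode (fst (prod_decode z), snd (prod_decode z) + j)" for j z
    by (induction j) auto
  have F0: "F (prod_encode (enc x, t)) = 0 \<longleftrightarrow> P x t" for x t
    using F(2)[of "(x, t)"] by (auto simp: enc_bool_def)
  let ?R = "\<lambda>x. (?N ^^ (LEAST j. F ((?N ^^ j) (prod_encode (x, 0))) = 0)) (prod_encode (x, 0))"
  have "recursive ?R"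
  proof (rule recursive_while[OF F(1)])
    show "recursive ?N"
      by (intro recursive_pair recursive_fst recursive_comp[OF recursive_Suc recursive_snd])
    show "recursive (\<lambda>x. prod_encode (x, 0))"
      by (intro recursive_pair recursive_id recursive_const)
    fix y
    obtain x :: 'a where x: "enc x = y" using surj by (metis surjD)
    obtain t where "P x t" using ex by blast
    then show "\<exists>k. F ((?N ^^ k) (prod_encode (y, 0))) = 0"
      unfolding N by (auto simp: x[symmetric] F0)
  qed
  then have "recursive (\<lambda>x. snd (prod_decode (?R x)))" by (rule recursive_comp[OF recursive_snd])
  then show ?thesis by (rule effectiveI) (simp add: N F0)
qed

subsection \<open>Lists and options\<close>

lemma effective_Cons [eff]: "effective f \<Longrightarrow> effective g \<Longrightarrow> effective (\<lambda>x. f x # g x)"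
  by (rule effective_recode[of "\<lambda>x. Suc (enc (f x, g x))"], intro eff) auto

lemma effective_Some [eff]: "effective f \<Longrightarrow> effective (\<lambda>x. Some (f x))"
  by (rule effective_recode[of "\<lambda>x. Suc (enc (f x))"], intro eff) auto

lemma effective_case_list [eff]:
  assumes f: "effective f" and a: "effective a"
    and b: "effective (\<lambda>z. b (fst z) (fst (snd z)) (snd (snd z)))"
  shows "effective (\<lambda>x. case f x of [] \<Rightarrow> a x | y # ys \<Rightarrow> b x y ys)"
proof -
  obtain F A B where F: "recursive F" "\<And>x. F (enc x) = enc (f x)"
    and A: "recursive A" "\<And>x. A (enc x) = enc (a x)"
    and B: "recursive B" "\<And>z. B (enc z) = enc (b (fst z) (fst (snd z)) (snd (snd z)))"
    using assms unfolding effective_def by blast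
  have "recursive (\<lambda>n. if F n = 0 then A n else B (prod_encode (n, F n - 1)))"
    by (intro recursive_if F A recursive_comp[OF B(1)] recursive_pair recursive_id recursive_comp[OF recursive_pred])
  then show ?thesis
  proof (rule effectiveI)
    fix x
    show "(if F (enc x) = 0 then A (enc x) else B (prod_encode (enc x, F (enc x) - 1)))
        = enc (case f x of [] \<Rightarrow> a x | y # ys \<Rightarrow> b x y ys)"
      using B(2)[of "(x, hd (f x), tl (f x))"] by (cases "f x") (simp_all add: F A)
  qed
qed

lemma effective_case_option [eff]:
  assumes f: "effective f" and a: "effective a"
    and b: "effective (\<lambda>z. b (fst z) (snd z))"
  shows "effective (\<lambda>x. case f x of None \<Rightarrow> a x | Some y \<Rightarrow> b x y)"
proof -
  obtain F A B where F: "recursive F" "\<And>x. F (enc x) = enc (f x)"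
    and A: "recursive A" "\<And>x. A (enc x) = enc (a x)"
    and B: "recursive B" "\<And>z. B (enc z) = enc (b (fst z) (snd z))"
    using assms unfolding effective_def by blast
  have "recursive (\<lambda>n. if F n = 0 then A n else B (prod_encode (n, F n - 1)))"
    by (intro recursive_if F A recursive_comp[OF B(1)] recursive_pair recursive_id recursive_comp[OF recursive_pred])
  then show ?thesis
  proof (rule effectiveI)
    fix x
    show "(if F (enc x) = 0 then A (enc x) else B (prod_encode (enc x, F (enc x) - 1)))
        = enc (case f x of None \<Rightarrow> a x | Some y \<Rightarrow> b x y)"
      using B(2)[of "(x, the (f x))"] by (cases "f x") (simp_all add: F A)
  qed
qed

lemma effective_foldl [eff]:
  fixes g :: "'a::encodable \<Rightarrow> 's::encodable \<Rightarrow> 'b::encodable \<Rightarrow> 's"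
  assumes g: "effective (\<lambda>z. g (fst z) (fst (snd z)) (snd (snd z)))" and a: "effective a" and l: "effective l"
  shows "effective (\<lambda>x. foldl (\<lambda>s y. g x s y) (a x) (l x))"
proof -
  let ?step = "\<lambda>x z. case snd z of [] \<Rightarrow> (fst z, []) | y # ys \<Rightarrow> (g x (fst z) y, ys)"
  have step: "(?step x ^^ n) (s, ys) = (foldl (g x) s ys, [])" if "length ys \<le> n" for x n s ys
    using that
  proof (induction n arbitrary: s ys)
    case (Suc n)
    then show ?case by (cases ys) (simp_all add: funpow_Suc_right del: funpow.simps(2))
  qed simp
  \<comment> \<open>Running \<open>enc (l x)\<close> rounds is usually too many, but the step is
    idle once the list is used up.\<close>
  then have *: "foldl (\<lambda>s y. g x s y) (a x) (l x) = fst ((?step x ^^ enc (l x)) (a x, l x))" for x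
    by (simp only: step[OF length_le_enc] fst_conv)
  have "effective (\<lambda>w. g (fst (fst w)) (fst (snd (fst w))) (fst (snd w)))"
    by (rule effective_compose[OF g, of "\<lambda>w. (fst (fst w), (fst (snd (fst w)), fst (snd w)))", simplified]) (intro eff)
  then show ?thesis unfolding * using a l by (intro eff)
qed

lemma effective_rev [eff]:
  assumes "effective l"
  shows "effective (\<lambda>x. rev (l x))"
proof -
  have *: "rev xs = foldl (\<lambda>s y. y # s) [] xs" for xs :: "'b list"
    by (simp add: foldl_conv_fold rev_conv_fold)
  show ?thesis unfolding * using assms by (intro eff)
qed

lemma effective_foldr [eff]:
  fixes g :: "'a::encodable \<Rightarrow> 'b::encodable \<Rightarrow> 's::encodable \<Rightarrow> 's"
  assumes g: "effective (\<lambda>z. g (fst z) (fst (snd z)) (snd (snd z)))" and l: "effective l" and a: "effective a"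
  shows "effective (\<lambda>x. foldr (\<lambda>y s. g x y s) (l x) (a x))"
proof -
  have "effective (\<lambda>z. g (fst z) (snd (snd z)) (fst (snd z)))"
    by (rule effective_compose[OF g, of "\<lambda>z. (fst z, (snd (snd z), fst (snd z)))", simplified]) (intro eff)
  then show ?thesis unfolding foldr_conv_foldl using l a by (intro eff)
qed

lemma effective_map [eff]:
  fixes g :: "'a::encodable \<Rightarrow> 'b::encodable \<Rightarrow> 'c::encodable"
  assumes g: "effective (\<lambda>z. g (fst z) (snd z))" and l: "effective l"
  shows "effective (\<lambda>x. map (\<lambda>y. g x y) (l x))"
proof -
  have *: "map f xs = foldr (\<lambda>y s. f y # s) xs []" for f :: "'b \<Rightarrow> 'c" and xs
    by (induction xs) auto
  have "effective (\<lambda>z. g (fst z) (fst (snd z)))"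
    by (rule effective_compose[OF g, of "\<lambda>z. (fst z, fst (snd z))", simplified]) (intro eff)
  then show ?thesis unfolding * using l by (intro eff)
qed

lemma effective_append [eff]: "effective f \<Longrightarrow> effective g \<Longrightarrow> effective (\<lambda>x. f x @ g x)"
proof -
  have *: "xs @ ys = foldr (\<lambda>y s. y # s) xs ys" for xs ys :: "'b list"
    by (induction xs) auto
  show "effective f \<Longrightarrow> effective g \<Longrightarrow> effective (\<lambda>x. f x @ g x)" unfolding * by (intro eff)
qed

lemma effective_concat [eff]: "effective f \<Longrightarrow> effective (\<lambda>x. concat (f x))"
proof -
  have *: "concat xs = foldr (\<lambda>y s. y @ s) xs []" for xs :: "'b list list"
    by (induction xs) auto
  show "effective f \<Longrightarrow> effective (\<lambda>x. concat (f x))" unfolding * by (intro eff)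
qed

lemma effective_length [eff]: "effective f \<Longrightarrow> effective (\<lambda>x. length (f x))"
proof -
  have *: "length xs = foldr (\<lambda>y s. Suc s) xs 0" for xs :: "'b list"
    by (induction xs) auto
  show "effective f \<Longrightarrow> effective (\<lambda>x. length (f x))" unfolding * by (intro eff)
qed

lemma effective_sum_list [eff]: "effective f \<Longrightarrow> effective (\<lambda>x. sum_list (f x) :: nat)"
proof -
  have *: "sum_list xs = foldr (\<lambda>y s. y + s) xs 0" for xs :: "nat list"
    by (induction xs) auto
  show "effective f \<Longrightarrow> effective (\<lambda>x. sum_list (f x) :: nat)" unfolding * by (intro eff)
qed

lemma effective_upt [eff]: "effective f \<Longrightarrow> effective (\<lambda>x. [0..<f x])"
proof -
  have *: "[0..<n] = rec_nat [] (\<lambda>k r. r @ [k]) n" for n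
    by (induction n) auto
  show "effective f \<Longrightarrow> effective (\<lambda>x. [0..<f x])" unfolding * by (intro eff)
qed

lemma effective_Ball_set [eff]:
  assumes P: "effective (\<lambda>z. P (fst z) (snd z))" and l: "effective l"
  shows "effective (\<lambda>x. \<forall>y\<in>set (l x). P x y)"
proof -
  have *: "(\<forall>y\<in>set ys. P x y) = foldr (\<lambda>y s. P x y \<and> s) ys True" for x ys
    by (induction ys) auto
  have "effective (\<lambda>z. P (fst z) (fst (snd z)))"
    by (rule effective_compose[OF P, of "\<lambda>z. (fst z, fst (snd z))", simplified]) (intro eff)
  then show ?thesis unfolding * using l by (intro eff)
qed

lemma effective_Bex_set [eff]:
  assumes P: "effective (\<lambda>z. P (fst z) (snd z))" and l: "effective l"
  shows "effective (\<lambda>x. \<exists>y\<in>set (l x). P x y)"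
proof -
  have *: "(\<exists>y\<in>set ys. P x y) = (\<not> (\<forall>y\<in>set ys. \<not> P x y))" for x ys
    by blast
  show ?thesis unfolding * using assms by (intro eff)
qed

lemma effective_takeWhile_1 [eff]: "effective l \<Longrightarrow> effective (\<lambda>x. takeWhile (\<lambda>a. a = (1 :: nat)) (l x))"
proof -
  have *: "takeWhile (\<lambda>a. a = (1 :: nat)) xs = foldr (\<lambda>y s. if y = 1 then y # s else []) xs []" for xs
    by (induction xs) auto
  show "effective l \<Longrightarrow> ?thesis" unfolding * by (intro eff)
qed

lemma effective_tl [eff]: "effective l \<Longrightarrow> effective (\<lambda>x. tl (l x))"
proof -
  have *: "tl xs = (case xs of [] \<Rightarrow> [] | y # ys \<Rightarrow> ys)" for xs :: "'b list"
    by (cases xs) auto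
  show "effective l \<Longrightarrow> ?thesis" unfolding * by (intro eff)
qed

lemma effective_drop [eff]: "effective n \<Longrightarrow> effective l \<Longrightarrow> effective (\<lambda>x. drop (n x) (l x))"
proof -
  have *: "drop k xs = ((\<lambda>s. tl s) ^^ k) xs" for k and xs :: "'b list"
    by (induction k) (auto simp: drop_Suc drop_tl)
  show "effective n \<Longrightarrow> effective l \<Longrightarrow> ?thesis" unfolding * by (intro eff)
qed

text \<open>Beyond the end of a list the value of \<open>!\<close> is unspecified, so indexing that
  is to be computed carries a default.\<close>

definition nth_or :: "'a \<Rightarrow> 'a list \<Rightarrow> nat \<Rightarrow> 'a" where
  "nth_or d xs n = (if n < length xs then xs ! n else d)"

lemma effective_nth_or [eff]:
  assumes "effective d" "effective l" "effective n"
  shows "effective (\<lambda>x. nth_or (d x) (l x) (n x))"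
proof -
  have *: "nth_or d xs n = (case drop n xs of [] \<Rightarrow> d | y # ys \<Rightarrow> y)" for d :: 'b and xs n
    by (cases "n < length xs") (simp_all add: nth_or_def flip: Cons_nth_drop_Suc)
  show ?thesis unfolding * using assms by (intro eff)
qed

lemma effective_zip [eff]:
  assumes "effective f" "effective g"
  shows "effective (\<lambda>x. zip (f x) (g x))"
proof -
  have *: "zip xs ys = map (\<lambda>i. (nth_or undefined xs i, nth_or undefined ys i))
      [0..<if length xs \<le> length ys then length xs else length ys]" for xs :: "'b list" and ys :: "'c list"
    by (auto simp: nth_or_def intro!: nth_equalityI)
  show ?thesis unfolding * using assms
    by (intro eff effective_compose_fst[of f] effective_compose_fst[of g])
qed

lemma effective_list_update [eff]:
  assumes "effective l" "effective n" "effective v"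
  shows "effective (\<lambda>x. (l x)[n x := v x])"
proof -
  have *: "xs[n := v] = map (\<lambda>i. if i = n then v else nth_or undefined xs i) [0..<length xs]"
    for xs :: "'b list" and n v
    by (auto simp: nth_or_def intro!: nth_equalityI)
  show ?thesis unfolding * using assms
    by (intro eff effective_compose_fst[of l] effective_compose_fst[of n] effective_compose_fst[of v])
qed

lemma effective_div [eff]:
  assumes "effective f" "effective g"
  shows "effective (\<lambda>x. f x div g x :: nat)"
proof -
  \<comment> \<open>The disjunct \<open>n = 0\<close> stops the search at \<open>0\<close>, which is
    the value of \<open>m div 0\<close>.\<close>
  have *: "m div n = (LEAST q. n = 0 \<or> m < Suc q * n)" for m n :: nat
  proof (cases "n = 0")
    case False
    then have "m < Suc q * n \<longleftrightarrow> m div n \<le> q" for q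
      using div_less_iff_less_mult[of n m "Suc q"] by (simp add: less_Suc_eq_le)
    then show ?thesis using False by (auto intro!: Least_equality[symmetric])
  qed simp
  have "effective (\<lambda>z :: nat \<times> nat. LEAST q. snd z = 0 \<or> fst z < Suc q * snd z)"
  proof (rule effective_Least)
    show "\<exists>q. snd z = 0 \<or> fst z < Suc q * snd z" for z :: "nat \<times> nat"
      by (intro exI[of _ "fst z"]) (cases "snd z", auto)
  qed (intro eff surj_enc_prod surj_enc_nat)+
  from effective_compose[OF this, of "\<lambda>x. (f x, g x)"] show ?thesis
    unfolding * using effective_Pair[OF assms] by simp
qed

lemma effective_mod [eff]: "effective f \<Longrightarrow> effective g \<Longrightarrow> effective (\<lambda>x. f x mod g x :: nat)"
  unfolding modulo_nat_def by (intro eff)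

section \<open>Simulation of machines\<close>

subsection \<open>Step-bounded simulation with partially known oracles\<close>

text \<open>The default \<open>0\<close> at unknown places is never relied on, since the simulation
  gives up at \<open>stuck\<close> configurations.\<close>

definition lookup :: "nat option list \<Rightarrow> nat \<Rightarrow> nat" where
  "lookup \<sigma> x = (case nth_or None \<sigma> x of None \<Rightarrow> 0 | Some v \<Rightarrow> v)"

definition query_value :: "config \<Rightarrow> nat" where
  "query_value c = nat_of_tape (nth_or ([], []) (snd c) 1)"

text \<open>
  The simulation gives up as soon as the query tape holds a number at which some oracle is
  unknown, whether or not the machine asks for it.
\<close>

definition stuck :: "nat option list list \<Rightarrow> config \<Rightarrow> bool" where
  "stuck \<sigma>s c \<longleftrightarrow> (\<exists>\<sigma>\<in>set \<sigma>s. nth_or None \<sigma> (query_value c) = None)"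

definition sim_step :: "nat option list list \<Rightarrow> tm \<Rightarrow> config option \<Rightarrow> config option" where
  "sim_step \<sigma>s M z = (case z of None \<Rightarrow> None | Some c \<Rightarrow>
     if stuck \<sigma>s c then None
     else case tm_step (map lookup \<sigma>s) M c of None \<Rightarrow> Some c | Some d \<Rightarrow> Some d)"

lemma sim_step_simps [simp]:
  "sim_step \<sigma>s M None = None"
  "sim_step \<sigma>s M (Some c) = (if stuck \<sigma>s c then None
     else case tm_step (map lookup \<sigma>s) M c of None \<Rightarrow> Some c | Some d \<Rightarrow> Some d)"
  by (simp_all add: sim_step_def)

text \<open>\<open>None\<close> means that nothing was decided within \<open>t\<close> steps. A
  halted configuration is kept by \<open>sim_step\<close>, so the bound may exceed the length of the
  computation.\<close>

definition run :: "nat option list list \<Rightarrow> tm \<Rightarrow> nat \<Rightarrow> nat \<Rightarrow> nat option" where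
  "run \<sigma>s M t n = (case (sim_step \<sigma>s M ^^ t) (Some (init_config M n)) of None \<Rightarrow> None | Some c \<Rightarrow>
     if stuck \<sigma>s c \<or> tm_step (map lookup \<sigma>s) M c \<noteq> None then None
     else Some (nat_of_tape (nth_or ([], []) (snd c) 0)))"

definition approximates :: "nat option list \<Rightarrow> (nat \<Rightarrow> nat) \<Rightarrow> bool" where
  "approximates \<sigma> \<phi> \<longleftrightarrow> (\<forall>x v. nth_or None \<sigma> x = Some v \<longrightarrow> \<phi> x = v)"

lemma apply_rule_approximates:
  assumes "list_all2 approximates \<sigma>s \<phi>s" "\<not> stuck \<sigma>s c"
  shows "apply_rule (map lookup \<sigma>s) r c = apply_rule \<phi>s r c"
proof (cases r)
  case (Query q j q')
  obtain p ts where c: "c = (p, ts)" by (cases c)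
  have len: "length \<sigma>s = length \<phi>s" using assms(1) by (rule list_all2_lengthD)
  have "lookup (\<sigma>s ! j) (nat_of_tape (ts ! 1)) = (\<phi>s ! j) (nat_of_tape (ts ! 1))"
    if j: "j < length \<phi>s" "1 < length ts"
  proof -
    have "approximates (\<sigma>s ! j) (\<phi>s ! j)" using assms(1) j by (auto simp: list_all2_conv_all_nth)
    moreover have "nth_or None (\<sigma>s ! j) (nat_of_tape (ts ! 1)) \<noteq> None"
      using assms(2) j len by (auto simp: stuck_def query_value_def c nth_or_def)
    ultimately show ?thesis by (auto simp: approximates_def lookup_def)
  qed
  then show ?thesis using len by (auto simp: c Query)
qed (cases c, simp)

lemma tm_step_approximates:
  assumes "list_all2 approximates \<sigma>s \<phi>s" "\<not> stuck \<sigma>s c"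
  shows "tm_step (map lookup \<sigma>s) M c = tm_step \<phi>s M c"
proof -
  have "first_rule (map lookup \<sigma>s) rs c = first_rule \<phi>s rs c" for rs
    by (induction rs) (simp_all add: apply_rule_approximates[OF assms] split: option.splits)
  then show ?thesis by (simp add: tm_step_def)
qed

lemma length_apply_rule: "apply_rule \<phi>s r c = Some d \<Longrightarrow> length (snd d) = length (snd c)"
  by (cases r; cases c) (auto split: if_splits)

lemma length_tm_step: "tm_step \<phi>s M c = Some d \<Longrightarrow> length (snd d) = length (snd c)"
proof -
  have "first_rule \<phi>s rs c = Some d \<Longrightarrow> length (snd d) = length (snd c)" for rs
    by (induction rs) (auto split: option.splits dest: length_apply_rule)
  then show "tm_step \<phi>s M c = Some d \<Longrightarrow> ?thesis" by (simp add: tm_step_def)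
qed

lemma run_sound:
  assumes ap: "list_all2 approximates \<sigma>s \<phi>s" and run: "run \<sigma>s M t n = Some m"
  shows "outputs \<phi>s M n m"
proof -
  let ?R = "\<lambda>c d. tm_step \<phi>s M c = Some d"
  have sim: "(sim_step \<sigma>s M ^^ k) (Some (init_config M n)) = Some c \<Longrightarrow>
    ?R\<^sup>*\<^sup>* (init_config M n) c \<and> length (snd c) = work_tapes M + 1" for k c
  proof (induction k arbitrary: c)
    case 0
    then show ?case by (auto simp: init_config_def)
  next
    case (Suc k)
    then obtain d where d: "(sim_step \<sigma>s M ^^ k) (Some (init_config M n)) = Some d"
      "sim_step \<sigma>s M (Some d) = Some c"
      by (cases "(sim_step \<sigma>s M ^^ k) (Some (init_config M n))") auto
    then have ns: "\<not> stuck \<sigma>s d" by auto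
    show ?case using Suc.IH[OF d(1)] d(2) ns tm_step_approximates[OF ap ns, of M]
      by (auto split: option.splits dest: length_tm_step intro: rtranclp.rtrancl_into_rtrancl)
  qed
  from run obtain c where c: "(sim_step \<sigma>s M ^^ t) (Some (init_config M n)) = Some c" "\<not> stuck \<sigma>s c"
    "tm_step (map lookup \<sigma>s) M c = None" "m = nat_of_tape (nth_or ([], []) (snd c) 0)"
    by (auto simp: run_def simp del: not_None_eq split: option.splits if_splits)
  show ?thesis
    using sim[OF c(1)] c(3,4) tm_step_approximates[OF ap c(2), of M]
    unfolding outputs_def by (intro exI[of _ c]) (simp add: nth_or_def)
qed

text \<open>A halting computation passes through finitely many configurations. \<open>T\<close>
  counts its steps and \<open>K\<close> exceeds every number that ever stands on its query tape,
  asked for or not.\<close>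

lemma run_complete:
  assumes "outputs \<phi>s M n m"
  shows "\<exists>T K. \<forall>t\<ge>T. \<forall>\<sigma>s. list_all2 approximates \<sigma>s \<phi>s \<longrightarrow>
    (\<forall>\<sigma>\<in>set \<sigma>s. \<forall>x<K. nth_or None \<sigma> x \<noteq> None) \<longrightarrow> run \<sigma>s M t n = Some m"
proof -
  let ?R = "\<lambda>c d. tm_step \<phi>s M c = Some d"
  obtain c where c: "?R\<^sup>*\<^sup>* (init_config M n) c" "tm_step \<phi>s M c = None" "m = nat_of_tape (snd c ! 0)"
    using assms by (auto simp: outputs_def)
  let ?good = "\<lambda>K \<sigma>s. list_all2 approximates \<sigma>s \<phi>s \<and> (\<forall>\<sigma>\<in>set \<sigma>s. \<forall>x<K. nth_or None \<sigma> x \<noteq> None)"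
  have "\<exists>T K. length (snd c) = work_tapes M + 1 \<and> query_value c < K \<and>
    (\<forall>\<sigma>s. ?good K \<sigma>s \<longrightarrow> (sim_step \<sigma>s M ^^ T) (Some (init_config M n)) = Some c)"
    using c(1)
  proof (induction rule: rtranclp_induct)
    case base
    show ?case by (intro exI[of _ 0] exI[of _ "Suc (query_value (init_config M n))"]) (auto simp: init_config_def)
  next
    case (step c d)
    then obtain T K where TK: "length (snd c) = work_tapes M + 1" "query_value c < K"
      "\<And>\<sigma>s. ?good K \<sigma>s \<Longrightarrow> (sim_step \<sigma>s M ^^ T) (Some (init_config M n)) = Some c" by blast
    have "(sim_step \<sigma>s M ^^ Suc T) (Some (init_config M n)) = Some d"
      if *: "?good (max K (Suc (query_value d))) \<sigma>s" for \<sigma>s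
    proof -
      have g: "?good K \<sigma>s" using * by auto
      then have ns: "\<not> stuck \<sigma>s c" using TK(2) by (auto simp: stuck_def)
      show ?thesis using TK(3)[OF g] tm_step_approximates[OF _ ns, of \<phi>s M] g ns step.hyps(2)
        by simp
    qed
    moreover have "length (snd d) = work_tapes M + 1" using length_tm_step[OF step.hyps(2)] TK(1) by simp
    ultimately show ?case by (intro exI[of _ "Suc T"] exI[of _ "max K (Suc (query_value d))"]) auto
  qed
  then obtain T K where len: "length (snd c) = work_tapes M + 1" and K: "query_value c < K"
    and T: "\<And>\<sigma>s. ?good K \<sigma>s \<Longrightarrow> (sim_step \<sigma>s M ^^ T) (Some (init_config M n)) = Some c"
    by blast
  have "run \<sigma>s M t n = Some m" if t: "T \<le> t" and g: "?good K \<sigma>s" for t \<sigma>s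
  proof -
    have ns: "\<not> stuck \<sigma>s c" using g K by (auto simp: stuck_def)
    have st: "tm_step (map lookup \<sigma>s) M c = None" using tm_step_approximates[OF _ ns] g c(2) by auto
    have "(sim_step \<sigma>s M ^^ (T + k)) (Some (init_config M n)) = Some c" for k
      by (induction k) (use T[OF g] ns st in auto)
    from this[of "t - T"] show ?thesis using t ns st c(3) len by (simp add: run_def nth_or_def)
  qed
  then show ?thesis by blast
qed

subsection \<open>The simulation is effective\<close>

text \<open>The list of numbers behind \<open>rule_encode\<close>: it has the same code as the rule,
  so the fields of a rule are read off by position.\<close>

fun rule_list :: "rule \<Rightarrow> nat list" where
  "rule_list (Step q as q' ws) = [0, q, enc as, q', enc ws]"
| "rule_list (Query q j q') = [1, q, j, q']"

fun step_syms :: "rule \<Rightarrow> nat list" where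
  "step_syms (Step q as q' ws) = as" | "step_syms (Query q j q') = []"

fun step_writes :: "rule \<Rightarrow> (nat \<times> move) list" where
  "step_writes (Step q as q' ws) = ws" | "step_writes (Query q j q') = []"

lemma effective_rule_list [eff]: "effective f \<Longrightarrow> effective (\<lambda>x. rule_list (f x))"
proof (rule effective_recode[OF effective_enc])
  have "enc (rule_list r) = enc r" for r
    by (cases r)
      (auto simp: enc_rule_def enc_list_def enc_prod_def[abs_def] enc_move_def enc_nat_def[abs_def] case_prod_unfold)
  then show "enc (rule_list (f x)) = enc (enc (f x))" for x by simp
qed

lemma effective_step_syms [eff]: "effective f \<Longrightarrow> effective (\<lambda>x. step_syms (f x))"
proof (rule effective_recode[where f = "\<lambda>x. if nth_or 0 (rule_list (f x)) 0 = 0 then nth_or 0 (rule_list (f x)) 2 else 0"])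
  show "enc (step_syms (f x)) = enc (if nth_or 0 (rule_list (f x)) 0 = 0 then nth_or 0 (rule_list (f x)) 2 else 0)" for x
    by (cases "f x") (auto simp: nth_or_def)
qed (intro eff)

lemma effective_step_writes [eff]: "effective f \<Longrightarrow> effective (\<lambda>x. step_writes (f x))"
proof (rule effective_recode[where f = "\<lambda>x. if nth_or 0 (rule_list (f x)) 0 = 0 then nth_or 0 (rule_list (f x)) 4 else 0"])
  show "enc (step_writes (f x)) = enc (if nth_or 0 (rule_list (f x)) 0 = 0 then nth_or 0 (rule_list (f x)) 4 else 0)" for x
    by (cases "f x") (auto simp: nth_or_def)
qed (intro eff)

lemma effective_work_tapes [eff]: "effective f \<Longrightarrow> effective (\<lambda>x. work_tapes (f x))"
  and effective_program [eff]: "effective f \<Longrightarrow> effective (\<lambda>x. program (f x))"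
proof -
  have "effective (\<lambda>x. (work_tapes (f x), program (f x)))" if "effective f"
    by (rule effective_recode[OF effective_enc[OF that]])
      (simp add: enc_tm_def tm_encode_def enc_list_def enc_rule_def[abs_def])
  from effective_fst[OF this] effective_snd[OF this]
  show "effective f \<Longrightarrow> effective (\<lambda>x. work_tapes (f x))" "effective f \<Longrightarrow> effective (\<lambda>x. program (f x))"
    by simp_all
qed

lemma effective_tape_read [eff]: "effective f \<Longrightarrow> effective (\<lambda>x. tape_read (f x))"
proof -
  have *: "tape_read t = nth_or 0 (snd t) 0" for t
    by (cases t rule: tape_read.cases) (auto simp: nth_or_def)
  show "effective f \<Longrightarrow> ?thesis" unfolding * by (intro eff)
qed

lemma effective_tape_write [eff]: "effective a \<Longrightarrow> effective f \<Longrightarrow> effective (\<lambda>x. tape_write (a x) (f x))"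
proof -
  have *: "tape_write a t = (fst t, a # tl (snd t))" for a t by (cases t) auto
  show "effective a \<Longrightarrow> effective f \<Longrightarrow> ?thesis" unfolding * by (intro eff)
qed

lemma effective_tape_move [eff]: "effective d \<Longrightarrow> effective f \<Longrightarrow> effective (\<lambda>x. tape_move (d x) (f x))"
proof -
  have *: "tape_move d t = (if d = MStay then t
    else if d = MRight then (tape_read t # fst t, tl (snd t))
    else if fst t = [] then ([], 0 # snd t) else (tl (fst t), nth_or 0 (fst t) 0 # snd t))" for d t
    by (cases "(d, t)" rule: tape_move.cases) (auto simp: nth_or_def)
  show "effective d \<Longrightarrow> effective f \<Longrightarrow> ?thesis" unfolding * by (intro eff)
qed

lemma effective_nat_of_tape [eff]: "effective f \<Longrightarrow> effective (\<lambda>x. nat_of_tape (f x))"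
  unfolding nat_of_tape_def by (intro eff)

lemma effective_replicate [eff]: "effective n \<Longrightarrow> effective a \<Longrightarrow> effective (\<lambda>x. replicate (n x) (a x))"
proof -
  have *: "replicate k b = rec_nat [] (\<lambda>i r. b # r) k" for k and b :: 'b
    by (induction k) auto
  show "effective n \<Longrightarrow> effective a \<Longrightarrow> ?thesis" unfolding *
    by (intro eff effective_compose_fst[of a])
qed

lemma effective_init_config [eff]: "effective M \<Longrightarrow> effective n \<Longrightarrow> effective (\<lambda>x. init_config (M x) (n x))"
  unfolding init_config_def tape_of_nat_def by (intro eff)

lemma effective_lookup [eff]: "effective \<sigma> \<Longrightarrow> effective n \<Longrightarrow> effective (\<lambda>x. lookup (\<sigma> x) (n x))"
  unfolding lookup_def by (intro eff)

lemma effective_apply_rule [eff]: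
  assumes "effective \<sigma>s" "effective r" "effective c"
  shows "effective (\<lambda>x. apply_rule (map lookup (\<sigma>s x)) (r x) (c x))"
proof -
  have *: "apply_rule (map lookup \<sigma>s) r c =
    (if nth_or 0 (rule_list r) 1 \<noteq> fst c then None
     else if nth_or 0 (rule_list r) 0 = 0 then
       (if map (\<lambda>t. tape_read t) (snd c) = step_syms r \<and> length (step_writes r) = length (snd c)
        then Some (nth_or 0 (rule_list r) 3,
          map (\<lambda>z. tape_move (snd (fst z)) (tape_write (fst (fst z)) (snd z))) (zip (step_writes r) (snd c)))
        else None)
     else if nth_or 0 (rule_list r) 2 < length \<sigma>s \<and> 1 < length (snd c)
       then Some (nth_or 0 (rule_list r) 3,
         (snd c)[1 := ([], replicate (lookup (nth_or [] \<sigma>s (nth_or 0 (rule_list r) 2)) (nat_of_tape (nth_or ([], []) (snd c) 1))) 1)])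
       else None)" for \<sigma>s r c
    by (cases r; cases c) (auto simp: nth_or_def tape_of_nat_def case_prod_unfold)
  show ?thesis unfolding * using assms by (intro eff)
qed

lemma effective_tm_step [eff]:
  assumes "effective \<sigma>s" "effective M" "effective c"
  shows "effective (\<lambda>x. tm_step (map lookup (\<sigma>s x)) (M x) (c x))"
proof -
  have *: "first_rule os rs c = foldr (\<lambda>r z. case apply_rule os r c of None \<Rightarrow> z | Some d \<Rightarrow> Some d) rs None" for os rs c
    by (induction rs) (auto split: option.splits)
  show ?thesis unfolding tm_step_def * using assms
    by (intro eff effective_compose_fst[of \<sigma>s] effective_compose_fst[of c])
qed

lemma effective_query_value [eff]: "effective c \<Longrightarrow> effective (\<lambda>x. query_value (c x))"
  unfolding query_value_def by (intro eff)

lemma effective_stuck [eff]: "effective \<sigma>s \<Longrightarrow> effective c \<Longrightarrow> effective (\<lambda>x. stuck (\<sigma>s x) (c x))"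
  unfolding stuck_def by (intro eff effective_compose_fst[of \<sigma>s] effective_compose_fst[of c])

lemma effective_run [eff]:
  assumes "effective \<sigma>s" "effective M" "effective t" "effective n"
  shows "effective (\<lambda>x. run (\<sigma>s x) (M x) (t x) (n x))"
proof -
  have f: "(sim_step \<sigma>s M ^^ t) z = ((\<lambda>s. sim_step \<sigma>s M s) ^^ t) z" for \<sigma>s M t z by simp
  have "effective (\<lambda>w :: nat option list list \<times> tm \<times> config option. sim_step (fst w) (fst (snd w)) (snd (snd w)))"
    unfolding sim_step_def by (intro eff)
  moreover have "effective (\<lambda>x. (\<sigma>s (fst x), M (fst x), snd x))"
    by (intro eff effective_compose_fst[of \<sigma>s] effective_compose_fst[of M] assms)
  ultimately have "effective (\<lambda>x. sim_step (\<sigma>s (fst x)) (M (fst x)) (snd x))"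
    using effective_compose[of "\<lambda>w. sim_step (fst w) (fst (snd w)) (snd (snd w))" "\<lambda>x. (\<sigma>s (fst x), M (fst x), snd x)"]
    by simp
  then show ?thesis unfolding run_def using assms
    by (intro eff effective_compose_fst[of \<sigma>s] effective_compose_fst[of M])
qed

subsection \<open>Total machines and oracle machines\<close>

text \<open>A step bound at which the simulation answers is found by search. Without oracles no
  configuration is stuck, and any answer is correct by \<open>run_sound\<close>.\<close>

lemma computable_nat_fun_imp_effective:
  fixes G :: "nat \<Rightarrow> 'b::encodable"
  assumes "\<And>n. outputs [] M n (enc (G n))"
  shows "effective G"
proof -
  define t where "t n = (LEAST t. run [] M t n \<noteq> None)" for n
  have ex: "\<exists>t. run [] M t n \<noteq> None" for n
    using run_complete[OF assms[of n]] by fastforce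
  have "run [] M (t n) n = Some (enc (G n))" for n
  proof -
    obtain v where v: "run [] M (t n) n = Some v" using LeastI_ex[OF ex[of n]] by (auto simp: t_def)
    then have "outputs [] M n v" by (intro run_sound[of "[]"]) auto
    then show ?thesis using v assms outputs_unique by blast
  qed
  moreover have "effective t"
    unfolding t_def by (rule effective_Least[OF _ ex surj_enc_nat]) (intro eff)
  then have "effective (\<lambda>n. case run [] M (t n) n of None \<Rightarrow> 0 | Some v \<Rightarrow> v)" by (intro eff)
  ultimately show ?thesis by (elim effective_recode) simp
qed

text \<open>A point near \<alpha> has an oracle that agrees with one of \<alpha> at all places used
  by the computation at \<alpha>. The machine then gives the same output for both points, and both
  values are close to it.\<close>

lemma computable_on_imp_continuous_on:
  fixes s :: "nat \<Rightarrow> 'a::metric_space" and t :: "nat \<Rightarrow> 'b::metric_space"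
  assumes s: "dense_sequence s" and g: "computable_on s t UNIV g"
  shows "continuous_on UNIV g"
proof -
  obtain M where "\<forall>\<alpha>\<in>UNIV. \<forall>\<phi>. is_oracle s \<alpha> \<phi> \<longrightarrow>
      (\<forall>n. \<exists>m. outputs [\<phi>] M n m \<and> dist (t m) (g \<alpha>) < 1 / 2 ^ n)"
    using g unfolding computable_on_def by blast
  then have M: "\<And>\<alpha> \<phi> n. is_oracle s \<alpha> \<phi> \<Longrightarrow> \<exists>m. outputs [\<phi>] M n m \<and> dist (t m) (g \<alpha>) < 1 / 2 ^ n"
    by blast
  have approx: "\<exists>i. dist \<alpha> (s i) < 1 / 2 ^ n" for \<alpha> n
  proof -
    have "\<alpha> \<in> closure (range s)" using s by (simp add: dense_sequence_def)
    then have "\<exists>y\<in>range s. dist y \<alpha> < 1 / 2 ^ n" unfolding closure_approachable by simp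
    then show ?thesis by (auto simp: dist_commute)
  qed
  define \<phi> where "\<phi> \<alpha> n = (SOME i. dist \<alpha> (s i) < 1 / 2 ^ n)" for \<alpha> n
  have \<phi>: "dist \<alpha> (s (\<phi> \<alpha> n)) < 1 / 2 ^ n" for \<alpha> n
    unfolding \<phi>_def using approx by (rule someI_ex)
  show ?thesis
    unfolding continuous_on_iff
  proof (intro ballI allI impI)
    fix \<alpha> :: 'a and e :: real assume e: "0 < e"
    obtain n where n: "1 / 2 ^ n < e / 2"
      using real_arch_pow_inv[of "e / 2" "1 / 2"] e by (auto simp: power_one_over)
    have "is_oracle s \<alpha> (\<phi> \<alpha>)" using \<phi> by (simp add: is_oracle_def)
    then obtain m where m: "outputs [\<phi> \<alpha>] M n m" "dist (t m) (g \<alpha>) < 1 / 2 ^ n" using M by blast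
    obtain T K where TK: "\<And>\<sigma>s. list_all2 approximates \<sigma>s [\<phi> \<alpha>] \<Longrightarrow>
        (\<forall>\<sigma>\<in>set \<sigma>s. \<forall>x<K. nth_or None \<sigma> x \<noteq> None) \<Longrightarrow> run \<sigma>s M T n = Some m"
      using run_complete[OF m(1)] by blast
    let ?\<sigma> = "map (\<lambda>i. Some (\<phi> \<alpha> i)) [0..<K]"
    have run: "run [?\<sigma>] M T n = Some m"
      by (rule TK) (auto simp: approximates_def nth_or_def split: if_splits)
    \<comment> \<open>The inequalities required of an oracle are strict, so finitely many of them
      survive a small change of the point.\<close>
    have "\<exists>d>0. \<forall>\<beta>. dist \<beta> \<alpha> < d \<longrightarrow> (\<forall>i<K. dist \<beta> (s (\<phi> \<alpha> i)) < 1 / 2 ^ i)"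
    proof (induction K)
      case (Suc K)
      then obtain d where d: "d > 0" "\<And>\<beta> i. dist \<beta> \<alpha> < d \<Longrightarrow> i < K \<Longrightarrow> dist \<beta> (s (\<phi> \<alpha> i)) < 1 / 2 ^ i" by blast
      let ?d = "min d (1 / 2 ^ K - dist \<alpha> (s (\<phi> \<alpha> K)))"
      have "dist \<beta> (s (\<phi> \<alpha> i)) < 1 / 2 ^ i" if "dist \<beta> \<alpha> < ?d" "i < Suc K" for \<beta> i
        using that d(2)[of \<beta> i] dist_triangle[of \<beta> "s (\<phi> \<alpha> K)" \<alpha>] by (cases "i = K") auto
      then show ?case using d(1) \<phi>[of \<alpha> K] by (intro exI[of _ ?d]) auto
    qed (auto intro: exI[of _ 1])
    then obtain d where d: "d > 0" "\<And>\<beta> i. dist \<beta> \<alpha> < d \<Longrightarrow> i < K \<Longrightarrow> dist \<beta> (s (\<phi> \<alpha> i)) < 1 / 2 ^ i" by blast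
    have "dist (g \<beta>) (g \<alpha>) < e" if "dist \<beta> \<alpha> < d" for \<beta>
    proof -
      let ?\<psi> = "\<lambda>i. if i < K then \<phi> \<alpha> i else \<phi> \<beta> i"
      have "is_oracle s \<beta> ?\<psi>" using d(2)[OF that] \<phi> by (auto simp: is_oracle_def)
      then obtain m' where m': "outputs [?\<psi>] M n m'" "dist (t m') (g \<beta>) < 1 / 2 ^ n" using M by blast
      have "outputs [?\<psi>] M n m"
        by (rule run_sound[OF _ run]) (auto simp: approximates_def nth_or_def split: if_splits)
      then have "m' = m" using m'(1) outputs_unique by blast
      then show ?thesis using m(2) m'(2) n dist_triangle3[of "g \<beta>" "g \<alpha>" "t m"] by auto
    qed
    then show "\<exists>d>0. \<forall>\<beta>\<in>UNIV. dist \<beta> \<alpha> < d \<longrightarrow> dist (g \<beta>) (g \<alpha>) < e" using d(1) by blast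
  qed
qed

section \<open>Measures\<close>

subsection \<open>Averages approximating points of a convex hull\<close>

text \<open>
  Greedy choice: as \<open>x\<close> is in the hull, some point of \<open>V\<close> lies on the far side of \<open>x\<close> from the
  partial sum of deviations, so that the squared norm grows by at most \<open>D\<^sup>2\<close> in each step.
\<close>

lemma convex_hull_greedy:
  fixes x :: "'a::real_inner"
  assumes x: "x \<in> convex hull V" and D: "\<And>v. v \<in> V \<Longrightarrow> norm (v - x) \<le> D"
  shows "\<exists>vs. set vs \<subseteq> V \<and> length vs = K \<and> (norm (\<Sum>v\<leftarrow>vs. v - x))\<^sup>2 \<le> real K * D\<^sup>2"
proof (induction K)
  case (Suc K)
  then obtain vs where vs: "set vs \<subseteq> V" "length vs = K" "(norm (\<Sum>v\<leftarrow>vs. v - x))\<^sup>2 \<le> real K * D\<^sup>2"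
    by blast
  let ?S = "\<Sum>v\<leftarrow>vs. v - x"
  have "\<exists>v\<in>V. ?S \<bullet> (v - x) \<le> 0"
  proof (rule ccontr)
    assume "\<not> ?thesis"
    then have "V \<subseteq> {y. ?S \<bullet> y > ?S \<bullet> x}" by (auto simp: inner_diff_right not_le)
    then have "convex hull V \<subseteq> {y. ?S \<bullet> y > ?S \<bullet> x}"
      by (rule hull_minimal) (rule convex_halfspace_gt)
    then show False using x by auto
  qed
  then obtain v where v: "v \<in> V" "?S \<bullet> (v - x) \<le> 0" by blast
  have "(norm (?S + (v - x)))\<^sup>2 = (norm ?S)\<^sup>2 + 2 * (?S \<bullet> (v - x)) + (norm (v - x))\<^sup>2"
    by (simp add: power2_norm_eq_inner inner_add_left inner_add_right inner_commute)
  also have "\<dots> \<le> real K * D\<^sup>2 + D\<^sup>2"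
    using vs(3) v(2) power_mono[OF D[OF v(1)], of 2] by simp
  finally have "(norm (\<Sum>v\<leftarrow>v # vs. v - x))\<^sup>2 \<le> real (Suc K) * D\<^sup>2"
    by (simp add: algebra_simps)
  then show ?case using vs v by (intro exI[of _ "v # vs"]) auto
qed simp

text \<open>Division of the greedy sum by \<open>K\<close> leaves a deviation of at most
  \<open>D / sqrt K\<close>, whatever the dimension and the size of \<open>V\<close>.\<close>

lemma convex_hull_average:
  fixes x :: "'a::real_inner"
  assumes x: "x \<in> convex hull V" and D: "\<And>v. v \<in> V \<Longrightarrow> norm (v - x) \<le> D"
    and K: "0 < K" "D\<^sup>2 \<le> real K * e\<^sup>2" and e: "0 \<le> e"
  shows "\<exists>vs. set vs \<subseteq> V \<and> length vs = K \<and> norm ((1 / real K) *\<^sub>R sum_list vs - x) \<le> e"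
proof -
  obtain vs where vs: "set vs \<subseteq> V" "length vs = K" "(norm (\<Sum>v\<leftarrow>vs. v - x))\<^sup>2 \<le> real K * D\<^sup>2"
    using convex_hull_greedy[OF x D] by blast
  have "(\<Sum>v\<leftarrow>vs. v - x) = sum_list vs - real K *\<^sub>R x"
    using vs(2) by (induction vs arbitrary: K) (auto simp: algebra_simps)
  then have eq: "(1 / real K) *\<^sub>R sum_list vs - x = (1 / real K) *\<^sub>R (\<Sum>v\<leftarrow>vs. v - x)"
    using K(1) by (simp add: scaleR_diff_right)
  have "(norm (\<Sum>v\<leftarrow>vs. v - x))\<^sup>2 \<le> real K * (real K * e\<^sup>2)"
    using vs(3) mult_left_mono[OF K(2), of "real K"] by linarith
  also have "\<dots> = (real K * e)\<^sup>2" by (simp add: power_mult_distrib power2_eq_square)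
  finally have "norm (\<Sum>v\<leftarrow>vs. v - x) \<le> real K * e" by (rule power2_le_imp_le) (use e in simp)
  then have "norm ((1 / real K) *\<^sub>R sum_list vs - x) \<le> e"
    unfolding eq using K(1) by (simp add: divide_le_eq mult.commute)
  then show ?thesis using vs by blast
qed

lemma average_in_convex:
  fixes vs :: "'a::real_vector list"
  assumes "convex C" "set vs \<subseteq> C" "vs \<noteq> []"
  shows "(1 / real (length vs)) *\<^sub>R sum_list vs \<in> C"
proof -
  have "sum_list vs = (\<Sum>i<length vs. vs ! i)" by (simp add: sum_list_sum_nth atLeast0LessThan)
  then have "(1 / real (length vs)) *\<^sub>R sum_list vs = (\<Sum>i<length vs. (1 / real (length vs)) *\<^sub>R (vs ! i))"
    by (simp add: scaleR_sum_right)
  also have "\<dots> \<in> C" using assms by (intro convex_sum) auto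
  finally show ?thesis .
qed

subsection \<open>Invariant measures\<close>

lemma invariant_measuresD:
  assumes "\<mu> \<in> invariant_measures f"
  shows "prob_space \<mu>" "sets \<mu> = sets borel" "f \<in> borel_measurable borel" "distr \<mu> borel f = \<mu>"
proof -
  show p: "prob_space \<mu>" and s: "sets \<mu> = sets borel" using assms by (auto simp: invariant_measures_def)
  have inv: "\<And>A. A \<in> sets borel \<Longrightarrow> f -` A \<in> sets borel" "\<And>A. A \<in> sets borel \<Longrightarrow> emeasure \<mu> (f -` A) = emeasure \<mu> A"
    using assms by (auto simp: invariant_measures_def)
  show m: "f \<in> borel_measurable borel" using inv(1) by (auto simp: measurable_def)
  have m': "f \<in> measurable \<mu> borel" using m measurable_cong_sets[OF s refl] by blast
  have "space \<mu> = UNIV" using sets_eq_imp_space_eq[OF s] by simp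
  then show "distr \<mu> borel f = \<mu>" using s inv(2) m'
    by (intro measure_eqI) (auto simp: emeasure_distr)
qed

lemma invariant_measuresI:
  assumes "prob_space \<mu>" "sets \<mu> = sets borel" "f \<in> borel_measurable borel" "distr \<mu> borel f = \<mu>"
  shows "\<mu> \<in> invariant_measures f"
proof -
  have m': "f \<in> measurable \<mu> borel" using assms(3) measurable_cong_sets[OF assms(2) refl] by blast
  have "space \<mu> = UNIV" using sets_eq_imp_space_eq[OF assms(2)] by simp
  then have "emeasure \<mu> (f -` A) = emeasure \<mu> A" if "A \<in> sets borel" for A
    using emeasure_distr[OF m' that] assms(4) by simp
  moreover have "f -` A \<in> sets borel" if "A \<in> sets borel" for A
    using measurable_sets[OF assms(3) that] by simp
  ultimately show ?thesis using assms(1,2) by (auto simp: invariant_measures_def)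
qed

lemma integrable_bounded_borel:
  fixes \<phi> :: "'a::topological_space \<Rightarrow> real"
  assumes "prob_space \<mu>" "sets \<mu> = sets borel" "\<phi> \<in> borel_measurable borel" "\<And>x. \<bar>\<phi> x\<bar> \<le> B"
  shows "integrable \<mu> \<phi>"
proof -
  interpret prob_space \<mu> by fact
  have "\<phi> \<in> borel_measurable \<mu>" using assms(3) measurable_cong_sets[OF assms(2) refl] by blast
  then show ?thesis by (intro integrable_const_bound[of _ B]) (use assms in auto)
qed

text \<open>The mixture is realised as a coin toss with bias \<open>u\<close> followed by \<mu> or
  \<nu>, so that \<open>integral_bind\<close> evaluates its integrals.\<close>

lemma convex_combination_invariant_measures:
  assumes \<mu>: "\<mu> \<in> invariant_measures f" and \<nu>: "\<nu> \<in> invariant_measures f" and u: "0 \<le> u" "u \<le> 1"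
  shows "\<exists>\<rho>\<in>invariant_measures f. \<forall>(\<phi> :: 'a::topological_space \<Rightarrow> real) B. \<phi> \<in> borel_measurable borel \<longrightarrow>
    (\<forall>x. \<bar>\<phi> x\<bar> \<le> B) \<longrightarrow> (\<integral>x. \<phi> x \<partial>\<rho>) = u * (\<integral>x. \<phi> x \<partial>\<mu>) + (1 - u) * (\<integral>x. \<phi> x \<partial>\<nu>)"
proof -
  note M = invariant_measuresD[OF \<mu>] and N = invariant_measuresD[OF \<nu>]
  let ?p = "measure_pmf (bernoulli_pmf u)"
  let ?k = "\<lambda>b. if b then \<mu> else \<nu>"
  let ?\<rho> = "bind ?p ?k"
  have k: "?k \<in> measurable ?p (subprob_algebra borel)"
    using M N by (auto simp: space_subprob_algebra prob_space_imp_subprob_space)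
  have sets: "sets ?\<rho> = sets borel" by (rule sets_bind) (use M N in auto)
  have em: "emeasure ?\<rho> A = ennreal u * emeasure \<mu> A + ennreal (1 - u) * emeasure \<nu> A" if "A \<in> sets borel" for A
    by (subst emeasure_bind[OF _ k that]) (use u in \<open>auto simp: mult.commute\<close>)
  have sp: "space \<mu> = UNIV" "space \<nu> = UNIV" "space ?\<rho> = UNIV"
    using sets_eq_imp_space_eq[OF M(2)] sets_eq_imp_space_eq[OF N(2)] sets_eq_imp_space_eq[OF sets]
    unfolding space_borel by blast+
  have "?\<rho> \<in> invariant_measures f"
    unfolding invariant_measures_def
  proof (intro CollectI conjI ballI prob_spaceI sets)
    show "emeasure ?\<rho> (space ?\<rho>) = 1"
      using em[of UNIV] prob_space.emeasure_space_1[OF M(1)] prob_space.emeasure_space_1[OF N(1)] u sp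
      by (simp flip: ennreal_plus)
    fix A :: "'a set" assume A: "A \<in> sets borel"
    have *: "f -` A \<in> sets borel" "emeasure \<mu> (f -` A) = emeasure \<mu> A" "emeasure \<nu> (f -` A) = emeasure \<nu> A"
      using \<mu> \<nu> A by (auto simp: invariant_measures_def)
    show "f -` A \<in> sets borel" "emeasure ?\<rho> (f -` A) = emeasure ?\<rho> A"
      using * em A by auto
  qed
  moreover have "(\<integral>x. \<phi> x \<partial>?\<rho>) = u * (\<integral>x. \<phi> x \<partial>\<mu>) + (1 - u) * (\<integral>x. \<phi> x \<partial>\<nu>)"
    if \<phi>: "\<phi> \<in> borel_measurable borel" "\<And>x. \<bar>\<phi> x\<bar> \<le> B" for \<phi> :: "'a \<Rightarrow> real" and B
  proof -
    have "(\<integral>x. \<phi> x \<partial>?\<rho>) = (\<integral>b. (\<integral>x. \<phi> x \<partial>?k b) \<partial>?p)"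
    proof (rule integral_bind[where K = borel and B = B and B' = 1, OF \<phi>(1,2) k])
      show "finite_measure ?p" by (rule measure_pmf.finite_measure)
      have "emeasure (?k b) (space (?k b)) \<le> ennreal 1" for b
        using prob_space.emeasure_space_1[OF M(1)] prob_space.emeasure_space_1[OF N(1)] by simp
      then show "AE b in ?p. emeasure (?k b) (space (?k b)) \<le> ennreal 1" by simp
    qed
    also have "\<dots> = u * (\<integral>x. \<phi> x \<partial>\<mu>) + (1 - u) * (\<integral>x. \<phi> x \<partial>\<nu>)"
      using u by (subst integral_measure_pmf[of UNIV]) (auto simp: UNIV_bool)
    finally show ?thesis .
  qed
  ultimately show ?thesis by (intro bexI[of _ ?\<rho>] allI impI) auto
qed

lemma measurable_uniform_count_measure: "g \<in> measurable (uniform_count_measure A) borel"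
  by (simp add: measurable_def space_uniform_count_measure sets_uniform_count_measure)

lemma integral_periodic_measure:
  fixes \<phi> :: "'a::topological_space \<Rightarrow> real"
  assumes "0 < p" "\<phi> \<in> borel_measurable borel"
  shows "(\<integral>x. \<phi> x \<partial>periodic_measure f q p) = (\<Sum>i<p. \<phi> ((f ^^ i) q)) / real p"
proof -
  have "(\<integral>x. \<phi> x \<partial>periodic_measure f q p) = (\<integral>i. \<phi> ((f ^^ i) q) \<partial>uniform_count_measure {..<p})"
    unfolding periodic_measure_def
    by (rule integral_distr[OF measurable_uniform_count_measure assms(2)])
  then show ?thesis by (simp add: integral_uniform_count_measure)
qed

lemma periodic_measure_invariant:
  assumes f: "f \<in> borel_measurable borel" and q: "periodic_point f q p"
  shows "periodic_measure f q p \<in> invariant_measures f"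
proof -
  have p: "0 < p" "(f ^^ p) q = q" using q by (auto simp: periodic_point_def)
  let ?\<mu> = "periodic_measure f q p"
  have sets: "sets ?\<mu> = sets borel" by (simp add: periodic_measure_def)
  interpret prob_space ?\<mu>
    unfolding periodic_measure_def
    by (rule prob_space.prob_space_distr[OF prob_space_uniform_count_measure measurable_uniform_count_measure])
      (use p in auto)
  have "measure ?\<mu> (f -` A) = measure ?\<mu> A" if A: "A \<in> sets borel" for A
  proof -
    have A': "f -` A \<in> sets borel" using measurable_sets[OF f A] by simp
    let ?g = "\<lambda>i. indicator A ((f ^^ i) q) :: real"
    have "(\<Sum>i<p. indicator (f -` A) ((f ^^ i) q)) = (\<Sum>i<p. ?g (Suc i))"
      by (simp add: indicator_def)
    \<comment> \<open>The shifted sum gains the term at \<open>p\<close> and loses that at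
      \<open>0\<close>; these agree by periodicity.\<close>
    also have "\<dots> = (\<Sum>i<p. ?g i)"
      using sum.lessThan_Suc_shift[of ?g p] p(2) by (simp add: comp_def)
    finally show ?thesis using measure_periodic_measure[OF p(1) A] measure_periodic_measure[OF p(1) A'] by simp
  qed
  moreover have "f -` A \<in> sets borel" if "A \<in> sets borel" for A
    using measurable_sets[OF f that] by simp
  ultimately show ?thesis
    unfolding invariant_measures_def using prob_space_axioms sets by (auto simp: emeasure_eq_measure)
qed

subsection \<open>Integrals and partitions\<close>

lemma integral_partition_approx:
  fixes \<phi> :: "'a::topological_space \<Rightarrow> real" and P :: "nat \<Rightarrow> 'a set"
  assumes \<mu>: "prob_space \<mu>" "sets \<mu> = sets borel" and \<phi>: "\<phi> \<in> borel_measurable borel" "\<And>x. \<bar>\<phi> x\<bar> \<le> B"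
    and P: "\<And>i. i < k \<Longrightarrow> P i \<in> sets borel" "disjoint_family_on P {..<k}" "(\<Union>i<k. P i) = UNIV"
    and c: "\<And>i x. i < k \<Longrightarrow> x \<in> P i \<Longrightarrow> \<bar>\<phi> x - c i\<bar> \<le> d"
  shows "\<bar>(\<integral>x. \<phi> x \<partial>\<mu>) - (\<Sum>i<k. c i * measure \<mu> (P i))\<bar> \<le> d"
proof -
  interpret prob_space \<mu> by fact
  let ?g = "\<lambda>x. \<Sum>i<k. c i * indicator (P i) x"
  have [measurable]: "\<And>i. i < k \<Longrightarrow> P i \<in> sets \<mu>" using P(1) \<mu>(2) by simp
  have ig: "integrable \<mu> (\<lambda>x. c i * indicator (P i) x)" if "i < k" for i
    using that by (intro integrable_mult_right integrable_real_indicator) (auto simp: emeasure_eq_measure)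
  then have ig': "integrable \<mu> ?g" by (intro Bochner_Integration.integrable_sum) auto
  have i\<phi>: "integrable \<mu> \<phi>" using integrable_bounded_borel[OF \<mu> \<phi>] .
  have "(\<integral>x. ?g x \<partial>\<mu>) = (\<Sum>i<k. \<integral>x. c i * indicator (P i) x \<partial>\<mu>)"
    by (rule Bochner_Integration.integral_sum) (use ig in auto)
  also have "\<dots> = (\<Sum>i<k. c i * measure \<mu> (P i))"
    by (rule sum.cong) (use \<mu>(2) in \<open>auto simp: sets_eq_imp_space_eq[OF \<mu>(2)]\<close>)
  finally have "(\<integral>x. \<phi> x \<partial>\<mu>) - (\<Sum>i<k. c i * measure \<mu> (P i)) = (\<integral>x. \<phi> x - ?g x \<partial>\<mu>)"
    using ig' i\<phi> by simp
  also have "\<bar>\<dots>\<bar> \<le> (\<integral>x. \<bar>\<phi> x - ?g x\<bar> \<partial>\<mu>)" by (rule integral_abs_bound)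
  also have "\<dots> \<le> (\<integral>x. d \<partial>\<mu>)"
  proof (rule integral_mono)
    fix x
    obtain i where i: "i < k" "x \<in> P i" using P(3) by auto
    have "?g x = (\<Sum>j<k. if j = i then c i else 0)"
      using P(2) i by (intro sum.cong) (auto simp: indicator_def disjoint_family_on_def)
    then have "?g x = c i" using i by simp
    then show "\<bar>\<phi> x - ?g x\<bar> \<le> d" using c[OF i] by simp
  qed (use ig' i\<phi> in auto)
  also have "\<dots> = d" by (simp add: prob_space)
  finally show ?thesis .
qed

lemma conv_measures_measure:
  assumes \<nu>: "\<nu> \<in> conv_measures \<mu>s" and \<mu>s: "\<And>\<mu>. \<mu> \<in> set \<mu>s \<Longrightarrow> prob_space \<mu> \<and> sets \<mu> = sets borel"
  obtains w :: "nat \<Rightarrow> real" where "\<And>j. j < length \<mu>s \<Longrightarrow> 0 \<le> w j" "(\<Sum>j<length \<mu>s. w j) = 1"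
    "\<And>A. A \<in> sets borel \<Longrightarrow> measure \<nu> A = (\<Sum>j<length \<mu>s. w j * measure (\<mu>s ! j) A)"
proof -
  obtain w :: "nat \<Rightarrow> real" where w: "\<forall>j<length \<mu>s. 0 \<le> w j" "(\<Sum>j<length \<mu>s. w j) = 1"
    "\<forall>A\<in>sets borel. emeasure \<nu> A = (\<Sum>j<length \<mu>s. ennreal (w j) * emeasure (\<mu>s ! j) A)"
    using \<nu> unfolding conv_measures_def by blast
  have "measure \<nu> A = (\<Sum>j<length \<mu>s. w j * measure (\<mu>s ! j) A)" if A: "A \<in> sets borel" for A
  proof -
    have "emeasure \<nu> A = (\<Sum>j<length \<mu>s. ennreal (w j * measure (\<mu>s ! j) A))"
      unfolding w(3)[rule_format, OF A]
    proof (rule sum.cong[OF refl])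
      fix j assume "j \<in> {..<length \<mu>s}"
      then have j: "j < length \<mu>s" by simp
      interpret prob_space "\<mu>s ! j" using \<mu>s[of "\<mu>s ! j"] j by simp
      show "ennreal (w j) * emeasure (\<mu>s ! j) A = ennreal (w j * measure (\<mu>s ! j) A)"
        using w(1) j by (simp add: emeasure_eq_measure ennreal_mult)
    qed
    also have "\<dots> = ennreal (\<Sum>j<length \<mu>s. w j * measure (\<mu>s ! j) A)"
      using w(1) by (intro sum_ennreal) auto
    finally show ?thesis
      using w(1) by (intro measure_eq_emeasure_eq_ennreal sum_nonneg) auto
  qed
  then show ?thesis using that w by blast
qed

subsection \<open>Coding a compact metric space by reals\<close>

lemma ternary_sums: "(\<lambda>i. 2 / 3 ^ (i + 1) :: real) sums 1"
proof -
  have "(\<lambda>i. (2 / 3) * (1 / 3) ^ i :: real) sums ((2 / 3) * (1 / (1 - 1 / 3)))"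
    by (intro sums_mult geometric_sums) auto
  then show ?thesis by (simp add: power_one_over field_simps)
qed

lemma ternary_tail: "(\<Sum>i. 2 / 3 ^ (i + Suc j + 1) :: real) = 1 / 3 ^ Suc j"
proof -
  have "(\<lambda>i. (2 / 3 ^ (i + 1)) * (1 / 3 ^ Suc j) :: real) sums (1 * (1 / 3 ^ Suc j))"
    by (intro sums_mult2 ternary_sums)
  then show ?thesis by (simp add: sums_iff power_add field_simps)
qed

lemma summable_ternary:
  fixes d :: "nat \<Rightarrow> real"
  assumes "\<And>i. \<bar>d i\<bar> \<le> 1"
  shows "summable (\<lambda>i. d i * (2 / 3 ^ (i + 1)))"
proof (rule summable_comparison_test')
  show "summable (\<lambda>i. 2 / 3 ^ (i + 1) :: real)" using ternary_sums by (rule sums_summable)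
  show "norm (d i * (2 / 3 ^ (i + 1))) \<le> 2 / 3 ^ (i + 1)" if "0 \<le> i" for i
    using mult_right_mono[OF assms[of i], of "2 / 3 ^ (i + 1)"] by (simp add: abs_mult)
qed

text \<open>The first nonzero term has size \<open>2 / 3 ^ Suc j\<close> and all later ones together
  at most half of that. This is why codes are written as in the Cantor set: close codes share their
  first digits, which fails for binary expansions.\<close>

lemma ternary_first_digit:
  fixes d :: "nat \<Rightarrow> real"
  assumes d: "\<And>i. \<bar>d i\<bar> \<le> 1" and 0: "\<And>i. i < j \<Longrightarrow> d i = 0" and 1: "\<bar>d j\<bar> = 1"
  shows "1 / 3 ^ Suc j \<le> \<bar>\<Sum>i. d i * (2 / 3 ^ (i + 1))\<bar>"
proof -
  let ?a = "\<lambda>i. d i * (2 / 3 ^ (i + 1))"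
  have sm: "summable ?a" by (rule summable_ternary[OF d])
  have split: "(\<Sum>i. ?a i) = (\<Sum>i. ?a (i + Suc j)) + sum ?a {..<Suc j}"
    by (rule suminf_split_initial_segment[OF sm])
  have "sum ?a {..<j} = 0" using 0 by (intro sum.neutral) auto
  then have hd: "\<bar>sum ?a {..<Suc j}\<bar> = 2 * (1 / 3 ^ Suc j)"
    using 1 by (simp add: abs_mult)
  have st: "summable (\<lambda>i. 2 / 3 ^ (i + Suc j + 1) :: real)"
    using summable_ignore_initial_segment[OF sums_summable[OF ternary_sums], of "Suc j"] by simp
  have le: "norm (?a (i + Suc j)) \<le> 2 / 3 ^ (i + Suc j + 1)" for i
    using mult_right_mono[OF d[of "i + Suc j"], of "2 / 3 ^ (i + Suc j + 1)"] by (simp add: abs_mult)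
  have "norm (\<Sum>i. ?a (i + Suc j)) \<le> (\<Sum>i. 2 / 3 ^ (i + Suc j + 1))"
    by (rule norm_suminf_le[OF le st])
  then have "\<bar>\<Sum>i. ?a (i + Suc j)\<bar> \<le> 1 / 3 ^ Suc j" unfolding ternary_tail by simp
  then show ?thesis unfolding split using hd by linarith
qed

text \<open>The digits of \<open>c x\<close> record which of the balls \<open>U j\<close> contain
  \<open>x\<close>, where \<open>j\<close> runs through all pairs of a dense point and a radius
  \<open>1 / 2 ^ n\<close>. By compactness finitely many balls of one small radius cover the space,
  so finitely many common digits force two points into a common small ball.\<close>

lemma compact_coding:
  fixes s :: "nat \<Rightarrow> 'a::metric_space"
  assumes "compact (UNIV :: 'a set)" "dense_sequence s"
  shows "\<exists>c :: 'a \<Rightarrow> real. c \<in> borel_measurable borel \<and> (\<forall>x. 0 \<le> c x \<and> c x \<le> 1) \<and>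
    (\<forall>e>0. \<exists>d>0. \<forall>x y. \<bar>c x - c y\<bar> < d \<longrightarrow> dist x y < e)"
proof -
  define U where "U j = ball (s (fst (prod_decode j))) (1 / 2 ^ snd (prod_decode j))" for j
  define b where "b j x = (indicator (U j) x :: real)" for j x
  define c where "c x = (\<Sum>j. b j x * (2 / 3 ^ (j + 1)))" for x
  have b: "0 \<le> b j x" "b j x \<le> 1" "\<bar>b j x\<bar> \<le> 1" "\<bar>b j x - b j y\<bar> \<le> 1" "b j x \<noteq> b j y \<Longrightarrow> \<bar>b j x - b j y\<bar> = 1" for j x y
    by (auto simp: b_def indicator_def)
  have [measurable]: "b j \<in> borel_measurable borel" for j
    unfolding b_def[abs_def] U_def by (intro borel_measurable_indicator) auto
  have sm: "summable (\<lambda>j. b j x * (2 / 3 ^ (j + 1)))" for x by (rule summable_ternary[OF b(3)])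
  have "c \<in> borel_measurable borel" unfolding c_def[abs_def] by measurable
  moreover have "0 \<le> c x" for x unfolding c_def by (rule suminf_nonneg[OF sm]) (simp add: b)
  moreover have "c x \<le> 1" for x
  proof -
    have "c x \<le> (\<Sum>j. 2 / 3 ^ (j + 1))"
      unfolding c_def
    proof (rule suminf_le[OF _ sm])
      show "summable (\<lambda>j. 2 / 3 ^ (j + 1) :: real)" using ternary_sums by (rule sums_summable)
      show "b j x * (2 / 3 ^ (j + 1)) \<le> 2 / 3 ^ (j + 1)" for j
        using mult_right_mono[OF b(2)[of j x], of "2 / 3 ^ (j + 1)"] by simp
    qed
    then show ?thesis using sums_unique[OF ternary_sums] by simp
  qed
  moreover have "\<exists>d>0. \<forall>x y. \<bar>c x - c y\<bar> < d \<longrightarrow> dist x y < e" if e: "0 < e" for e :: real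
  proof -
    obtain n where n: "1 / 2 ^ n < e / 2"
      using real_arch_pow_inv[of "e / 2" "1 / 2"] e by (auto simp: power_one_over)
    have "UNIV \<subseteq> (\<Union>i. ball (s i) (1 / 2 ^ n))"
    proof
      fix x :: 'a
      have "x \<in> closure (range s)" using assms(2) by (simp add: dense_sequence_def)
      moreover have "0 < (1 / 2 ^ n :: real)" by simp
      ultimately show "x \<in> (\<Union>i. ball (s i) (1 / 2 ^ n))" unfolding closure_approachable by (metis UN_iff UNIV_I imageE mem_ball)
    qed
    then obtain I where I: "finite I" "UNIV \<subseteq> (\<Union>i\<in>I. ball (s i) (1 / 2 ^ n))"
      using compactE_image[OF assms(1), of UNIV "\<lambda>i. ball (s i) (1 / 2 ^ n)"] by (metis open_ball)
    \<comment> \<open>Beyond the positions of all digits that belong to the finite cover.\<close>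
    define J where "J = Suc (Max (insert 0 ((\<lambda>i. prod_encode (i, n)) ` I)))"
    have J: "prod_encode (i, n) < J" if "i \<in> I" for i
      unfolding J_def using I(1) that by (simp add: less_Suc_eq_le)
    have "dist x y < e" if xy: "\<bar>c x - c y\<bar> < 1 / 3 ^ J" for x y
    proof -
      have eq: "b j x = b j y" if "j < J" for j
      proof (rule ccontr)
        assume "b j x \<noteq> b j y"
        define k where "k = (LEAST j. b j x \<noteq> b j y)"
        have k: "b k x \<noteq> b k y" "k \<le> j" unfolding k_def using \<open>b j x \<noteq> b j y\<close>
          by (rule LeastI, rule Least_le)
        have k': "b i x - b i y = 0" if "i < k" for i using not_less_Least[of i "\<lambda>j. b j x \<noteq> b j y"] that by (simp add: k_def)
        have "1 / 3 ^ Suc k \<le> \<bar>\<Sum>i. (b i x - b i y) * (2 / 3 ^ (i + 1))\<bar>"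
          by (rule ternary_first_digit[of "\<lambda>i. b i x - b i y", OF b(4) k' b(5)[OF k(1)]])
        also have "(\<Sum>i. (b i x - b i y) * (2 / 3 ^ (i + 1))) = c x - c y"
          unfolding c_def left_diff_distrib by (rule suminf_diff[symmetric, OF sm sm])
        finally have "1 / 3 ^ Suc k < (1 / 3 ^ J :: real)" using xy by linarith
        moreover have "(3 :: real) ^ Suc k \<le> 3 ^ J" using k(2) \<open>j < J\<close> by (intro power_increasing) auto
        then have "1 / 3 ^ J \<le> (1 / 3 ^ Suc k :: real)" by (intro divide_left_mono) auto
        ultimately show False by linarith
      qed
      have "x \<in> (\<Union>i\<in>I. ball (s i) (1 / 2 ^ n))" using I(2) by blast
      then obtain i where i: "i \<in> I" "x \<in> ball (s i) (1 / 2 ^ n)" by blast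
      have "y \<in> ball (s i) (1 / 2 ^ n)"
        using eq[OF J[OF i(1)]] i(2) by (auto simp: b_def U_def indicator_def split: if_splits)
      then show ?thesis using i(2) n dist_triangle3[of x y "s i"] by (auto simp: mem_ball)
    qed
    then show ?thesis by (intro exI[of _ "1 / 3 ^ J"]) auto
  qed
  ultimately show ?thesis by blast
qed

text \<open>
  The closure of the graph of the coding is compact and the graph of a function of the code, so
  its first projection is a homeomorphism.
\<close>

lemma compact_coding_inverse:
  fixes s :: "nat \<Rightarrow> 'a::metric_space"
  assumes "compact (UNIV :: 'a set)" "dense_sequence s"
  shows "\<exists>(c :: 'a \<Rightarrow> real) K g. c \<in> borel_measurable borel \<and> (\<forall>x. 0 \<le> c x \<and> c x \<le> 1) \<and>
    compact K \<and> range c \<subseteq> K \<and> continuous_on K g \<and> (\<forall>x. g (c x) = x)"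
proof -
  obtain c :: "'a \<Rightarrow> real" where c: "c \<in> borel_measurable borel" "\<And>x. 0 \<le> c x \<and> c x \<le> 1"
    "\<And>e. e > 0 \<Longrightarrow> \<exists>d>0. \<forall>x y. \<bar>c x - c y\<bar> < d \<longrightarrow> dist x y < e"
    using compact_coding[OF assms] by blast
  define \<Gamma> where "\<Gamma> = closure (range (\<lambda>x. (c x, x)))"
  have "\<Gamma> \<subseteq> {0..1} \<times> UNIV"
    unfolding \<Gamma>_def by (rule closure_minimal) (use c(2) in \<open>auto intro!: closed_Times\<close>)
  moreover have "compact ({0..1 :: real} \<times> (UNIV :: 'a set))" by (intro compact_Times compact_Icc assms(1))
  ultimately have comp: "compact \<Gamma>" using compact_Int_closed[of "{0..1} \<times> UNIV" \<Gamma>]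
    by (simp add: \<Gamma>_def Int_absorb1)
  have inj: "inj_on fst \<Gamma>"
  proof (rule inj_onI, clarsimp)
    fix t x y assume x: "(t, x) \<in> \<Gamma>" and y: "(t, y) \<in> \<Gamma>"
    have "dist x y \<le> e" if e: "0 < e" for e
    proof -
      obtain d where d: "d > 0" "\<And>u v. \<bar>c u - c v\<bar> < d \<Longrightarrow> dist u v < e / 3"
        using c(3)[of "e / 3"] e by auto
      let ?m = "min (d / 2) (e / 3)"
      have "0 < ?m" using d(1) e by simp
      then obtain u v where u: "dist (c u, u) (t, x) < ?m" and v: "dist (c v, v) (t, y) < ?m"
        using x y unfolding \<Gamma>_def closure_approachable by (metis (no_types, lifting) rangeE)
      have "dist (c u) t < ?m" "dist u x < ?m" "dist (c v) t < ?m" "dist v y < ?m"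
        using dist_fst_le[of "(c u, u)" "(t, x)"] dist_snd_le[of "(c u, u)" "(t, x)"]
          dist_fst_le[of "(c v, v)" "(t, y)"] dist_snd_le[of "(c v, v)" "(t, y)"] u v by auto
      then have "\<bar>c u - c v\<bar> < d" "dist u x < e / 3" "dist v y < e / 3"
        unfolding dist_real_def min_less_iff_conj by linarith+
      then show ?thesis
        using d(2)[of u v] dist_triangle[of x y u] dist_triangle[of u y v] by (auto simp: dist_commute)
    qed
    then show "x = y" by (metis dist_eq_0_iff dist_le_zero_iff field_le_epsilon add_0)
  qed
  define g where "g t = snd (inv_into \<Gamma> fst t)" for t
  have mem: "(c x, x) \<in> \<Gamma>" for x unfolding \<Gamma>_def by (rule closure_subset[THEN subsetD]) auto
  have "continuous_on (fst ` \<Gamma>) (inv_into \<Gamma> fst)"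
    by (rule continuous_on_inv[OF _ comp]) (auto intro: continuous_intros simp: inv_into_f_f[OF inj])
  then have "continuous_on (fst ` \<Gamma>) g" unfolding g_def by (intro continuous_intros)
  moreover have "compact (fst ` \<Gamma>)" by (intro compact_continuous_image continuous_intros comp)
  moreover have "range c \<subseteq> fst ` \<Gamma>" using mem by force
  moreover have "g (c x) = x" for x
    using inv_into_f_f[OF inj mem[of x]] by (simp add: g_def)
  ultimately show ?thesis using c(1,2) by blast
qed

subsection \<open>Weak sequential compactness\<close>

text \<open>The images under the code are laws on the unit interval, hence tight. Their limit
  \<open>L\<close> is carried by \<open>K\<close>, because the truncated distance to
  \<open>K\<close> has integral \<open>0\<close> along the sequence, and so it can be brought back
  by \<open>g\<close>. A continuous \<phi> is tested on the line through an extension of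
  \<open>\<phi> (g t)\<close> from \<open>K\<close>, supplied by Tietze's theorem.\<close>

lemma weakly_convergent_subsequence:
  fixes s :: "nat \<Rightarrow> 'a::metric_space" and \<mu> :: "nat \<Rightarrow> 'a measure"
  assumes X: "compact (UNIV :: 'a set)" "dense_sequence s"
    and \<mu>: "\<And>n. prob_space (\<mu> n)" "\<And>n. sets (\<mu> n) = sets borel"
  shows "\<exists>r \<nu>. strict_mono (r :: nat \<Rightarrow> nat) \<and> prob_space \<nu> \<and> sets \<nu> = sets borel \<and>
    (\<forall>\<phi> :: 'a \<Rightarrow> real. continuous_on UNIV \<phi> \<longrightarrow> (\<lambda>n. \<integral>x. \<phi> x \<partial>\<mu> (r n)) \<longlonglongrightarrow> (\<integral>x. \<phi> x \<partial>\<nu>))"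
proof -
  obtain c :: "'a \<Rightarrow> real" and K g where c: "c \<in> borel_measurable borel" "\<And>x. 0 \<le> c x \<and> c x \<le> 1"
    and K: "compact K" "range c \<subseteq> K" and g: "continuous_on K g" "\<And>x. g (c x) = x"
    using compact_coding_inverse[OF X] by blast
  have c': "c \<in> measurable (\<mu> n) borel" for n using c(1) measurable_cong_sets[OF \<mu>(2) refl] by blast
  define m where "m n = distr (\<mu> n) borel c" for n
  have "prob_space (m n)" for n unfolding m_def by (rule prob_space.prob_space_distr[OF \<mu>(1) c'])
  then have rd: "real_distribution (m n)" for n
    by (simp add: real_distribution_def real_distribution_axioms_def m_def)
  \<comment> \<open>Tightness is stated with half-open intervals and the code may take the value
    \<open>0\<close>, hence the left end \<open>-1\<close>.\<close>
  have m1: "measure (m n) {-1<..1} = 1" for n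
  proof -
    have "-1 < c x" for x using c(2)[of x] by linarith
    then have "c -` {-1<..1} \<inter> space (\<mu> n) = space (\<mu> n)" using c(2) by auto
    then show ?thesis unfolding m_def using prob_space.prob_space[OF \<mu>(1)] by (simp add: measure_distr[OF c'])
  qed
  have "\<exists>a b. a < b \<and> (\<forall>n. 1 - e < measure (m n) {a<..b})" if "0 < e" for e :: real
  proof -
    have "(-1 :: real) < 1 \<and> (\<forall>n. 1 - e < measure (m n) {-1<..1})" using that m1 by simp
    then show ?thesis by blast
  qed
  then have "tight m" unfolding tight_def using rd by blast
  then obtain r L where r: "strict_mono r" and L: "real_distribution L" and w: "weak_conv_m (m \<circ> id \<circ> r) L"
    using tight_imp_convergent_subsubsequence[OF _ strict_mono_id] by blast
  interpret L: real_distribution L by fact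
  have w': "weak_conv_m (\<lambda>n. m (r n)) L" using w by (simp add: comp_def)
  have conv: "(\<lambda>n. \<integral>x. h (c x) \<partial>\<mu> (r n)) \<longlonglongrightarrow> (\<integral>t. h t \<partial>L)"
    if h: "continuous_on UNIV h" "\<And>t. \<bar>h t\<bar> \<le> B" for h :: "real \<Rightarrow> real" and B
  proof -
    have hb: "h \<in> borel_measurable borel" by (rule borel_measurable_continuous_onI[OF h(1)])
    have "(\<lambda>n. \<integral>t. h t \<partial>m (r n)) \<longlonglongrightarrow> (\<integral>t. h t \<partial>L)"
      by (rule weak_conv_imp_integral_bdd_continuous_conv[OF _ _ w', of h B])
        (use rd L h in \<open>auto simp: continuous_on_eq_continuous_at\<close>)
    then show ?thesis unfolding m_def by (simp add: integral_distr[OF c' hb])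
  qed
  have AE: "AE t in L. t \<in> K"
  proof -
    let ?h = "\<lambda>t. min 1 (infdist t K)"
    have "K \<noteq> {}" using K(2) by auto
    have hc: "continuous_on UNIV ?h" by (intro continuous_intros)
    have "(\<lambda>n. \<integral>x. ?h (c x) \<partial>\<mu> (r n)) \<longlonglongrightarrow> (\<integral>t. ?h t \<partial>L)"
      by (rule conv[OF hc, of 1]) (auto simp: infdist_nonneg)
    moreover have "?h (c x) = 0" for x using K(2) by (simp add: range_subsetD)
    ultimately have "(\<integral>t. ?h t \<partial>L) = 0" by (simp add: LIMSEQ_const_iff)
    moreover have "integrable L ?h"
      by (rule L.integrable_const_bound[of _ 1])
        (use borel_measurable_continuous_onI[OF hc] in \<open>auto simp: infdist_nonneg\<close>)
    ultimately have "AE t in L. ?h t = 0"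
      by (subst (asm) integral_nonneg_eq_0_iff_AE) (auto simp: infdist_nonneg)
    then show ?thesis
      by eventually_elim (use in_closed_iff_infdist_zero[OF compact_imp_closed[OF K(1)] \<open>K \<noteq> {}\<close>] in \<open>auto simp: min_def split: if_splits\<close>)
  qed
  \<comment> \<open>Off \<open>K\<close>, which is an \<open>L\<close>-null set, nothing is known
    about \<open>g\<close>; a constant there makes the map Borel on the whole line.\<close>
  define G where "G t = (if t \<in> K then g t else undefined)" for t
  have G: "G \<in> borel_measurable borel"
    unfolding G_def by (rule borel_measurable_continuous_on_if) (use K g in \<open>auto intro: borel_compact\<close>)
  then have G': "G \<in> measurable L borel" using measurable_cong_sets[OF L.events_eq_borel refl] by blast
  define \<nu> where "\<nu> = distr L borel G"
  have "(\<lambda>n. \<integral>x. \<phi> x \<partial>\<mu> (r n)) \<longlonglongrightarrow> (\<integral>x. \<phi> x \<partial>\<nu>)" if \<phi>: "continuous_on UNIV \<phi>" for \<phi> :: "'a \<Rightarrow> real"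
  proof -
    have "bounded (range \<phi>)" by (intro compact_imp_bounded compact_continuous_image \<phi> X(1))
    then obtain B where B: "\<And>x. \<bar>\<phi> x\<bar> \<le> B" unfolding bounded_iff by auto
    have "continuous_on K (\<lambda>t. \<phi> (g t))"
      by (rule continuous_on_compose2[OF \<phi> g(1)]) auto
    moreover have "0 \<le> B" using B[of undefined] by simp
    ultimately obtain h where h: "continuous_on UNIV h" "\<And>t. t \<in> K \<Longrightarrow> h t = \<phi> (g t)" "\<And>t. \<bar>h t\<bar> \<le> B"
      using Tietze[of K "\<lambda>t. \<phi> (g t)" UNIV B] compact_imp_closed[OF K(1)] B by auto
    have "(\<lambda>n. \<integral>x. h (c x) \<partial>\<mu> (r n)) \<longlonglongrightarrow> (\<integral>t. h t \<partial>L)" by (rule conv[OF h(1,3)])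
    moreover have "h (c x) = \<phi> x" for x using h(2)[of "c x"] K(2) g(2) by auto
    moreover have "(\<integral>x. \<phi> x \<partial>\<nu>) = (\<integral>t. h t \<partial>L)"
    proof -
      have pb: "\<phi> \<in> borel_measurable borel" by (rule borel_measurable_continuous_onI[OF \<phi>])
      have "(\<integral>x. \<phi> x \<partial>\<nu>) = (\<integral>t. \<phi> (G t) \<partial>L)"
        unfolding \<nu>_def by (rule integral_distr[OF G' pb])
      also have "\<dots> = (\<integral>t. h t \<partial>L)"
      proof (rule integral_cong_AE)
        show "(\<lambda>t. \<phi> (G t)) \<in> borel_measurable L" by (rule measurable_compose[OF G' pb])
        show "h \<in> borel_measurable L"
          using borel_measurable_continuous_onI[OF h(1)] measurable_cong_sets[OF L.events_eq_borel refl] by blast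
        show "AE t in L. \<phi> (G t) = h t" using AE by eventually_elim (simp add: G_def h(2))
      qed
      finally show ?thesis .
    qed
    ultimately show ?thesis by simp
  qed
  moreover have "prob_space \<nu>" unfolding \<nu>_def by (rule L.prob_space_distr[OF G'])
  moreover have "sets \<nu> = sets borel" by (simp add: \<nu>_def)
  ultimately show ?thesis using r by blast
qed

text \<open>For closed nonempty \<open>A\<close> the functions
  \<open>max 0 (1 - k * infdist x A)\<close> decrease to the indicator of \<open>A\<close>, and the
  closed sets are an intersection-stable generator of the Borel sets.\<close>

lemma measure_eqI_continuous:
  fixes \<mu> \<nu> :: "'a::metric_space measure"
  assumes \<mu>: "prob_space \<mu>" "sets \<mu> = sets borel" and \<nu>: "prob_space \<nu>" "sets \<nu> = sets borel"
    and eq: "\<And>(\<phi> :: 'a \<Rightarrow> real). continuous_on UNIV \<phi> \<Longrightarrow> (\<And>x. \<bar>\<phi> x\<bar> \<le> 1) \<Longrightarrow> (\<integral>x. \<phi> x \<partial>\<mu>) = (\<integral>x. \<phi> x \<partial>\<nu>)"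
  shows "\<mu> = \<nu>"
proof -
  let ?\<phi> = "\<lambda>A k x. max 0 (1 - real k * infdist x A)"
  have cont: "continuous_on UNIV (?\<phi> A k)" for A :: "'a set" and k by (intro continuous_intros)
  have lim: "(\<lambda>k. \<integral>x. ?\<phi> A k x \<partial>\<rho>) \<longlonglongrightarrow> measure \<rho> A"
    if A: "closed A" "A \<noteq> {}" and \<rho>: "prob_space \<rho>" "sets \<rho> = sets borel" for A :: "'a set" and \<rho>
  proof -
    interpret prob_space \<rho> by fact
    have Am: "A \<in> sets \<rho>" using A \<rho>(2) by auto
    have "(\<lambda>k. \<integral>x. ?\<phi> A k x \<partial>\<rho>) \<longlonglongrightarrow> (\<integral>x. indicator A x \<partial>\<rho>)"
    proof (rule integral_dominated_convergence[where w = "\<lambda>_. 1"])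
      show "?\<phi> A k \<in> borel_measurable \<rho>" for k
        using borel_measurable_continuous_onI[OF cont] measurable_cong_sets[OF \<rho>(2) refl] by blast
      have "(\<lambda>k. ?\<phi> A k x) \<longlonglongrightarrow> indicator A x" for x
      proof (cases "x \<in> A")
        case False
        then have pos: "0 < infdist x A"
          using in_closed_iff_infdist_zero[OF A] infdist_nonneg[of x A] by (metis order_le_less)
        obtain N :: nat where N: "1 < real N * infdist x A" using reals_Archimedean3[OF pos] by blast
        have "\<forall>\<^sub>F k in sequentially. ?\<phi> A k x = 0"
          using eventually_ge_at_top[of N]
        proof eventually_elim
          case (elim k)
          then have "real N * infdist x A \<le> real k * infdist x A" using pos by (intro mult_right_mono) auto
          then show ?case using N by simp
        qed
        then show ?thesis using False by (simp add: tendsto_eventually)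
      qed simp
      then show "AE x in \<rho>. (\<lambda>k. ?\<phi> A k x) \<longlonglongrightarrow> indicator A x" by simp
    qed (use Am in \<open>auto simp: infdist_nonneg\<close>)
    then show ?thesis using Am by simp
  qed
  have closed_eq: "measure \<mu> A = measure \<nu> A" if A: "closed A" for A
  \<comment> \<open>As \<open>infdist x {}\<close> is \<open>0\<close>, the approximating functions
    would be constantly \<open>1\<close> for the empty set.\<close>
  proof (cases "A = {}")
    case False
    have "(\<lambda>k. \<integral>x. ?\<phi> A k x \<partial>\<mu>) = (\<lambda>k. \<integral>x. ?\<phi> A k x \<partial>\<nu>)"
      by (rule ext, rule eq[OF cont]) (auto simp: infdist_nonneg)
    then show ?thesis using lim[OF A False \<mu>] lim[OF A False \<nu>] LIMSEQ_unique by metis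
  qed simp
  interpret M: prob_space \<mu> by fact
  interpret N: prob_space \<nu> by fact
  have borel: "sets (borel :: 'a measure) = sigma_sets UNIV (Collect closed)"
    by (subst borel_eq_closed) simp
  show ?thesis
    by (rule measure_eqI_generator_eq[where E = "Collect closed" and \<Omega> = UNIV and A = "\<lambda>_. UNIV"])
      (use \<mu>(2) \<nu>(2) borel closed_eq in \<open>auto simp: Int_stable_def M.emeasure_eq_measure N.emeasure_eq_measure\<close>)
qed

section \<open>Periodic orbits and dyadic approximations\<close>

subsection \<open>Computing along periodic orbits\<close>

text \<open>\<open>N\<close> computes the starting point and \<open>F\<close> the map. The single
  bound \<open>t\<close> limits both the steps of each simulation and the length of each
  table.\<close>

primrec orbit_table :: "tm \<Rightarrow> tm \<Rightarrow> nat \<Rightarrow> nat \<Rightarrow> nat option list" where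
  "orbit_table F N t 0 = map (\<lambda>i. run [] N t i) [0..<t]"
| "orbit_table F N t (Suc a) = map (\<lambda>i. run [orbit_table F N t a] F t i) [0..<t]"

definition orbit_value :: "tm \<Rightarrow> tm \<Rightarrow> tm \<Rightarrow> nat \<Rightarrow> nat \<Rightarrow> nat \<Rightarrow> nat option" where
  "orbit_value F G N t a k = run [orbit_table F N t a] G t k"

lemma effective_orbit_table [eff]:
  assumes "effective N" "effective t" "effective a"
  shows "effective (\<lambda>x. orbit_table F (N x) (t x) (a x))"
proof -
  have *: "orbit_table F N t a = rec_nat (map (\<lambda>i. run [] N t i) [0..<t]) (\<lambda>k r. map (\<lambda>i. run [r] F t i) [0..<t]) a" for N t a
    by (induction a) simp_all
  have "effective (\<lambda>w. orbit_table F (fst w) (fst (snd w)) (snd (snd w)))"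
    unfolding * by (intro eff)
  from effective_compose[OF this, of "\<lambda>x. (N x, t x, a x)"] show ?thesis
    using assms by (simp add: effective_Pair)
qed

lemma effective_orbit_value [eff]:
  assumes "effective N" "effective t" "effective a" "effective k"
  shows "effective (\<lambda>x. orbit_value F G (N x) (t x) (a x) (k x))"
  unfolding orbit_value_def using assms by (intro eff)

context
  fixes F N :: tm and \<phi> :: "nat \<Rightarrow> nat \<Rightarrow> nat"
  assumes start: "\<And>i. outputs [] N i (\<phi> 0 i)"
    and step: "\<And>a i. outputs [\<phi> a] F i (\<phi> (Suc a) i)"
begin

lemma orbit_table_approximates: "approximates (orbit_table F N t a) (\<phi> a)"
proof (induction a)
  case 0
  have "\<phi> 0 x = v" if "run [] N t x = Some v" for x v
    using outputs_unique[OF start run_sound[of "[]" "[]", OF _ that]] by simp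
  then show ?case by (auto simp: approximates_def nth_or_def split: if_splits)
next
  case (Suc a)
  have "\<phi> (Suc a) x = v" if "run [orbit_table F N t a] F t x = Some v" for x v
    using outputs_unique[OF step run_sound[of _ "[\<phi> a]", OF _ that]] Suc by simp
  then show ?case by (auto simp: approximates_def nth_or_def split: if_splits)
qed

text \<open>How many entries of one table are needed depends on the queries made for the next one,
  so the induction keeps \<open>K\<close> arbitrary.\<close>

lemma orbit_table_complete: "\<exists>T. \<forall>t\<ge>T. \<forall>x<K. nth_or None (orbit_table F N t a) x \<noteq> None"
proof (induction a arbitrary: K)
  case 0
  have "\<forall>x. \<exists>T. \<forall>t\<ge>T. run [] N t x \<noteq> None"
  proof
    fix x
    obtain T K where "\<forall>t\<ge>T. \<forall>\<sigma>s. list_all2 approximates \<sigma>s [] \<longrightarrow>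
        (\<forall>\<sigma>\<in>set \<sigma>s. \<forall>x<K. nth_or None \<sigma> x \<noteq> None) \<longrightarrow> run \<sigma>s N t x = Some (\<phi> 0 x)"
      using run_complete[OF start[of x]] by blast
    then have "\<forall>t\<ge>T. run [] N t x = Some (\<phi> 0 x)" by simp
    then show "\<exists>T. \<forall>t\<ge>T. run [] N t x \<noteq> None" by (intro exI[of _ T]) simp
  qed
  from choice[OF this] obtain T where T: "\<forall>x. \<forall>t\<ge>T x. run [] N t x \<noteq> None" ..
  show ?case
  proof (intro exI allI impI)
    \<comment> \<open>Including \<open>K\<close> in the maximum makes the table long enough to have
      an entry at \<open>x\<close>.\<close>
    fix t x assume t: "Max (insert K (T ` {..<K})) \<le> t" and x: "x < K"
    then have "\<forall>y\<in>insert K (T ` {..<K}). y \<le> t" by (subst (asm) Max_le_iff) simp_all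
    then have "T x \<le> t" "K \<le> t" using x by blast+
    then have Tx: "T x \<le> t" and xt: "x < t" using x by linarith+
    have eq: "nth_or None (orbit_table F N t 0) x = run [] N t x" using xt by (simp add: nth_or_def)
    show "nth_or None (orbit_table F N t 0) x \<noteq> None" unfolding eq by (rule T[rule_format, OF Tx])
  qed
next
  case (Suc a)
  have "\<forall>x. \<exists>T. \<forall>t\<ge>T. run [orbit_table F N t a] F t x \<noteq> None"
  proof
    fix x
    obtain T K where TK: "\<And>t \<sigma>s. t \<ge> T \<Longrightarrow> list_all2 approximates \<sigma>s [\<phi> a] \<Longrightarrow>
        \<forall>\<sigma>\<in>set \<sigma>s. \<forall>x<K. nth_or None \<sigma> x \<noteq> None \<Longrightarrow> run \<sigma>s F t x = Some (\<phi> (Suc a) x)"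
      using run_complete[OF step[of a x]] by blast
    obtain T' where T': "\<forall>t\<ge>T'. \<forall>x<K. nth_or None (orbit_table F N t a) x \<noteq> None" using Suc by blast
    have "run [orbit_table F N t a] F t x = Some (\<phi> (Suc a) x)" if "t \<ge> max T T'" for t
    proof (rule TK)
      show "list_all2 approximates [orbit_table F N t a] [\<phi> a]" using orbit_table_approximates by simp
    qed (use that T' in simp_all)
    then show "\<exists>T. \<forall>t\<ge>T. run [orbit_table F N t a] F t x \<noteq> None"
      by (intro exI[of _ "max T T'"]) simp
  qed
  from choice[OF this] obtain T where T: "\<forall>x. \<forall>t\<ge>T x. run [orbit_table F N t a] F t x \<noteq> None" ..
  show ?case
  proof (intro exI allI impI)
    fix t x assume t: "Max (insert K (T ` {..<K})) \<le> t" and x: "x < K"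
    then have "\<forall>y\<in>insert K (T ` {..<K}). y \<le> t" by (subst (asm) Max_le_iff) simp_all
    then have "T x \<le> t" "K \<le> t" using x by blast+
    then have Tx: "T x \<le> t" and xt: "x < t" using x by linarith+
    have eq: "nth_or None (orbit_table F N t (Suc a)) x = run [orbit_table F N t a] F t x" using xt by (simp add: nth_or_def)
    show "nth_or None (orbit_table F N t (Suc a)) x \<noteq> None" unfolding eq by (rule T[rule_format, OF Tx])
  qed
qed

lemma orbit_value_sound: "orbit_value F G N t a k = Some y \<Longrightarrow> outputs [\<phi> a] G k y"
  unfolding orbit_value_def by (rule run_sound[rotated]) (auto simp: orbit_table_approximates)

lemma orbit_value_complete:
  assumes "outputs [\<phi> a] G k y"
  shows "\<exists>T. \<forall>t\<ge>T. orbit_value F G N t a k \<noteq> None"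
proof -
  obtain T K where TK: "\<And>t \<sigma>s. t \<ge> T \<Longrightarrow> list_all2 approximates \<sigma>s [\<phi> a] \<Longrightarrow>
      \<forall>\<sigma>\<in>set \<sigma>s. \<forall>x<K. nth_or None \<sigma> x \<noteq> None \<Longrightarrow> run \<sigma>s G t k = Some y"
    using run_complete[OF assms] by blast
  obtain T' where T': "\<forall>t\<ge>T'. \<forall>x<K. nth_or None (orbit_table F N t a) x \<noteq> None"
    using orbit_table_complete by blast
  have "orbit_value F G N t a k = Some y" if "t \<ge> max T T'" for t
    unfolding orbit_value_def
  proof (rule TK)
    show "list_all2 approximates [orbit_table F N t a] [\<phi> a]" using orbit_table_approximates by simp
  qed (use that T' in simp_all)
  then show ?thesis by (intro exI[of _ "max T T'"]) simp
qed

end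

subsection \<open>The enumeration of the rationals\<close>

text \<open>In \<open>int_decode\<close> the code \<open>a\<close> has absolute value
  \<open>(a + 1) div 2\<close> and is negative iff \<open>a\<close> is odd, so a quotient is
  negative iff the parities differ and it is not \<open>0\<close>. A zero denominator gives the
  rational \<open>0\<close>, represented here as \<open>0 / 1\<close>.\<close>

definition rat_num :: "nat \<Rightarrow> nat" where
  "rat_num x = (if snd (prod_decode x) = 0 then 0 else (fst (prod_decode x) + 1) div 2)"

definition rat_den :: "nat \<Rightarrow> nat" where
  "rat_den x = (if snd (prod_decode x) = 0 then 1 else (snd (prod_decode x) + 1) div 2)"

definition rat_neg :: "nat \<Rightarrow> bool" where
  "rat_neg x \<longleftrightarrow> rat_num x \<noteq> 0 \<and> fst (prod_decode x) mod 2 \<noteq> snd (prod_decode x) mod 2"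

lemma rat_den_pos: "0 < rat_den x"
  by (auto simp: rat_den_def)

lemma int_decode_abs: "int_decode a = (if a mod 2 = 0 then 1 else -1) * int ((a + 1) div 2)"
proof (cases "even a")
  case False
  then obtain k where "a = 2 * k + 1" by (elim oddE)
  then show ?thesis by (simp add: int_decode_def sum_decode_def)
qed (auto simp: int_decode_def sum_decode_def elim!: evenE)

lemma of_rat_nat_to_rat_surj:
  "(of_rat (nat_to_rat_surj x) :: real) = (if rat_neg x then -1 else 1) * (real (rat_num x) / real (rat_den x))"
proof -
  obtain a b where ab: "prod_decode x = (a, b)" by fastforce
  have "b = 0 \<longleftrightarrow> int_decode b = 0" by (auto simp: int_decode_abs)
  have "(of_rat (nat_to_rat_surj x) :: real) = real_of_int (int_decode a) / real_of_int (int_decode b)"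
    by (simp add: nat_to_rat_surj_def ab of_rat_rat Fract_of_int_quotient of_rat_divide)
  then show ?thesis
    by (auto simp: int_decode_abs rat_num_def rat_den_def rat_neg_def ab)
qed

lemma effective_prod_decode [eff]: "effective f \<Longrightarrow> effective (\<lambda>x. prod_decode (f x))"
  by (rule effective_recode[of f]) (auto simp: enc_prod_def)

lemma effective_rat_num [eff]: "effective f \<Longrightarrow> effective (\<lambda>x. rat_num (f x))"
  unfolding rat_num_def by (intro eff)

lemma effective_rat_den [eff]: "effective f \<Longrightarrow> effective (\<lambda>x. rat_den (f x))"
  unfolding rat_den_def by (intro eff)

lemma effective_rat_neg [eff]: "effective f \<Longrightarrow> effective (\<lambda>x. rat_neg (f x))"
  unfolding rat_neg_def by (intro eff)

text \<open>Cross multiplication reduces equality to natural numbers and so makes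
  \<open>first_occurrences\<close> decidable.\<close>

lemma nat_to_rat_surj_eq_iff:
  "nat_to_rat_surj x = nat_to_rat_surj y \<longleftrightarrow>
    rat_neg x = rat_neg y \<and> rat_num x * rat_den y = rat_num y * rat_den x"
proof -
  have "nat_to_rat_surj x = nat_to_rat_surj y \<longleftrightarrow>
      (of_rat (nat_to_rat_surj x) :: real) = of_rat (nat_to_rat_surj y)" by simp
  also have "\<dots> \<longleftrightarrow> rat_neg x = rat_neg y \<and> real (rat_num x) * real (rat_den y) = real (rat_num y) * real (rat_den x)"
  proof -
    define p where "p z = real (rat_num z) / real (rat_den z)" for z
    have pos: "0 \<le> p z" "rat_neg z \<Longrightarrow> p z \<noteq> 0" for z
      using rat_den_pos[of z] by (auto simp: rat_neg_def p_def)
    have "p x = p y \<longleftrightarrow> real (rat_num x) * real (rat_den y) = real (rat_num y) * real (rat_den x)"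
      unfolding p_def using rat_den_pos[of x] rat_den_pos[of y] by (simp add: frac_eq_eq)
    moreover have "(if rat_neg x then -1 else 1) * p x = (if rat_neg y then -1 else 1) * p y \<longleftrightarrow>
        rat_neg x = rat_neg y \<and> p x = p y"
      using pos[of x] pos[of y] by (cases "rat_neg x"; cases "rat_neg y") auto
    ultimately show ?thesis unfolding of_rat_nat_to_rat_surj p_def by simp
  qed
  also have "\<dots> \<longleftrightarrow> rat_neg x = rat_neg y \<and> rat_num x * rat_den y = rat_num y * rat_den x"
    by (simp flip: of_nat_mult)
  finally show ?thesis .
qed

lemma first_occurrences_iff:
  "n \<in> first_occurrences \<longleftrightarrow> (\<forall>m\<in>set [0..<n]. \<not> (rat_neg m = rat_neg n \<and> rat_num m * rat_den n = rat_num n * rat_den m))"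
  by (simp add: first_occurrences_def flip: nat_to_rat_surj_eq_iff) auto

lemma infinite_first_occurrences: "infinite first_occurrences"
proof
  assume fin: "finite first_occurrences"
  have "r \<in> nat_to_rat_surj ` first_occurrences" for r
  proof -
    obtain n0 where "nat_to_rat_surj n0 = r" using surj_nat_to_rat_surj by (metis surjD)
    then have "nat_to_rat_surj (LEAST n. nat_to_rat_surj n = r) = r" by (rule LeastI)
    moreover from this have "(LEAST n. nat_to_rat_surj n = r) \<in> first_occurrences"
      unfolding first_occurrences_def using not_less_Least by fastforce
    ultimately show ?thesis by (metis imageI)
  qed
  then have "nat_to_rat_surj ` first_occurrences = UNIV" by blast
  then have "finite (UNIV :: rat set)" using fin by (metis finite_imageI)
  then show False by (simp add: infinite_UNIV_char_0)
qed

definition rat_index :: "nat \<Rightarrow> nat" where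
  "rat_index = enumerate first_occurrences"

text \<open>An infinite decidable set is enumerated by repeated search for its next element.\<close>

lemma effective_rat_index [eff]: "effective f \<Longrightarrow> effective (\<lambda>x. rat_index (f x))"
proof -
  define succ where "succ m = (LEAST n. n \<in> first_occurrences \<and> m < n)" for m
  have "effective (\<lambda>m. LEAST n. (\<forall>m\<in>set [0..<n]. \<not> (rat_neg m = rat_neg n \<and> rat_num m * rat_den n = rat_num n * rat_den m)) \<and> m < n)"
  proof (rule effective_Least[OF _ _ surj_enc_nat])
    show "\<exists>n. (\<forall>m\<in>set [0..<n]. \<not> (rat_neg m = rat_neg n \<and> rat_num m * rat_den n = rat_num n * rat_den m)) \<and> m < n" for m
      using infinite_first_occurrences unfolding first_occurrences_iff[symmetric] infinite_nat_iff_unbounded by blast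
  qed (intro eff)
  then have succ: "effective succ" unfolding succ_def[abs_def] first_occurrences_iff .
  have *: "rat_index n = rec_nat (LEAST n. n \<in> first_occurrences) (\<lambda>k r. succ r) n" for n
    by (induction n) (simp_all add: rat_index_def enumerate_0 succ_def enumerate_Suc''[OF infinite_first_occurrences])
  have "effective (\<lambda>n. rec_nat (LEAST n. n \<in> first_occurrences) (\<lambda>k r. succ r) n)"
    by (intro eff effective_compose[OF succ])
  then have "effective (\<lambda>n. rat_index n)" unfolding * .
  then show "effective f \<Longrightarrow> ?thesis" by (rule effective_compose)
qed

subsection \<open>Dyadic approximation of rational points\<close>

text \<open>
  An approximation of \<open>2 ^ k * (real_seq c + B)\<close>, where \<open>B\<close> is a shift which makes the relevant
  numbers nonnegative. The value is \<open>0\<close> far below \<open>- B\<close>.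
\<close>

definition grid :: "nat \<Rightarrow> nat \<Rightarrow> nat \<Rightarrow> nat" where
  "grid B k c = (if rat_neg (rat_index c)
     then 2 ^ k * B - 2 ^ k * rat_num (rat_index c) div rat_den (rat_index c)
     else 2 ^ k * B + 2 ^ k * rat_num (rat_index c) div rat_den (rat_index c))"

lemma effective_grid [eff]: "effective k \<Longrightarrow> effective f \<Longrightarrow> effective (\<lambda>x. grid B (k x) (f x))"
  unfolding grid_def by (intro eff)

lemma grid_conv_floor:
  "grid B k c = (if real_seq c < 0 then 2 ^ k * B - nat \<lfloor>2 ^ k * \<bar>real_seq c\<bar>\<rfloor>
     else 2 ^ k * B + nat \<lfloor>2 ^ k * \<bar>real_seq c\<bar>\<rfloor>)"
proof -
  let ?x = "rat_index c"
  define p where "p = real (rat_num ?x) / real (rat_den ?x)"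
  have p: "0 \<le> p" "rat_neg ?x \<Longrightarrow> p \<noteq> 0"
    using rat_den_pos[of ?x] by (auto simp: rat_neg_def p_def)
  have r: "real_seq c = (if rat_neg ?x then -1 else 1) * p"
    unfolding real_seq_def rat_enum_def rat_index_def[symmetric] p_def by (rule of_rat_nat_to_rat_surj)
  have neg: "rat_neg ?x \<longleftrightarrow> real_seq c < 0"
    unfolding r using p by (cases "rat_neg ?x") auto
  have abs: "\<bar>real_seq c\<bar> = real (rat_num ?x) / real (rat_den ?x)"
    unfolding r using p(1) by (simp flip: p_def)
  have "2 ^ k * \<bar>real_seq c\<bar> = real (2 ^ k * rat_num ?x) / real (rat_den ?x)" unfolding abs by simp
  then have "nat \<lfloor>2 ^ k * \<bar>real_seq c\<bar>\<rfloor> = 2 ^ k * rat_num ?x div rat_den ?x"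
    by (simp only: floor_divide_of_nat_eq nat_int)
  then show ?thesis by (simp only: grid_def neg)
qed

text \<open>Rounding costs at most one unit, and the only other danger is the truncated subtraction.
  A positive value shows that nothing was cut off, and so does a number not below
  \<open>- B\<close>.\<close>

lemma grid_approx:
  assumes "- real B \<le> real_seq c \<or> 0 < grid B k c"
  shows "\<bar>real (grid B k c) - 2 ^ k * (real_seq c + real B)\<bar> \<le> 1"
proof -
  let ?q = "2 ^ k * \<bar>real_seq c\<bar>"
  have q: "0 \<le> ?q" by simp
  have fl: "real (nat \<lfloor>?q\<rfloor>) \<le> ?q" "?q < real (nat \<lfloor>?q\<rfloor>) + 1"
    using q by linarith+
  show ?thesis
  proof (cases "real_seq c < 0")
    case False
    then show ?thesis using fl unfolding grid_conv_floor by (simp add: algebra_simps)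
  next
    case True
    have "nat \<lfloor>?q\<rfloor> \<le> 2 ^ k * B"
      using assms
    proof
      assume "- real B \<le> real_seq c"
      then have "?q \<le> 2 ^ k * real B" using True by (intro mult_left_mono) auto
      with fl(1) have "real (nat \<lfloor>?q\<rfloor>) \<le> 2 ^ k * real B" by linarith
      also have "\<dots> = real (2 ^ k * B)" by simp
      finally show ?thesis by (simp only: of_nat_le_iff)
    qed (use True in \<open>simp add: grid_conv_floor\<close>)
    then have "real (grid B k c) = 2 ^ k * real B - real (nat \<lfloor>?q\<rfloor>)"
      using True unfolding grid_conv_floor by (simp add: of_nat_diff)
    then show ?thesis using fl True by (simp add: algebra_simps)
  qed
qed

lemma grid_surj: "\<exists>c. grid B k c = n"
proof -
  have "real n / 2 ^ k - real B \<in> \<rat>" by (intro Rats_diff Rats_divide Rats_of_nat Rats_power) auto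
  then obtain c where c: "real_seq c = real n / 2 ^ k - real B" unfolding range_real_seq[symmetric] by auto
  have "grid B k c = n"
  proof (cases "real_seq c < 0")
    case True
    then have "2 ^ k * \<bar>real_seq c\<bar> = real (2 ^ k * B) - real n" unfolding c by (simp add: field_simps)
    moreover have "real n \<le> real (2 ^ k * B)" using True unfolding c by (simp add: field_simps)
    then have "n \<le> 2 ^ k * B" by (simp only: of_nat_le_iff)
    ultimately have "2 ^ k * \<bar>real_seq c\<bar> = real (2 ^ k * B - n)" by (simp only: of_nat_diff)
    then show ?thesis using True \<open>n \<le> 2 ^ k * B\<close> unfolding grid_conv_floor by (simp only: floor_of_nat nat_int) simp
  next
    case False
    then have "2 ^ k * \<bar>real_seq c\<bar> = real n - real (2 ^ k * B)" unfolding c by (simp add: field_simps)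
    moreover have "real n \<ge> real (2 ^ k * B)" using False unfolding c by (simp add: field_simps)
    then have "n \<ge> 2 ^ k * B" by (simp only: of_nat_le_iff)
    ultimately have "2 ^ k * \<bar>real_seq c\<bar> = real (n - 2 ^ k * B)" by (simp only: of_nat_diff)
    then show ?thesis using False \<open>n \<ge> 2 ^ k * B\<close> unfolding grid_conv_floor by (simp only: floor_of_nat nat_int) simp
  qed
  then show ?thesis by blast
qed

definition grid_point :: "nat \<Rightarrow> nat \<Rightarrow> nat \<Rightarrow> nat \<Rightarrow> nat list" where
  "grid_point B d k c = map (\<lambda>j. grid B k j) (tuple_decode d c)"

lemma effective_tuple_decode [eff]: "effective f \<Longrightarrow> effective (\<lambda>x. tuple_decode d (f x))"
proof -
  have "effective (tuple_decode d)"
  proof (induction d)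
    case (Suc d)
    show ?case
    proof (cases d)
      case 0
      show ?thesis unfolding 0 tuple_decode.simps(2)[abs_def] by (intro eff)
    next
      case (Suc d')
      with \<open>effective (tuple_decode d)\<close> have "effective (tuple_decode (Suc d'))" by simp
      have "effective (\<lambda>n. fst (prod_decode n) # tuple_decode (Suc d') (snd (prod_decode n)))"
        by (intro eff effective_compose[OF \<open>effective (tuple_decode (Suc d'))\<close>])
      then show ?thesis unfolding Suc tuple_decode.simps(3)[abs_def] .
    qed
  qed (simp add: effective_const)
  then show "effective f \<Longrightarrow> ?thesis" by (rule effective_compose)
qed

lemma effective_grid_point [eff]: "effective k \<Longrightarrow> effective f \<Longrightarrow> effective (\<lambda>x. grid_point B d (k x) (f x))"
  unfolding grid_point_def by (intro eff effective_compose_fst[of k])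

lemma length_grid_point [simp]: "length (grid_point B d k c) = d"
  by (simp add: grid_point_def)

lemma grid_point_surj:
  assumes "0 < d" "length ns = d"
  shows "\<exists>c. grid_point B d k c = ns"
proof -
  obtain h where h: "\<And>n. grid B k (h n) = n" using grid_surj[of B k] by metis
  obtain c where "tuple_decode d c = map h ns" using surj_tuple_decode[of d "map h ns"] assms by auto
  then show ?thesis by (auto simp: grid_point_def h comp_def intro!: exI[of _ c])
qed

lemma grid_point_nth:
  "grid_point B CARD('m) k c ! to_nat_on (UNIV :: 'm::finite set) i =
    grid B k (tuple_decode CARD('m) c ! to_nat_on (UNIV :: 'm set) i)"
  by (simp add: grid_point_def to_nat_on_UNIV_less)

section \<open>The rotation set\<close>

subsection \<open>Geometry of the rotation set\<close>

lemma rotation_setE: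
  assumes "v \<in> rotation_set f \<Phi>"
  obtains \<mu> where "\<mu> \<in> invariant_measures f" "\<forall>i. v $ i = (\<integral>x. \<Phi> x $ i \<partial>\<mu>)"
  using assms by (auto simp: rotation_set_def)

lemma rotation_setI: "\<mu> \<in> invariant_measures f \<Longrightarrow> (\<And>i. v $ i = (\<integral>x. \<Phi> x $ i \<partial>\<mu>)) \<Longrightarrow> v \<in> rotation_set f \<Phi>"
  unfolding rotation_set_def by (intro CollectI exI[of _ \<mu>]) (simp add: vec_eq_iff)

lemma convex_rotation_set:
  fixes \<Phi> :: "'a::topological_space \<Rightarrow> real ^ 'm::finite"
  assumes \<Phi>: "\<And>i. (\<lambda>x. \<Phi> x $ i) \<in> borel_measurable borel" "\<And>x i. \<bar>\<Phi> x $ i\<bar> \<le> B"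
  shows "convex (rotation_set f \<Phi>)"
proof (rule convexI)
  fix x y and u v :: real
  assume x: "x \<in> rotation_set f \<Phi>" and y: "y \<in> rotation_set f \<Phi>" and uv: "0 \<le> u" "0 \<le> v" "u + v = 1"
  obtain \<mu> where \<mu>: "\<mu> \<in> invariant_measures f" "\<forall>i. x $ i = (\<integral>x. \<Phi> x $ i \<partial>\<mu>)" using x by (rule rotation_setE)
  obtain \<nu> where \<nu>: "\<nu> \<in> invariant_measures f" "\<forall>i. y $ i = (\<integral>x. \<Phi> x $ i \<partial>\<nu>)" using y by (rule rotation_setE)
  have v: "v = 1 - u" "u \<le> 1" using uv by auto
  obtain \<rho> where \<rho>: "\<rho> \<in> invariant_measures f" "\<And>(\<phi> :: 'a \<Rightarrow> real) B. \<phi> \<in> borel_measurable borel \<Longrightarrow>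
    (\<forall>x. \<bar>\<phi> x\<bar> \<le> B) \<Longrightarrow> (\<integral>x. \<phi> x \<partial>\<rho>) = u * (\<integral>x. \<phi> x \<partial>\<mu>) + (1 - u) * (\<integral>x. \<phi> x \<partial>\<nu>)"
    using convex_combination_invariant_measures[OF \<mu>(1) \<nu>(1) uv(1) v(2)] by blast
  show "u *\<^sub>R x + v *\<^sub>R y \<in> rotation_set f \<Phi>"
  proof (rule rotation_setI[OF \<rho>(1)])
    fix i
    have "(\<integral>x. \<Phi> x $ i \<partial>\<rho>) = u * (\<integral>x. \<Phi> x $ i \<partial>\<mu>) + (1 - u) * (\<integral>x. \<Phi> x $ i \<partial>\<nu>)"
      by (rule \<rho>(2)[OF \<Phi>(1)]) (use \<Phi>(2) in blast)
    then show "(u *\<^sub>R x + v *\<^sub>R y) $ i = (\<integral>x. \<Phi> x $ i \<partial>\<rho>)" by (simp add: \<mu>(2) \<nu>(2) v(1))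
  qed
qed

text \<open>A weak limit \<nu> of invariant measures is invariant: \<phi> composed with
  \<open>f\<close> is again a continuous test function, so both integrals pass to the limit.\<close>

lemma compact_rotation_set:
  fixes s :: "nat \<Rightarrow> 'a::metric_space" and \<Phi> :: "'a \<Rightarrow> real ^ 'm::finite"
  assumes X: "compact (UNIV :: 'a set)" "dense_sequence s"
    and f: "continuous_on UNIV f" and \<Phi>: "continuous_on UNIV \<Phi>"
  shows "compact (rotation_set f \<Phi>)"
  unfolding compact_def
proof (intro allI impI)
  fix v :: "nat \<Rightarrow> real ^ 'm" assume "\<forall>n. v n \<in> rotation_set f \<Phi>"
  then have "\<forall>n. \<exists>\<mu>. \<mu> \<in> invariant_measures f \<and> (\<forall>i. v n $ i = (\<integral>x. \<Phi> x $ i \<partial>\<mu>))"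
    by (metis rotation_setE)
  then obtain \<mu> where \<mu>: "\<And>n. \<mu> n \<in> invariant_measures f" "\<And>n i. v n $ i = (\<integral>x. \<Phi> x $ i \<partial>\<mu> n)"
    by metis
  note M = invariant_measuresD[OF \<mu>(1)]
  obtain r \<nu> where r: "strict_mono (r :: nat \<Rightarrow> nat)" and \<nu>: "prob_space \<nu>" "sets \<nu> = sets borel"
    and lim: "\<And>\<phi> :: 'a \<Rightarrow> real. continuous_on UNIV \<phi> \<Longrightarrow> (\<lambda>n. \<integral>x. \<phi> x \<partial>\<mu> (r n)) \<longlonglongrightarrow> (\<integral>x. \<phi> x \<partial>\<nu>)"
    using weakly_convergent_subsequence[OF X, of \<mu>, OF M(1,2)] by blast
  have fb: "f \<in> borel_measurable borel" by (rule borel_measurable_continuous_onI[OF f])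
  have f\<nu>: "f \<in> measurable \<nu> borel" using fb measurable_cong_sets[OF \<nu>(2) refl] by blast
  have f\<mu>: "f \<in> measurable (\<mu> n) borel" for n using fb measurable_cong_sets[OF M(2) refl] by blast
  have "distr \<nu> borel f = \<nu>"
  proof (rule measure_eqI_continuous)
    show "prob_space (distr \<nu> borel f)" by (rule prob_space.prob_space_distr[OF \<nu>(1) f\<nu>])
    fix \<phi> :: "'a \<Rightarrow> real" assume \<phi>: "continuous_on UNIV \<phi>"
    have \<phi>b: "\<phi> \<in> borel_measurable borel" by (rule borel_measurable_continuous_onI[OF \<phi>])
    have "(\<integral>x. \<phi> (f x) \<partial>\<mu> n) = (\<integral>x. \<phi> x \<partial>\<mu> n)" for n
      using integral_distr[OF f\<mu> \<phi>b, of n] M(4)[of n] by simp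
    moreover have "(\<lambda>n. \<integral>x. \<phi> (f x) \<partial>\<mu> (r n)) \<longlonglongrightarrow> (\<integral>x. \<phi> (f x) \<partial>\<nu>)"
      by (rule lim) (rule continuous_on_compose2[OF \<phi> f], simp)
    ultimately have "(\<lambda>n. \<integral>x. \<phi> x \<partial>\<mu> (r n)) \<longlonglongrightarrow> (\<integral>x. \<phi> (f x) \<partial>\<nu>)" by simp
    then show "(\<integral>x. \<phi> x \<partial>distr \<nu> borel f) = (\<integral>x. \<phi> x \<partial>\<nu>)"
      unfolding integral_distr[OF f\<nu> \<phi>b] using lim[OF \<phi>] by (rule LIMSEQ_unique)
  qed (use \<nu> in auto)
  then have inv: "\<nu> \<in> invariant_measures f" by (intro invariant_measuresI \<nu> fb)
  show "\<exists>l\<in>rotation_set f \<Phi>. \<exists>r. strict_mono r \<and> (v \<circ> r) \<longlonglongrightarrow> l"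
  proof (intro bexI exI conjI)
    show "(\<chi> i. \<integral>x. \<Phi> x $ i \<partial>\<nu>) \<in> rotation_set f \<Phi>" by (rule rotation_setI[OF inv]) simp
    show "(v \<circ> r) \<longlonglongrightarrow> (\<chi> i. \<integral>x. \<Phi> x $ i \<partial>\<nu>)"
    proof (rule vec_tendstoI)
      fix i
      have "continuous_on UNIV (\<lambda>x. \<Phi> x $ i)" by (intro continuous_intros \<Phi>)
      from lim[OF this] show "(\<lambda>n. (v \<circ> r) n $ i) \<longlonglongrightarrow> (\<chi> i. \<integral>x. \<Phi> x $ i \<partial>\<nu>) $ i"
        by (simp add: \<mu>(2))
    qed
  qed (rule r)
qed

text \<open>
  Replacing \<open>\<Phi>\<close> by its values at the points \<open>p i\<close> costs \<open>d / 2\<close> for either measure, and \<open>B * d\<close>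
  is the cost of exchanging the weights of the partition elements.
\<close>

lemma integral_near_convex_hull:
  fixes \<Phi> :: "'a::topological_space \<Rightarrow> real ^ 'm::finite" and P :: "nat \<Rightarrow> 'a set"
  assumes \<mu>: "prob_space \<mu>" "sets \<mu> = sets borel"
    and \<mu>s: "\<And>\<mu>. \<mu> \<in> set \<mu>s \<Longrightarrow> prob_space \<mu> \<and> sets \<mu> = sets borel" and \<nu>: "\<nu> \<in> conv_measures \<mu>s"
    and \<Phi>: "\<And>i. (\<lambda>x. \<Phi> x $ i) \<in> borel_measurable borel" "\<And>x i. \<bar>\<Phi> x $ i\<bar> \<le> B"
    and P: "\<And>j. j < k \<Longrightarrow> P j \<in> sets borel" "disjoint_family_on P {..<k}" "(\<Union>j<k. P j) = UNIV"
    and p: "\<And>j x. j < k \<Longrightarrow> x \<in> P j \<Longrightarrow> norm (\<Phi> x - \<Phi> (p j)) \<le> d / 2"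
    and d: "(\<Sum>j<k. \<bar>measure \<mu> (P j) - measure \<nu> (P j)\<bar>) \<le> d"
  shows "\<exists>x\<in>convex hull ((\<lambda>\<mu>. \<chi> i. \<integral>x. \<Phi> x $ i \<partial>\<mu>) ` set \<mu>s). \<forall>i. \<bar>(\<integral>x. \<Phi> x $ i \<partial>\<mu>) - x $ i\<bar> \<le> (1 + B) * d"
proof -
  let ?v = "\<lambda>\<mu>. \<chi> i. \<integral>x. \<Phi> x $ i \<partial>\<mu>"
  obtain w where w: "\<And>j. j < length \<mu>s \<Longrightarrow> 0 \<le> w j" "(\<Sum>j<length \<mu>s. w j) = 1"
    "\<And>A. A \<in> sets borel \<Longrightarrow> measure \<nu> A = (\<Sum>j<length \<mu>s. w j * measure (\<mu>s ! j) A)"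
    using conv_measures_measure[OF \<nu> \<mu>s] by blast
  define x where "x = (\<Sum>j<length \<mu>s. w j *\<^sub>R ?v (\<mu>s ! j))"
  have "x \<in> convex hull (?v ` set \<mu>s)"
    unfolding x_def by (rule convex_sum) (use w in \<open>auto intro!: hull_inc\<close>)
  moreover have "\<bar>(\<integral>x. \<Phi> x $ i \<partial>\<mu>) - x $ i\<bar> \<le> (1 + B) * d" for i
  proof -
    let ?c = "\<lambda>j. \<Phi> (p j) $ i"
    let ?S = "\<lambda>\<mu>. \<Sum>j<k. ?c j * measure \<mu> (P j)"
    have c: "\<bar>\<Phi> x $ i - ?c j\<bar> \<le> d / 2" if "j < k" "x \<in> P j" for j x
      using p[OF that] component_le_norm_cart[of "\<Phi> x - \<Phi> (p j)" i] by simp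
    note approx = integral_partition_approx[OF _ _ \<Phi> P c]
    \<comment> \<open>The sum \<open>?S\<close> is linear in the measure, so \<nu> inherits the
      estimate from the measures whose combination it is.\<close>
    have "?S \<nu> = (\<Sum>l<length \<mu>s. w l * ?S (\<mu>s ! l))"
    proof -
      have "?S \<nu> = (\<Sum>j<k. \<Sum>l<length \<mu>s. ?c j * (w l * measure (\<mu>s ! l) (P j)))"
        by (rule sum.cong) (simp_all add: w(3) P(1) sum_distrib_left)
      also have "\<dots> = (\<Sum>l<length \<mu>s. \<Sum>j<k. ?c j * (w l * measure (\<mu>s ! l) (P j)))" by (rule sum.swap)
      finally show ?thesis by (simp add: sum_distrib_left mult.left_commute)
    qed
    then have "x $ i - ?S \<nu> = (\<Sum>l<length \<mu>s. w l * ((\<integral>x. \<Phi> x $ i \<partial>(\<mu>s ! l)) - ?S (\<mu>s ! l)))"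
      by (simp add: x_def right_diff_distrib sum_subtractf)
    also have "\<bar>\<dots>\<bar> \<le> (\<Sum>l<length \<mu>s. w l * (d / 2))"
    proof (rule order.trans[OF sum_abs sum_mono])
      fix l assume "l \<in> {..<length \<mu>s}"
      then have l: "l < length \<mu>s" by simp
      have "\<bar>(\<integral>x. \<Phi> x $ i \<partial>(\<mu>s ! l)) - ?S (\<mu>s ! l)\<bar> \<le> d / 2"
        by (rule approx) (use \<mu>s[of "\<mu>s ! l"] l in auto)
      then show "\<bar>w l * ((\<integral>x. \<Phi> x $ i \<partial>(\<mu>s ! l)) - ?S (\<mu>s ! l))\<bar> \<le> w l * (d / 2)"
        using mult_left_mono[OF _ w(1)[OF l]] w(1)[OF l] by (simp only: abs_mult abs_of_nonneg)
    qed
    also have "\<dots> = d / 2" unfolding sum_distrib_right[symmetric] w(2) by simp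
    finally have 1: "\<bar>x $ i - ?S \<nu>\<bar> \<le> d / 2" .
    have 2: "\<bar>(\<integral>x. \<Phi> x $ i \<partial>\<mu>) - ?S \<mu>\<bar> \<le> d / 2" by (rule approx) (use \<mu> in auto)
    have "\<bar>?S \<mu> - ?S \<nu>\<bar> \<le> (\<Sum>j<k. \<bar>?c j * (measure \<mu> (P j) - measure \<nu> (P j))\<bar>)"
      unfolding sum_subtractf[symmetric] right_diff_distrib by (rule sum_abs)
    also have "\<dots> \<le> (\<Sum>j<k. B * \<bar>measure \<mu> (P j) - measure \<nu> (P j)\<bar>)"
      by (rule sum_mono) (simp add: abs_mult mult_right_mono \<Phi>(2))
    also have "\<dots> \<le> B * d"
      unfolding sum_distrib_left[symmetric] using d \<Phi>(2)[of undefined undefined] by (intro mult_left_mono) auto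
    finally have "\<bar>?S \<mu> - ?S \<nu>\<bar> \<le> B * d" .
    moreover have "(1 + B) * d = d / 2 + d / 2 + B * d" by (simp add: algebra_simps)
    ultimately show ?thesis using 1 2 by linarith
  qed
  ultimately show ?thesis by blast
qed

subsection \<open>Averages of dyadic approximations\<close>

definition list_average :: "nat \<Rightarrow> nat list list \<Rightarrow> nat list" where
  "list_average d vs = map (\<lambda>j. sum_list (map (\<lambda>v. nth_or 0 v j) vs) div length vs) [0..<d]"

lemma effective_list_average [eff]: "effective f \<Longrightarrow> effective (\<lambda>x. list_average d (f x))"
  unfolding list_average_def by (intro eff effective_compose_fst[of f])

text \<open>The entries of \<open>v\<close> are the coordinates of \<open>x\<close> on the shifted
  and scaled grid, up to an error of \<open>e\<close> units of \<open>1 / 2 ^ k\<close>.\<close>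

definition near :: "nat \<Rightarrow> nat \<Rightarrow> real \<Rightarrow> nat list \<Rightarrow> real ^ 'm::finite \<Rightarrow> bool" where
  "near B k e v x \<longleftrightarrow> length v = CARD('m) \<and>
     (\<forall>i. \<bar>real (v ! to_nat_on (UNIV :: 'm set) i) - 2 ^ k * (x $ i + real B)\<bar> \<le> e)"

text \<open>Averaging does not increase the error; the integer division adds at most one
  unit.\<close>

lemma near_list_average:
  fixes xs :: "(real ^ 'm::finite) list"
  assumes vs: "list_all2 (near B k e) vs xs" and ne: "vs \<noteq> []"
  shows "near B k (e + 1) (list_average CARD('m) vs) ((1 / real (length vs)) *\<^sub>R sum_list xs)"
  unfolding near_def
proof (intro conjI allI)
  show "length (list_average CARD('m) vs) = CARD('m)" by (simp add: list_average_def)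
  fix i :: 'm
  let ?j = "to_nat_on (UNIV :: 'm set) i"
  let ?n = "length vs"
  let ?S = "sum_list (map (\<lambda>v. nth_or 0 v ?j) vs)"
  have j: "?j < CARD('m)" by (rule to_nat_on_UNIV_less)
  have n: "0 < real ?n" using ne by simp
  have "\<bar>real ?S - 2 ^ k * (sum_list xs $ i + real (length vs) * real B)\<bar> \<le> real (length vs) * e"
    using vs
  proof (induction rule: list_all2_induct)
    case (Cons v vs x xs)
    have "nth_or 0 v ?j = v ! ?j" using Cons.hyps(1) j by (simp add: near_def nth_or_def)
    moreover have "\<bar>real (v ! ?j) - 2 ^ k * (x $ i + real B)\<bar> \<le> e" using Cons.hyps(1) by (simp add: near_def)
    ultimately show ?case using Cons.IH by (simp add: algebra_simps)
  qed simp
  then have "\<bar>real ?S / ?n - 2 ^ k * (sum_list xs $ i + ?n * real B) / ?n\<bar> \<le> e"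
    using n by (simp add: divide_le_eq mult.commute flip: diff_divide_distrib)
  moreover have "2 ^ k * (sum_list xs $ i + ?n * real B) / ?n
      = 2 ^ k * (((1 / real ?n) *\<^sub>R sum_list xs) $ i + real B)"
    using n by (simp add: field_simps)
  moreover have "real (?S div ?n) \<le> real ?S / ?n" "real ?S / ?n < real (?S div ?n) + 1"
    using floor_divide_of_nat_eq[of ?S ?n, where 'a = real] by linarith+
  moreover have "list_average CARD('m) vs ! ?j = ?S div ?n" using j by (simp add: list_average_def)
  ultimately show "\<bar>real (list_average CARD('m) vs ! ?j) - 2 ^ k * (((1 / real ?n) *\<^sub>R sum_list xs) $ i + real B)\<bar> \<le> e + 1"
    by linarith
qed

text \<open>One unit is due to rounding and one to the distance between \<open>vec_seq c\<close> and
  \<open>x\<close>. The margin \<open>1\<close> below \<open>B\<close> keeps the coordinates of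
  \<open>vec_seq c\<close> at or above \<open>- B\<close>, where \<open>grid\<close> is
  accurate.\<close>

lemma near_grid_point:
  fixes x :: "real ^ 'm::finite"
  assumes "\<And>i. \<bar>vec_seq c $ i - x $ i\<bar> \<le> 1 / 2 ^ k" "\<And>i. \<bar>x $ i\<bar> \<le> real B - 1"
  shows "near B k 2 (grid_point B CARD('m) k c) x"
  unfolding near_def
proof (intro conjI allI)
  fix i :: 'm
  let ?c = "tuple_decode CARD('m) c ! to_nat_on (UNIV :: 'm set) i"
  have r: "vec_seq c $ i = real_seq ?c" by (simp add: vec_seq_def)
  have "1 / 2 ^ k \<le> (1 :: real)" by simp
  then have "- real B \<le> real_seq ?c" using assms(1)[of i] assms(2)[of i] unfolding r by linarith
  then have "\<bar>real (grid B k ?c) - 2 ^ k * (real_seq ?c + real B)\<bar> \<le> 1" by (intro grid_approx) simp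
  moreover have "\<bar>2 ^ k * (real_seq ?c - x $ i)\<bar> \<le> 1"
    using mult_left_mono[OF assms(1)[of i], of "2 ^ k"] unfolding r by (simp add: abs_mult)
  ultimately show "\<bar>real (grid_point B CARD('m) k c ! to_nat_on (UNIV :: 'm set) i) - 2 ^ k * (x $ i + real B)\<bar> \<le> 2"
    unfolding grid_point_nth by (simp add: algebra_simps)
qed simp

text \<open>
  The search aims one unit above \<open>w\<close>, as the grid value \<open>0\<close> does not determine the position.
\<close>

definition center :: "nat \<Rightarrow> nat \<Rightarrow> nat \<Rightarrow> nat list \<Rightarrow> nat" where
  "center B d k w = (LEAST c. grid_point B d k c = map (\<lambda>j. Suc (nth_or 0 w j)) [0..<d])"

lemma effective_center [eff]:
  assumes d: "0 < d" and k: "effective k" and w: "effective w"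
  shows "effective (\<lambda>x. center B d (k x) (w x))"
proof -
  have "effective (\<lambda>z :: nat \<times> nat list. LEAST c. grid_point B d (fst z) c = map (\<lambda>j. Suc (nth_or 0 (snd z) j)) [0..<d])"
  proof (rule effective_Least)
    show "\<exists>c. grid_point B d (fst z) c = map (\<lambda>j. Suc (nth_or 0 (snd z) j)) [0..<d]" for z :: "nat \<times> nat list"
      by (rule grid_point_surj[OF d]) simp
  qed (intro eff surj_enc_prod surj_enc_list surj_enc_nat)+
  from effective_compose[OF this, of "\<lambda>x. (k x, w x)"] show ?thesis
    unfolding center_def using effective_Pair[OF k w] by simp
qed

text \<open>Beyond the error \<open>e\<close> of \<open>w\<close>, one unit comes from aiming above
  \<open>w\<close> and one from rounding.\<close>

lemma near_center:
  fixes x :: "real ^ 'm::finite"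
  assumes w: "near B k e w x"
  shows "\<bar>(vec_seq (center B CARD('m) k w) :: real ^ 'm) $ i - x $ i\<bar> \<le> (e + 2) / 2 ^ k"
proof -
  let ?j = "to_nat_on (UNIV :: 'm set) i"
  define c where "c = center B CARD('m) k w"
  have j: "?j < CARD('m)" by (rule to_nat_on_UNIV_less)
  have "\<exists>c. grid_point B CARD('m) k c = map (\<lambda>j. Suc (nth_or 0 w j)) [0..<CARD('m)]"
    by (rule grid_point_surj) simp_all
  then have "grid_point B CARD('m) k c = map (\<lambda>j. Suc (nth_or 0 w j)) [0..<CARD('m)]"
    unfolding c_def center_def by (rule LeastI_ex)
  then have "grid_point B CARD('m) k c ! ?j = Suc (w ! ?j)"
    using j w by (simp add: nth_or_def near_def)
  then have g: "grid B k (tuple_decode CARD('m) c ! ?j) = Suc (w ! ?j)" by (simp add: grid_point_nth)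
  then have "\<bar>real (Suc (w ! ?j)) - 2 ^ k * (real_seq (tuple_decode CARD('m) c ! ?j) + real B)\<bar> \<le> 1"
    using grid_approx[of B "tuple_decode CARD('m) c ! ?j" k] by simp
  moreover have "\<bar>real (w ! ?j) - 2 ^ k * (x $ i + real B)\<bar> \<le> e" using w by (simp add: near_def)
  ultimately have "\<bar>2 ^ k * ((vec_seq c :: real ^ 'm) $ i - x $ i)\<bar> \<le> e + 2"
    by (simp add: vec_seq_def algebra_simps)
  then have "2 ^ k * \<bar>(vec_seq c :: real ^ 'm) $ i - x $ i\<bar> \<le> e + 2" by (simp add: abs_mult)
  then show ?thesis by (simp add: le_divide_eq mult.commute flip: c_def)
qed

lemma effective_n_lists [eff]:
  assumes "effective K" "effective l"
  shows "effective (\<lambda>x. List.n_lists (K x) (l x))"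
proof -
  have *: "List.n_lists n xs = rec_nat [[]] (\<lambda>k r. concat (map (\<lambda>ys. map (\<lambda>y. y # ys) xs) r)) n" for n and xs :: "'b list"
    by (induction n) simp_all
  have "effective (\<lambda>z. List.n_lists (fst z) (snd z :: 'b list))" unfolding * by (intro eff)
  from effective_compose[OF this, of "\<lambda>x. (K x, l x)"] show ?thesis using assms by (simp add: effective_Pair)
qed

lemma hausdorff_dist_le:
  assumes "\<And>x. x \<in> A \<Longrightarrow> \<exists>y\<in>B. dist x y \<le> r" "\<And>y. y \<in> B \<Longrightarrow> \<exists>x\<in>A. dist x y \<le> r"
  shows "hausdorff_dist A B \<le> ennreal r"
  unfolding hausdorff_dist_def
proof (intro max.boundedI SUP_least)
  fix x assume "x \<in> A"
  then obtain y where "y \<in> B" "dist x y \<le> r" using assms(1) by blast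
  then show "(INF y\<in>B. ennreal (dist x y)) \<le> ennreal r" by (intro INF_lower2) (auto intro: ennreal_leI)
next
  fix y assume "y \<in> B"
  then obtain x where "x \<in> A" "dist x y \<le> r" using assms(2) by blast
  then show "(INF x\<in>A. ennreal (dist x y)) \<le> ennreal r" by (intro INF_lower2) (auto intro: ennreal_leI)
qed

lemma norm_le_card_mult:
  fixes x :: "real ^ 'm::finite"
  assumes "\<And>i. \<bar>x $ i\<bar> \<le> e"
  shows "norm x \<le> real CARD('m) * e"
proof -
  have "norm x \<le> (\<Sum>i\<in>UNIV. \<bar>x $ i\<bar>)" by (rule norm_le_l1_cart)
  also have "\<dots> \<le> (\<Sum>i\<in>(UNIV :: 'm set). e)" by (rule sum_mono) (rule assms)
  finally show ?thesis by simp
qed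

subsection \<open>Periodic orbits from machines\<close>

text \<open>The oracle of the next point consists of the very numbers that \<open>F\<close> outputs
  with the present oracle; these are the values that simulation writes into the tables.\<close>

lemma orbit_oracles:
  fixes s :: "nat \<Rightarrow> 'a::metric_space"
  assumes N: "computes_point s N q"
    and F: "\<And>\<alpha> \<phi> n. is_oracle s \<alpha> \<phi> \<Longrightarrow> \<exists>m. outputs [\<phi>] F n m \<and> dist (s m) (f \<alpha>) < 1 / 2 ^ n"
  obtains \<phi> where "\<And>i. outputs [] N i (\<phi> 0 i)" "\<And>a i. outputs [\<phi> a] F i (\<phi> (Suc a) i)"
    "\<And>a. is_oracle s ((f ^^ a) q) (\<phi> a)"
proof -
  obtain \<phi>0 where \<phi>0: "\<And>i. outputs [] N i (\<phi>0 i)" "is_oracle s q \<phi>0"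
    using N by (auto simp: computes_point_def)
  define \<phi> where "\<phi> = rec_nat \<phi>0 (\<lambda>_ \<phi> i. SOME m. outputs [\<phi>] F i m)"
  have \<phi>_Suc: "\<phi> (Suc a) i = (SOME m. outputs [\<phi> a] F i m)" for a i by (simp add: \<phi>_def)
  have or: "is_oracle s ((f ^^ a) q) (\<phi> a)" for a
  proof (induction a)
    case 0
    then show ?case using \<phi>0(2) by (simp add: \<phi>_def)
  next
    case (Suc a)
    have "dist (s (\<phi> (Suc a) i)) (f ((f ^^ a) q)) < 1 / 2 ^ i" for i
    proof -
      obtain m where m: "outputs [\<phi> a] F i m" "dist (s m) (f ((f ^^ a) q)) < 1 / 2 ^ i" using F[OF Suc] by blast
      have "outputs [\<phi> a] F i (\<phi> (Suc a) i)" unfolding \<phi>_Suc using m(1) by (rule someI)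
      then show ?thesis using m outputs_unique by blast
    qed
    then show ?case by (simp add: is_oracle_def dist_commute)
  qed
  have "outputs [\<phi> a] F i (\<phi> (Suc a) i)" for a i
    unfolding \<phi>_Suc using F[OF or[of a], of i] by (blast intro: someI)
  moreover have "outputs [] N i (\<phi> 0 i)" for i using \<phi>0(1) by (simp add: \<phi>_def)
  ultimately show ?thesis using that or by blast
qed

lemma orbit_value_correct:
  fixes s :: "nat \<Rightarrow> 'a::metric_space" and t :: "nat \<Rightarrow> 'b::metric_space"
  assumes N: "computes_point s N q"
    and F: "\<And>\<alpha> \<phi> n. is_oracle s \<alpha> \<phi> \<Longrightarrow> \<exists>m. outputs [\<phi>] F n m \<and> dist (s m) (f \<alpha>) < 1 / 2 ^ n"
    and G: "\<And>\<alpha> \<phi> n. is_oracle s \<alpha> \<phi> \<Longrightarrow> \<exists>m. outputs [\<phi>] G n m \<and> dist (t m) (g \<alpha>) < 1 / 2 ^ n"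
  shows "orbit_value F G N T a k = Some y \<Longrightarrow> dist (t y) (g ((f ^^ a) q)) < 1 / 2 ^ k"
    and "\<forall>\<^sub>F T in sequentially. orbit_value F G N T a k \<noteq> None"
proof -
  obtain \<phi> where \<phi>: "\<And>i. outputs [] N i (\<phi> 0 i)" "\<And>a i. outputs [\<phi> a] F i (\<phi> (Suc a) i)"
    "\<And>a. is_oracle s ((f ^^ a) q) (\<phi> a)"
    using orbit_oracles[of s N q F f, OF N F] by blast
  obtain m where m: "outputs [\<phi> a] G k m" "dist (t m) (g ((f ^^ a) q)) < 1 / 2 ^ k" using G[OF \<phi>(3)] by blast
  show "\<forall>\<^sub>F T in sequentially. orbit_value F G N T a k \<noteq> None"
    unfolding eventually_sequentially by (rule orbit_value_complete[OF \<phi>(1,2) m(1)])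
  assume "orbit_value F G N T a k = Some y"
  from orbit_value_sound[OF \<phi>(1,2) this] have "y = m" using m(1) outputs_unique by blast
  then show "dist (t y) (g ((f ^^ a) q)) < 1 / 2 ^ k" using m(2) by simp
qed

text \<open>The default \<open>0\<close> does not occur once \<open>orbits_ready\<close>
  holds.\<close>

definition orbit_codes :: "tm \<Rightarrow> tm \<Rightarrow> nat \<Rightarrow> nat \<Rightarrow> (tm \<times> nat) list \<Rightarrow> nat list list" where
  "orbit_codes F G T k Ns = map (\<lambda>z. map (\<lambda>a. case orbit_value F G (fst z) T a k of None \<Rightarrow> 0 | Some y \<Rightarrow> y) [0..<snd z]) Ns"

definition orbits_ready :: "tm \<Rightarrow> tm \<Rightarrow> nat \<Rightarrow> nat \<Rightarrow> (tm \<times> nat) list \<Rightarrow> bool" where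
  "orbits_ready F G T k Ns \<longleftrightarrow> (\<forall>z\<in>set Ns. \<forall>a\<in>set [0..<snd z]. orbit_value F G (fst z) T a k \<noteq> None)"

lemma effective_orbit_codes [eff]:
  assumes "effective T" "effective k" "effective Ns"
  shows "effective (\<lambda>x. orbit_codes F G (T x) (k x) (Ns x))"
proof -
  have "effective (\<lambda>w. orbit_codes F G (fst w) (fst (snd w)) (snd (snd w)))"
    unfolding orbit_codes_def by (intro eff)
  from effective_compose[OF this, of "\<lambda>x. (T x, k x, Ns x)"] show ?thesis
    using assms by (simp add: effective_Pair)
qed

lemma effective_orbits_ready [eff]:
  assumes "effective T" "effective k" "effective Ns"
  shows "effective (\<lambda>x. orbits_ready F G (T x) (k x) (Ns x))"
proof -
  have "effective (\<lambda>w. orbits_ready F G (fst w) (fst (snd w)) (snd (snd w)))"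
    unfolding orbits_ready_def by (intro eff)
  from effective_compose[OF this, of "\<lambda>x. (T x, k x, Ns x)"] show ?thesis
    using assms by (simp add: effective_Pair)
qed

definition orbit_average :: "('a \<Rightarrow> 'a) \<Rightarrow> ('a \<Rightarrow> real ^ 'm) \<Rightarrow> 'a \<Rightarrow> nat \<Rightarrow> real ^ 'm" where
  "orbit_average f \<Phi> q m = (1 / real m) *\<^sub>R (\<Sum>a\<leftarrow>[0..<m]. \<Phi> ((f ^^ a) q))"

lemma orbit_average_eq_integral:
  fixes \<Phi> :: "'a::topological_space \<Rightarrow> real ^ 'm::finite"
  assumes "0 < m" "\<And>i. (\<lambda>x. \<Phi> x $ i) \<in> borel_measurable borel"
  shows "orbit_average f \<Phi> q m = (\<chi> i. \<integral>x. \<Phi> x $ i \<partial>periodic_measure f q m)"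
proof -
  have "(\<Sum>a\<leftarrow>[0..<m]. \<Phi> ((f ^^ a) q)) = (\<Sum>a<m. \<Phi> ((f ^^ a) q))"
    by (simp add: interv_sum_list_conv_sum_set_nat atLeast0LessThan)
  then show ?thesis
    by (simp add: orbit_average_def vec_eq_iff integral_periodic_measure[OF assms(1) assms(2)])
qed

text \<open>The tuples in \<open>List.n_lists\<close> repeat entries, so they yield exactly the
  convex combinations of the orbit averages with weights in multiples of \<open>1 / K\<close>, up to
  rounding.\<close>

definition hull_centers :: "nat \<Rightarrow> nat \<Rightarrow> nat \<Rightarrow> nat \<Rightarrow> nat list list \<Rightarrow> nat list" where
  "hull_centers B d k K yss =
     map (\<lambda>vs. center B d k (list_average d vs))
       (List.n_lists K (map (\<lambda>ys. list_average d (map (\<lambda>y. grid_point B d k y) ys)) yss))"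

lemma effective_hull_centers [eff]:
  assumes "0 < d" "effective k" "effective K" "effective yss"
  shows "effective (\<lambda>x. hull_centers B d (k x) (K x) (yss x))"
proof -
  have "effective (\<lambda>w. hull_centers B d (fst w) (fst (snd w)) (snd (snd w)))"
    unfolding hull_centers_def by (intro eff assms(1))
  from effective_compose[OF this, of "\<lambda>x. (k x, K x, yss x)"] show ?thesis
    using assms by (simp add: effective_Pair)
qed

lemma list_all2_choose_right:
  assumes "list_all2 R vs xs" "set us \<subseteq> set vs"
  obtains ys where "list_all2 R us ys" "set ys \<subseteq> set xs"
proof -
  have "\<forall>u\<in>set us. \<exists>y\<in>set xs. R u y"
  proof
    fix u assume "u \<in> set us"
    then obtain i where "i < length vs" "vs ! i = u" using assms(2) by (metis in_set_conv_nth subsetD)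
    then show "\<exists>y\<in>set xs. R u y"
      using assms(1) by (intro bexI[of _ "xs ! i"]) (auto simp: list_all2_conv_all_nth)
  qed
  then obtain h where h: "\<And>u. u \<in> set us \<Longrightarrow> h u \<in> set xs \<and> R u (h u)" by metis
  have "list_all2 R us (map h us)" using h by (simp add: list_all2_conv_all_nth)
  moreover have "set (map h us) \<subseteq> set xs" using h by auto
  ultimately show ?thesis by (rule that)
qed

text \<open>In units of \<open>1 / 2 ^ k\<close> the error is 3 for an orbit average, 4 after
  averaging \<open>K\<close> of them and 6 for the rational centre. The factor
  \<open>CARD('m)\<close> passes from coordinates to the norm.\<close>

lemma hull_centers_near:
  fixes vs :: "(real ^ 'm::finite) list"
  assumes near: "list_all2 (\<lambda>ys v. near B k 3 (list_average CARD('m) (map (\<lambda>y. grid_point B CARD('m) k y) ys)) v) yss vs"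
    and K: "0 < K"
  shows "c \<in> set (hull_centers B CARD('m) k K yss) \<Longrightarrow>
      \<exists>us. set us \<subseteq> set vs \<and> length us = K \<and> norm (vec_seq c - (1 / real K) *\<^sub>R sum_list us) \<le> real CARD('m) * (6 / 2 ^ k)"
    and "set us \<subseteq> set vs \<Longrightarrow> length us = K \<Longrightarrow>
      \<exists>c\<in>set (hull_centers B CARD('m) k K yss). norm (vec_seq c - (1 / real K) *\<^sub>R sum_list us) \<le> real CARD('m) * (6 / 2 ^ k)"
proof -
  let ?V = "map (\<lambda>ys. list_average CARD('m) (map (\<lambda>y. grid_point B CARD('m) k y) ys)) yss"
  let ?c = "\<lambda>ws. center B CARD('m) k (list_average CARD('m) ws)"
  have V: "list_all2 (near B k 3) ?V vs" using near by (simp add: list_all2_map1)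
  have close: "norm (vec_seq (?c ws) - (1 / real K) *\<^sub>R sum_list us) \<le> real CARD('m) * (6 / 2 ^ k)"
    if "list_all2 (near B k 3) ws us" "length ws = K" for ws and us :: "(real ^ 'm) list"
  proof (rule norm_le_card_mult)
    have "near B k (3 + 1) (list_average CARD('m) ws) ((1 / real (length ws)) *\<^sub>R sum_list us)"
      by (rule near_list_average[OF that(1)]) (use that(2) K in auto)
    from near_center[OF this] show "\<bar>(vec_seq (?c ws) - (1 / real K) *\<^sub>R sum_list us) $ i\<bar> \<le> 6 / 2 ^ k" for i
      using that(2) by simp
  qed
  {
    assume "c \<in> set (hull_centers B CARD('m) k K yss)"
    then obtain ws where ws: "set ws \<subseteq> set ?V" "length ws = K" "c = ?c ws"
      by (auto simp: hull_centers_def set_n_lists)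
    obtain us where us: "list_all2 (near B k 3) ws us" "set us \<subseteq> set vs"
      using list_all2_choose_right[OF V ws(1)] .
    then show "\<exists>us. set us \<subseteq> set vs \<and> length us = K \<and> norm (vec_seq c - (1 / real K) *\<^sub>R sum_list us) \<le> real CARD('m) * (6 / 2 ^ k)"
      using close[OF us(1) ws(2)] ws list_all2_lengthD[OF us(1)] by auto
  }
  assume us: "set us \<subseteq> set vs" "length us = K"
  have "list_all2 (\<lambda>x v. near B k 3 v x) vs ?V" using V by (simp add: list_all2_conv_all_nth)
  from list_all2_choose_right[OF this us(1)] obtain ws
    where ws: "list_all2 (\<lambda>x v. near B k 3 v x) us ws" "set ws \<subseteq> set ?V" .
  have len: "length ws = K" using list_all2_lengthD[OF ws(1)] us(2) by simp
  have "list_all2 (near B k 3) ws us" using ws(1) by (simp add: list_all2_conv_all_nth)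
  from close[OF this len] show "\<exists>c\<in>set (hull_centers B CARD('m) k K yss).
      norm (vec_seq c - (1 / real K) *\<^sub>R sum_list us) \<le> real CARD('m) * (6 / 2 ^ k)"
    using ws(2) len by (intro bexI[of _ "?c ws"]) (auto simp: hull_centers_def set_n_lists)
qed

text \<open>
  Points of the balls are \<open>r + \<delta>\<close>-close to an average of points of \<open>V\<close>. Conversely a point of \<open>R\<close> is
  \<open>\<eta>\<close>-close to the hull of \<open>V\<close>, hence \<open>\<eta> + e + \<delta>\<close>-close to a centre.
\<close>

lemma hausdorff_dist_balls_le:
  fixes R :: "(real ^ 'm::finite) set" and C :: "nat set"
  assumes R: "convex R" "V \<subseteq> R" and K: "0 < K" "D\<^sup>2 \<le> real K * e\<^sup>2" "0 \<le> e"
    and D: "\<And>u v. u \<in> R \<Longrightarrow> v \<in> R \<Longrightarrow> norm (u - v) \<le> D"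
    and hull: "\<And>\<rho>. \<rho> \<in> R \<Longrightarrow> \<exists>x\<in>convex hull V. norm (\<rho> - x) \<le> \<eta>"
    and C1: "\<And>c. c \<in> C \<Longrightarrow> \<exists>us. set us \<subseteq> V \<and> length us = K \<and> norm (vec_seq c - (1 / real K) *\<^sub>R sum_list us) \<le> \<delta>"
    and C2: "\<And>us. set us \<subseteq> V \<Longrightarrow> length us = K \<Longrightarrow> \<exists>c\<in>C. norm (vec_seq c - (1 / real K) *\<^sub>R sum_list us) \<le> \<delta>"
    and r: "0 \<le> r" "r + \<delta> \<le> d" "\<eta> + e + \<delta> \<le> d"
  shows "hausdorff_dist (\<Union>c\<in>C. cball (vec_seq c) r) R \<le> ennreal d"
proof (rule hausdorff_dist_le)
  fix x :: "real ^ 'm" assume "x \<in> (\<Union>c\<in>C. cball (vec_seq c) r)"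
  then obtain c where c: "c \<in> C" "dist (vec_seq c) x \<le> r" by auto
  obtain us where us: "set us \<subseteq> V" "length us = K" "norm (vec_seq c - (1 / real K) *\<^sub>R sum_list us) \<le> \<delta>"
    using C1[OF c(1)] by blast
  have "(1 / real K) *\<^sub>R sum_list us \<in> R"
    using average_in_convex[OF R(1), of us] us(1,2) R(2) K(1) by auto
  moreover have "dist x ((1 / real K) *\<^sub>R sum_list us) \<le> d"
    using dist_triangle[of x "(1 / real K) *\<^sub>R sum_list us" "vec_seq c"] c(2) us(3) r(2)
    by (simp add: dist_commute dist_norm[of "vec_seq c" "_ *\<^sub>R _"])
  ultimately show "\<exists>y\<in>R. dist x y \<le> d" by blast
next
  fix y assume y: "y \<in> R"
  obtain x where x: "x \<in> convex hull V" "norm (y - x) \<le> \<eta>" using hull[OF y] by blast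
  have "x \<in> R" using hull_minimal[OF R(2), of convex] R(1) x(1) by blast
  then obtain us where us: "set us \<subseteq> V" "length us = K" "norm ((1 / real K) *\<^sub>R sum_list us - x) \<le> e"
    using convex_hull_average[OF x(1) _ K] D R(2) by blast
  obtain c where c: "c \<in> C" "norm (vec_seq c - (1 / real K) *\<^sub>R sum_list us) \<le> \<delta>" using C2[OF us(1,2)] by blast
  have "dist (vec_seq c) y \<le> \<delta> + e + \<eta>"
    using dist_triangle[of "vec_seq c" y "(1 / real K) *\<^sub>R sum_list us"] dist_triangle[of "(1 / real K) *\<^sub>R sum_list us" y x]
      c(2) us(3) x(2) by (simp add: dist_norm norm_minus_commute)
  then have "dist (vec_seq c) y \<le> d" using r(3) by simp
  moreover have "vec_seq c \<in> (\<Union>c\<in>C. cball (vec_seq c) r)" by (rule UN_I[OF c(1)]) (use r(1) in simp)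
  ultimately show "\<exists>x\<in>\<Union>c\<in>C. cball (vec_seq c) r. dist x y \<le> d" by blast
qed

section \<open>Rotation vectors and the hull of orbit averages\<close>

lemma rotation_set_component_le:
  fixes \<Phi> :: "'a::topological_space \<Rightarrow> real ^ 'm::finite"
  assumes \<Phi>: "\<And>i. (\<lambda>x. \<Phi> x $ i) \<in> borel_measurable borel" "\<And>x i. \<bar>\<Phi> x $ i\<bar> \<le> B"
    and v: "v \<in> rotation_set f \<Phi>"
  shows "\<bar>v $ i\<bar> \<le> B"
proof -
  obtain \<mu> where \<mu>: "\<mu> \<in> invariant_measures f" "\<forall>i. v $ i = (\<integral>x. \<Phi> x $ i \<partial>\<mu>)" using v by (rule rotation_setE)
  note M = invariant_measuresD[OF \<mu>(1)]
  interpret prob_space \<mu> by (rule M(1))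
  have int: "integrable \<mu> (\<lambda>x. \<Phi> x $ i)" by (rule integrable_bounded_borel[OF M(1,2) \<Phi>])
  have "\<bar>v $ i\<bar> \<le> (\<integral>x. \<bar>\<Phi> x $ i\<bar> \<partial>\<mu>)" using \<mu>(2) integral_abs_bound[of \<mu> "\<lambda>x. \<Phi> x $ i"] by simp
  also have "\<dots> \<le> (\<integral>x. B \<partial>\<mu>)" by (rule integral_mono) (use int \<Phi>(2) in auto)
  finally show ?thesis by (simp add: prob_space)
qed

lemma rotation_set_near_orbit_hull:
  fixes f :: "'a::metric_space \<Rightarrow> 'a" and \<Phi> :: "'a \<Rightarrow> real ^ 'm::finite" and Ns :: "(tm \<times> nat) list"
  assumes X: "compact (UNIV :: 'a set)" and f: "f \<in> borel_measurable borel"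
    and \<Phi>: "\<And>i. (\<lambda>x. \<Phi> x $ i) \<in> borel_measurable borel" "\<And>x i. \<bar>\<Phi> x $ i\<bar> \<le> B"
    and \<kappa>: "modulus_of_continuity \<Phi> \<kappa>"
    and qs: "list_all2 (\<lambda>(N, m) q. computes_point s N q \<and> periodic_point f q m) Ns qs"
    and P: "\<forall>i<length ps. P i \<in> sets borel" "disjoint_family_on P {..<length ps}"
      "(\<Union>i<length ps. P i) = UNIV" "\<forall>i<length ps. ps ! i \<in> P i"
      "\<forall>i<length ps. diameter (P i) < 1 / 2 ^ (\<kappa> (n + 1) + 1)"
      "\<forall>\<mu>\<in>invariant_measures f. \<exists>\<nu>\<in>conv_measures (map2 (\<lambda>q (N, m). periodic_measure f q m) qs Ns).
         (\<Sum>i<length ps. \<bar>measure \<mu> (P i) - measure \<nu> (P i)\<bar>) < 1 / 2 ^ n"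
  shows "set (map2 (\<lambda>z q. orbit_average f \<Phi> q (snd z)) Ns qs) \<subseteq> rotation_set f \<Phi>"
    and "\<rho> \<in> rotation_set f \<Phi> \<Longrightarrow> \<exists>x\<in>convex hull (set (map2 (\<lambda>z q. orbit_average f \<Phi> q (snd z)) Ns qs)).
      norm (\<rho> - x) \<le> real CARD('m) * ((1 + B) * (1 / 2 ^ n))"
proof -
  let ?\<mu>s = "map2 (\<lambda>q (N, m). periodic_measure f q m) qs Ns"
  let ?v = "\<lambda>\<mu>. \<chi> i. \<integral>x. \<Phi> x $ i \<partial>\<mu>"
  have per: "periodic_point f q (snd z)" if "(z, q) \<in> set (zip Ns qs)" for z q
    using qs that by (auto simp: list_all2_iff)
  have zip: "(z, q) \<in> set (zip Ns qs) \<longleftrightarrow> (q, z) \<in> set (zip qs Ns)" for z q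
    using list_all2_lengthD[OF qs] by (auto simp: in_set_zip)
  have avg: "orbit_average f \<Phi> q (snd z) = ?v (periodic_measure f q (snd z))"
    and inv: "periodic_measure f q (snd z) \<in> invariant_measures f" if "(z, q) \<in> set (zip Ns qs)" for z q
    using per[OF that] orbit_average_eq_integral[OF _ \<Phi>(1)] periodic_measure_invariant[OF f]
    by (auto simp: periodic_point_def)
  have \<mu>s: "set ?\<mu>s = {periodic_measure f q (snd z) |z q. (z, q) \<in> set (zip Ns qs)}"
    unfolding zip by (force simp: case_prod_unfold)
  have V: "set (map2 (\<lambda>z q. orbit_average f \<Phi> q (snd z)) Ns qs) = ?v ` set ?\<mu>s"
    unfolding \<mu>s using avg by force
  show "set (map2 (\<lambda>z q. orbit_average f \<Phi> q (snd z)) Ns qs) \<subseteq> rotation_set f \<Phi>"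
    unfolding V \<mu>s using inv by (auto simp: rotation_set_def)
  assume "\<rho> \<in> rotation_set f \<Phi>"
  then obtain \<mu> where \<mu>: "\<mu> \<in> invariant_measures f" "\<forall>i. \<rho> $ i = (\<integral>x. \<Phi> x $ i \<partial>\<mu>)" by (rule rotation_setE)
  obtain \<nu> where \<nu>: "\<nu> \<in> conv_measures ?\<mu>s" "(\<Sum>i<length ps. \<bar>measure \<mu> (P i) - measure \<nu> (P i)\<bar>) < 1 / 2 ^ n"
    using P(6) \<mu>(1) by blast
  have osc: "norm (\<Phi> x - \<Phi> (ps ! j)) \<le> (1 / 2 ^ n) / 2" if j: "j < length ps" "x \<in> P j" for j x
  proof -
    \<comment> \<open>Distances are controlled by \<open>diameter\<close> only for bounded
      sets.\<close>
    have "bounded (P j)" using compact_imp_bounded[OF X] by (rule bounded_subset) simp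
    then have "dist x (ps ! j) \<le> diameter (P j)" by (rule diameter_bounded_bound) (use P(4) j in auto)
    also have "\<dots> < 1 / 2 ^ (\<kappa> (n + 1) + 1)" using P(5) j by blast
    also have "\<dots> \<le> 1 / 2 ^ \<kappa> (n + 1)" by (simp add: field_simps)
    finally have "norm (\<Phi> x - \<Phi> (ps ! j)) < 1 / 2 ^ (n + 1)" using \<kappa> unfolding modulus_of_continuity_def by blast
    then show ?thesis by (simp add: field_simps)
  qed
  have inv': "prob_space \<mu> \<and> sets \<mu> = sets borel" if "\<mu> \<in> set ?\<mu>s" for \<mu>
    using that inv invariant_measuresD(1,2) unfolding \<mu>s by blast
  have "\<exists>x\<in>convex hull (?v ` set ?\<mu>s). \<forall>i. \<bar>(\<integral>x. \<Phi> x $ i \<partial>\<mu>) - x $ i\<bar> \<le> (1 + B) * (1 / 2 ^ n)"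
    by (rule integral_near_convex_hull[OF invariant_measuresD(1,2)[OF \<mu>(1)] inv' \<nu>(1) \<Phi> P(1)[rule_format] P(2,3) osc
      less_imp_le[OF \<nu>(2)]])
  then obtain x where x: "x \<in> convex hull (?v ` set ?\<mu>s)"
    "\<forall>i. \<bar>(\<integral>x. \<Phi> x $ i \<partial>\<mu>) - x $ i\<bar> \<le> (1 + B) * (1 / 2 ^ n)" by blast
  have "norm (\<rho> - x) \<le> real CARD('m) * ((1 + B) * (1 / 2 ^ n))"
    by (rule norm_le_card_mult) (use x(2) \<mu>(2) in simp)
  with x(1) show "\<exists>x\<in>convex hull (set (map2 (\<lambda>z q. orbit_average f \<Phi> q (snd z)) Ns qs)).
      norm (\<rho> - x) \<le> real CARD('m) * ((1 + B) * (1 / 2 ^ n))"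
    unfolding V by blast
qed

text \<open>Each point of an orbit contributes an error of 2 units, and averaging along the orbit
  adds the third.\<close>

lemma orbit_codes_near:
  fixes s :: "nat \<Rightarrow> 'a::metric_space" and \<Phi> :: "'a \<Rightarrow> real ^ 'm::finite"
  assumes F: "\<And>\<alpha> \<phi> n. is_oracle s \<alpha> \<phi> \<Longrightarrow> \<exists>m. outputs [\<phi>] F n m \<and> dist (s m) (f \<alpha>) < 1 / 2 ^ n"
    and G: "\<And>\<alpha> \<phi> n. is_oracle s \<alpha> \<phi> \<Longrightarrow> \<exists>m. outputs [\<phi>] G n m \<and> dist (vec_seq m) (\<Phi> \<alpha>) < 1 / 2 ^ n"
    and B: "\<And>x i. \<bar>\<Phi> x $ i\<bar> \<le> real B - 1"
    and qs: "list_all2 (\<lambda>(N, m) q. computes_point s N q \<and> periodic_point f q m) Ns qs"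
    and ready: "orbits_ready F G T k Ns"
  shows "list_all2 (\<lambda>ys v. near B k 3 (list_average CARD('m) (map (\<lambda>y. grid_point B CARD('m) k y) ys)) v)
    (orbit_codes F G T k Ns) (map2 (\<lambda>z q. orbit_average f \<Phi> q (snd z)) Ns qs)"
proof -
  have len: "length Ns = length qs" using qs by (rule list_all2_lengthD)
  have "near B k 3 (list_average CARD('m) (map (\<lambda>y. grid_point B CARD('m) k y) (orbit_codes F G T k Ns ! j)))
      (orbit_average f \<Phi> (qs ! j) (snd (Ns ! j)))" if j: "j < length Ns" for j
  proof -
    obtain N m where Nm: "Ns ! j = (N, m)" by fastforce
    define y where "y a = (case orbit_value F G N T a k of None \<Rightarrow> 0 | Some y \<Rightarrow> y)" for a
    have codes: "orbit_codes F G T k Ns ! j = map y [0..<m]"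
      using j by (simp add: orbit_codes_def Nm y_def)
    have N: "computes_point s N (qs ! j)" and m: "0 < m"
      using qs j Nm by (auto simp: list_all2_conv_all_nth periodic_point_def dest!: spec[of _ j])
    have "near B k 2 (grid_point B CARD('m) k (y a)) (\<Phi> ((f ^^ a) (qs ! j)))" if a: "a < m" for a
    proof (rule near_grid_point)
      have "(N, m) \<in> set Ns" using j Nm by (metis nth_mem)
      then have "orbit_value F G N T a k \<noteq> None" using ready a unfolding orbits_ready_def by force
      then have eq: "orbit_value F G N T a k = Some (y a)" by (auto simp: y_def)
      have "dist (vec_seq (y a)) (\<Phi> ((f ^^ a) (qs ! j))) < 1 / 2 ^ k"
        by (rule orbit_value_correct(1)[where f = f and t = vec_seq and g = \<Phi>, OF N F G eq])
      then show "\<bar>(vec_seq (y a) :: real ^ 'm) $ i - \<Phi> ((f ^^ a) (qs ! j)) $ i\<bar> \<le> 1 / 2 ^ k" for i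
        using component_le_norm_cart[of "vec_seq (y a) - \<Phi> ((f ^^ a) (qs ! j))" i] by (simp add: dist_norm)
    qed (rule B)
    then have "list_all2 (near B k 2) (map (\<lambda>a. grid_point B CARD('m) k (y a)) [0..<m])
        (map (\<lambda>a. \<Phi> ((f ^^ a) (qs ! j))) [0..<m])"
      by (simp add: list_all2_conv_all_nth)
    from near_list_average[OF this] m show ?thesis
      by (simp add: codes orbit_average_def Nm comp_def)
  qed
  then show ?thesis using len by (simp add: list_all2_conv_all_nth orbit_codes_def)
qed

text \<open>Each single value is available for all large bounds, and only finitely many are needed,
  so one bound serves them all.\<close>

lemma eventually_orbits_ready:
  fixes s :: "nat \<Rightarrow> 'a::metric_space" and t :: "nat \<Rightarrow> 'b::metric_space"
  assumes F: "\<And>\<alpha> \<phi> n. is_oracle s \<alpha> \<phi> \<Longrightarrow> \<exists>m. outputs [\<phi>] F n m \<and> dist (s m) (f \<alpha>) < 1 / 2 ^ n"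
    and G: "\<And>\<alpha> \<phi> n. is_oracle s \<alpha> \<phi> \<Longrightarrow> \<exists>m. outputs [\<phi>] G n m \<and> dist (t m) (g \<alpha>) < 1 / 2 ^ n"
    and qs: "list_all2 (\<lambda>(N, m) q. computes_point s N q \<and> periodic_point f q m) Ns qs"
  shows "\<exists>T. orbits_ready F G T k Ns"
proof -
  have "\<forall>\<^sub>F T in sequentially. orbit_value F G (fst z) T a k \<noteq> None" if z: "z \<in> set Ns" for z a
  proof -
    obtain q where "computes_point s (fst z) q"
      using qs z by (auto simp: list_all2_conv_all_nth in_set_conv_nth)
    then show ?thesis by (rule orbit_value_correct(2)[where f = f and t = t and g = g, OF _ F G])
  qed
  then have "\<forall>\<^sub>F T in sequentially. orbits_ready F G T k Ns"
    unfolding orbits_ready_def by (intro eventually_ball_finite ballI finite_set)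
  then show ?thesis by (rule eventually_happens'[OF sequentially_bot])
qed

text \<open>The empty list of balls is output: both suprema in \<open>hausdorff_dist {} {}\<close>
  are over the empty set, so this distance is \<open>0\<close>.\<close>

lemma rotation_set_empty_computable:
  assumes "invariant_measures f = {}"
  shows "computable_compact (rotation_set f \<Phi>)"
proof -
  have empty: "rotation_set f \<Phi> = {}" using assms by (simp add: rotation_set_def)
  have "computable_nat_fun (\<lambda>_. 0)" by (intro effective_imp_computable_nat_fun eff)
  then obtain M where "\<And>n. outputs [] M n 0" by (auto simp: computable_nat_fun_def)
  then show ?thesis
    unfolding computable_compact_def empty
    by (intro conjI exI[of _ M] allI exI[of _ "[]"]) (simp_all add: hausdorff_dist_def bot_ennreal)
qed

theorem theorem3p1:
  fixes s :: "nat \<Rightarrow> 'a::metric_space"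
    and f :: "'a \<Rightarrow> 'a"
    and \<Phi> :: "'a \<Rightarrow> real ^ 'm::finite"
    and \<kappa> :: "nat \<Rightarrow> nat"
    and \<psi> :: tm
  assumes "compact (UNIV :: 'a set)"
    and "dense_sequence s"
    and "computable2_on s s real_seq UNIV (dist :: 'a \<Rightarrow> 'a \<Rightarrow> real)"
    and "computable_on s s UNIV f"
    and "continuous_on UNIV \<Phi>"
    and "computable_on s vec_seq UNIV \<Phi>"
    and "computable_nat_fun \<kappa>"
    and "modulus_of_continuity \<Phi> \<kappa>"
    and "\<forall>n. \<exists>(Ms :: tm list) (ps :: 'a list) (Ns :: (tm \<times> nat) list) (qs :: 'a list).
           outputs [] \<psi> n
             (prod_encode
               (list_encode (map tm_encode Ms),
                list_encode (map (\<lambda>(N, m). prod_encode (tm_encode N, m)) Ns))) \<and>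
           list_all2 (computes_point s) Ms ps \<and>
           list_all2 (\<lambda>(N, m) q. computes_point s N q \<and> periodic_point f q m) Ns qs \<and>
           (\<exists>P :: nat \<Rightarrow> 'a set.
              (\<forall>i<length ps. P i \<in> sets borel) \<and>
              disjoint_family_on P {..<length ps} \<and>
              (\<Union>i<length ps. P i) = UNIV \<and>
              (\<forall>i<length ps. ps ! i \<in> P i) \<and>
              (\<forall>i<length ps. diameter (P i) < 1 / 2 ^ (\<kappa> (n + 1) + 1)) \<and>
              (\<forall>\<mu>\<in>invariant_measures f.
                 \<exists>\<nu>\<in>conv_measures (map2 (\<lambda>q (N, m). periodic_measure f q m) qs Ns).
                   (\<Sum>i<length ps. \<bar>measure \<mu> (P i) - measure \<nu> (P i)\<bar>) < 1 / 2 ^ n))"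
  shows "computable_compact (rotation_set f \<Phi>)"
proof (cases "invariant_measures f = {}")
  case True
  then show ?thesis by (rule rotation_set_empty_computable)
next
  case False
  note X = assms(1,2)
  have fc: "continuous_on UNIV f" by (rule computable_on_imp_continuous_on[OF assms(2,4)])
  have fb: "f \<in> borel_measurable borel" by (rule borel_measurable_continuous_onI[OF fc])
  have \<Phi>b: "(\<lambda>x. \<Phi> x $ i) \<in> borel_measurable borel" for i
    by (intro borel_measurable_continuous_onI continuous_intros assms(5))
  have "bounded (range \<Phi>)" by (intro compact_imp_bounded compact_continuous_image assms(1,5))
  then obtain b where b: "\<And>x. norm (\<Phi> x) \<le> b" unfolding bounded_iff by auto
  \<comment> \<open>The summand \<open>1\<close> gives the margin asked for by
    \<open>near_grid_point\<close>, and it makes \<open>B\<close> and hence \<open>K n\<close>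
    positive.\<close>
  define B where "B = nat \<lceil>b\<rceil> + 1"
  have B1: "\<bar>\<Phi> x $ i\<bar> \<le> real B - 1" for x i
    using b[of x] component_le_norm_cart[of "\<Phi> x" i] unfolding B_def by linarith
  then have B: "\<bar>\<Phi> x $ i\<bar> \<le> real B" for x i using B1[of x i] by linarith
  obtain F where "\<forall>\<alpha>\<in>UNIV. \<forall>\<phi>. is_oracle s \<alpha> \<phi> \<longrightarrow> (\<forall>n. \<exists>m. outputs [\<phi>] F n m \<and> dist (s m) (f \<alpha>) < 1 / 2 ^ n)"
    using assms(4) unfolding computable_on_def by blast
  then have F: "\<And>\<alpha> \<phi> n. is_oracle s \<alpha> \<phi> \<Longrightarrow> \<exists>m. outputs [\<phi>] F n m \<and> dist (s m) (f \<alpha>) < 1 / 2 ^ n" by blast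
  obtain G where "\<forall>\<alpha>\<in>UNIV. \<forall>\<phi>. is_oracle s \<alpha> \<phi> \<longrightarrow> (\<forall>n. \<exists>m. outputs [\<phi>] G n m \<and> dist (vec_seq m) (\<Phi> \<alpha>) < 1 / 2 ^ n)"
    using assms(6) unfolding computable_on_def by blast
  then have G: "\<And>\<alpha> \<phi> n. is_oracle s \<alpha> \<phi> \<Longrightarrow> \<exists>m. outputs [\<phi>] G n m \<and> dist (vec_seq m) (\<Phi> \<alpha>) < 1 / 2 ^ n" by blast
  let ?R = "rotation_set f \<Phi>"
  let ?V = "\<lambda>Ns qs. set (map2 (\<lambda>z q. orbit_average f \<Phi> q (snd z)) Ns qs)"
  define d where "d = CARD('m)"
  have d: "0 < d" by (simp add: d_def)

  \<comment> \<open>The partitions are used up here; what remains of them is the hull estimate for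
    the orbits named by the output of \<open>\<psi>\<close>.\<close>
  have "\<forall>n. \<exists>z :: tm list \<times> (tm \<times> nat) list. outputs [] \<psi> n (enc z) \<and>
    (\<exists>qs. list_all2 (\<lambda>(N, m) q. computes_point s N q \<and> periodic_point f q m) (snd z) qs \<and> ?V (snd z) qs \<subseteq> ?R \<and>
      (\<forall>\<rho>\<in>?R. \<exists>x\<in>convex hull (?V (snd z) qs). norm (\<rho> - x) \<le> real d * ((1 + real B) * (1 / 2 ^ n))))"
  proof
    fix n
    obtain Ms :: "tm list" and ps :: "'a list" and Ns :: "(tm \<times> nat) list" and qs :: "'a list" and P :: "nat \<Rightarrow> 'a set"
      where out: "outputs [] \<psi> n (prod_encode (list_encode (map tm_encode Ms),
          list_encode (map (\<lambda>(N, m). prod_encode (tm_encode N, m)) Ns)))"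
      and qs: "list_all2 (\<lambda>(N, m) q. computes_point s N q \<and> periodic_point f q m) Ns qs"
      and P: "\<forall>i<length ps. P i \<in> sets borel" "disjoint_family_on P {..<length ps}"
        "(\<Union>i<length ps. P i) = UNIV" "\<forall>i<length ps. ps ! i \<in> P i"
        "\<forall>i<length ps. diameter (P i) < 1 / 2 ^ (\<kappa> (n + 1) + 1)"
        "\<forall>\<mu>\<in>invariant_measures f. \<exists>\<nu>\<in>conv_measures (map2 (\<lambda>q (N, m). periodic_measure f q m) qs Ns).
           (\<Sum>i<length ps. \<bar>measure \<mu> (P i) - measure \<nu> (P i)\<bar>) < 1 / 2 ^ n"
      using assms(9)[rule_format, of n] by (elim exE conjE) (rule that)
    have "enc (Ms, Ns) = prod_encode (list_encode (map tm_encode Ms),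
          list_encode (map (\<lambda>(N, m). prod_encode (tm_encode N, m)) Ns))"
      by (simp add: enc_list_def enc_tm_def enc_prod_def[abs_def] case_prod_unfold)
    then show "\<exists>z :: tm list \<times> (tm \<times> nat) list. outputs [] \<psi> n (enc z) \<and>
      (\<exists>qs. list_all2 (\<lambda>(N, m) q. computes_point s N q \<and> periodic_point f q m) (snd z) qs \<and> ?V (snd z) qs \<subseteq> ?R \<and>
        (\<forall>\<rho>\<in>?R. \<exists>x\<in>convex hull (?V (snd z) qs). norm (\<rho> - x) \<le> real d * ((1 + real B) * (1 / 2 ^ n))))"
      using out qs rotation_set_near_orbit_hull[OF X(1) fb \<Phi>b B assms(8) qs P] unfolding d_def
      by (intro exI[of _ "(Ms, Ns)"] conjI exI[of _ qs]) simp_all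
  qed
  from choice[OF this] obtain z :: "nat \<Rightarrow> tm list \<times> (tm \<times> nat) list" where
    z: "\<And>n. outputs [] \<psi> n (enc (z n))"
    and qs: "\<And>n. \<exists>qs. list_all2 (\<lambda>(N, m) q. computes_point s N q \<and> periodic_point f q m) (snd (z n)) qs \<and> ?V (snd (z n)) qs \<subseteq> ?R \<and>
      (\<forall>\<rho>\<in>?R. \<exists>x\<in>convex hull (?V (snd (z n)) qs). norm (\<rho> - x) \<le> real d * ((1 + real B) * (1 / 2 ^ n)))"
    by blast
  \<comment> \<open>Although \<open>z\<close> comes from choice, its codes are what
    \<open>\<psi>\<close> outputs.\<close>
  have z_eff: "effective z" by (rule computable_nat_fun_imp_effective[OF z])

  \<comment> \<open>By \<open>d \<le> 2 ^ d\<close> and \<open>1 + B \<le> 2 ^ B\<close>, this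
    precision makes the hull error \<open>d * (1 + B) / 2 ^ (n + (2 + d + B))\<close> at most
    \<open>1 / 2 ^ (n + 2)\<close>.\<close>
  define Ns where "Ns n = snd (z (n + (2 + d + B)))" for n
  \<comment> \<open>Makes the rounding error \<open>6 * d / 2 ^ k n\<close> at most an eighth of
    \<open>1 / 2 ^ n\<close>, as \<open>6 / 64 < 1 / 8\<close>.\<close>
  define k where "k n = n + (6 + d)" for n
  \<comment> \<open>This is \<open>D\<^sup>2 / e\<^sup>2\<close> for the diameter bound
    \<open>D = 2 * d * B\<close> of the rotation set and the averaging error
    \<open>e = 1 / 2 ^ (n + 2)\<close>.\<close>
  define K where "K n = (2 * d * B)\<^sup>2 * 16 * 4 ^ n" for n
  define T where "T n = (LEAST T. orbits_ready F G T (k n) (Ns n))" for n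
  define C where "C n = hull_centers B d (k n) (K n) (orbit_codes F G (T n) (k n) (Ns n))" for n
  have ex: "\<exists>T. orbits_ready F G T (k n) (Ns n)" for n
  proof -
    obtain ql where ql: "list_all2 (\<lambda>(N, m) q. computes_point s N q \<and> periodic_point f q m) (Ns n) ql"
      using qs[of "n + (2 + d + B)"] unfolding Ns_def by blast
    show ?thesis by (rule eventually_orbits_ready[where f = f and t = vec_seq and g = \<Phi>, OF F G ql])
  qed
  have ready: "orbits_ready F G (T n) (k n) (Ns n)" for n unfolding T_def using ex by (rule LeastI_ex)
  have eNs: "effective Ns" unfolding Ns_def[abs_def] by (intro eff effective_compose[OF z_eff])
  have ek: "effective k" unfolding k_def[abs_def] by (intro eff)
  have eK: "effective K" unfolding K_def[abs_def] by (intro eff)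
  have eT: "effective T"
    unfolding T_def[abs_def]
    by (rule effective_Least[OF _ ex surj_enc_nat]) (intro eff effective_compose_fst[OF ek] effective_compose_fst[OF eNs])
  have "effective C" unfolding C_def[abs_def] by (intro eff d ek eK eT eNs)
  \<comment> \<open>The number \<open>2 * (n + 2)\<close> is \<open>int_encode\<close> of the
    exponent \<open>n + 2\<close>, so every ball has radius \<open>1 / 2 ^ (n + 2)\<close>.\<close>
  then have "effective (\<lambda>n. enc (map (\<lambda>c. (c, 2 * (n + 2))) (C n)))" by (intro eff)
  then obtain M where M: "\<And>n. outputs [] M n (enc (map (\<lambda>c. (c, 2 * (n + 2))) (C n)))"
    using effective_imp_computable_nat_fun by (fastforce simp: computable_nat_fun_def)

  have R_bound: "norm (u - v) \<le> 2 * real d * real B" if "u \<in> ?R" "v \<in> ?R" for u v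
  proof -
    have "norm (u - v) \<le> real CARD('m) * (2 * real B)"
    proof (rule norm_le_card_mult)
      fix i
      show "\<bar>(u - v) $ i\<bar> \<le> 2 * real B"
        using rotation_set_component_le[OF \<Phi>b B that(1), of i] rotation_set_component_le[OF \<Phi>b B that(2), of i]
        by (simp add: abs_le_iff)
    qed
    then show ?thesis by (simp add: d_def mult_ac)
  qed
  \<comment> \<open>In units of \<open>1 / 2 ^ n\<close> the errors sum to at most
    \<open>1/4 + 1/4 + 1/8\<close>; a factor below \<open>1\<close> turns this into the strict
    inequality of \<open>computable_compact\<close>.\<close>
  have haus: "hausdorff_dist (\<Union>c\<in>set (C n). cball (vec_seq c) (1 / 2 ^ (n + 2))) ?R \<le> ennreal (3 / 4 * (1 / 2 ^ n))" for n
  proof -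
    obtain ql where ql: "list_all2 (\<lambda>(N, m) q. computes_point s N q \<and> periodic_point f q m) (Ns n) ql"
      "?V (Ns n) ql \<subseteq> ?R"
      "\<And>\<rho>. \<rho> \<in> ?R \<Longrightarrow> \<exists>x\<in>convex hull (?V (Ns n) ql). norm (\<rho> - x) \<le> real d * ((1 + real B) * (1 / 2 ^ (n + (2 + d + B))))"
      using qs[of "n + (2 + d + B)"] unfolding Ns_def by blast
    have K: "0 < K n" using d by (simp add: K_def B_def)
    have pow2: "((2 :: real) ^ n)\<^sup>2 = 4 ^ n" by (simp add: power2_eq_square flip: power_mult_distrib)
    have Ke: "(2 * real d * real B)\<^sup>2 \<le> real (K n) * (1 / 2 ^ (n + 2))\<^sup>2"
      by (simp add: K_def power_divide power_add power_mult_distrib pow2)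
    have "real d \<le> real (2 ^ d)" "real (1 + B) \<le> real (2 ^ B)"
      unfolding of_nat_le_iff using less_exp[of d] less_exp[of B] by linarith+
    then have dB: "real d \<le> 2 ^ d" "1 + real B \<le> 2 ^ B" by simp_all
    have "real d * (6 / 2 ^ k n) \<le> 2 ^ d * (6 / 2 ^ k n)" using dB(1) by (intro mult_right_mono) auto
    also have "\<dots> \<le> 1 / 8 * (1 / 2 ^ n)" by (simp add: k_def power_add field_simps)
    finally have delta: "real d * (6 / 2 ^ k n) \<le> 1 / 8 * (1 / 2 ^ n)" .
    have "real d * ((1 + real B) * (1 / 2 ^ (n + (2 + d + B)))) \<le> 2 ^ d * (2 ^ B * (1 / 2 ^ (n + (2 + d + B))))"
      using dB by (intro mult_mono) auto
    also have "\<dots> = 1 / 4 * (1 / 2 ^ n)" by (simp add: power_add field_simps)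
    finally have eta: "real d * ((1 + real B) * (1 / 2 ^ (n + (2 + d + B)))) \<le> 1 / 4 * (1 / 2 ^ n)" .
    have r: "(1 :: real) / 2 ^ (n + 2) = 1 / 4 * (1 / 2 ^ n)" by simp
    have pos: "0 \<le> (1 :: real) / 2 ^ n" by simp
    have "list_all2 (\<lambda>ys v. near B (k n) 3 (list_average CARD('m) (map (\<lambda>y. grid_point B CARD('m) (k n) y) ys)) v)
        (orbit_codes F G (T n) (k n) (Ns n)) (map2 (\<lambda>z q. orbit_average f \<Phi> q (snd z)) (Ns n) ql)"
      by (rule orbit_codes_near[where f = f and \<Phi> = \<Phi>, OF F G B1 ql(1) ready])
    note near = hull_centers_near[OF this K]
    show ?thesis
    proof (rule hausdorff_dist_balls_le[OF convex_rotation_set[OF \<Phi>b B] ql(2) K Ke _ R_bound ql(3)])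
      show "\<exists>us. set us \<subseteq> ?V (Ns n) ql \<and> length us = K n \<and>
        norm (vec_seq c - (1 / real (K n)) *\<^sub>R sum_list us) \<le> real d * (6 / 2 ^ k n)" if "c \<in> set (C n)" for c
        using near(1) that unfolding C_def d_def by blast
      show "\<exists>c\<in>set (C n). norm (vec_seq c - (1 / real (K n)) *\<^sub>R sum_list us) \<le> real d * (6 / 2 ^ k n)"
        if "set us \<subseteq> ?V (Ns n) ql" "length us = K n" for us
        using near(2)[OF that] unfolding C_def d_def .
      show "1 / 2 ^ (n + 2) + real d * (6 / 2 ^ k n) \<le> 3 / 4 * (1 / 2 ^ n)"
        using delta pos unfolding r by linarith
      show "real d * ((1 + real B) * (1 / 2 ^ (n + (2 + d + B)))) + 1 / 2 ^ (n + 2) + real d * (6 / 2 ^ k n) \<le> 3 / 4 * (1 / 2 ^ n)"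
        using delta eta pos unfolding r by linarith
    qed auto
  qed
  show ?thesis
    unfolding computable_compact_def
  proof (intro conjI exI[of _ M] allI)
    show "compact ?R" by (rule compact_rotation_set[OF X fc assms(5)])
    fix n
    let ?bs = "map (\<lambda>c. (c, int (n + 2))) (C n)"
    have "map (\<lambda>(c, l). prod_encode (c, int_encode l)) ?bs = map enc (map (\<lambda>c. (c, 2 * (n + 2))) (C n))"
    proof -
      have "int_encode (int j) = 2 * j" for j by (simp add: int_encode_def sum_encode_def)
      then show ?thesis by (simp only: map_map comp_def case_prod_conv enc_Pair enc_nat_def)
    qed
    then have "outputs [] M n (list_encode (map (\<lambda>(c, l). prod_encode (c, int_encode l)) ?bs))"
      using M[of n] by (simp only: enc_list_def)
    moreover have "(\<Union>(c, l)\<in>set ?bs. cball (vec_seq c :: real ^ 'm) (2 powi (- l)))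
        = (\<Union>c\<in>set (C n). cball (vec_seq c) (1 / 2 ^ (n + 2)))"
    proof -
      have "(2 :: real) powi (- int j) = 1 / 2 ^ j" for j by (simp add: power_int_minus inverse_eq_divide)
      then show ?thesis by (simp only: set_map image_image case_prod_conv)
    qed
    moreover have "0 < (1 :: real) / 2 ^ n" by simp
    then have "3 / 4 * (1 / 2 ^ n) < (1 :: real) / 2 ^ n" by linarith
    then have "ennreal (3 / 4 * (1 / 2 ^ n)) < ennreal (1 / 2 ^ n)" by (intro ennreal_lessI) simp_all
    note less = le_less_trans[OF haus[of n] this]
    ultimately show "\<exists>bs. outputs [] M n (list_encode (map (\<lambda>(c, l). prod_encode (c, int_encode l)) bs)) \<and>
        hausdorff_dist (\<Union>(c, l)\<in>set bs. cball (vec_seq c) (2 powi (- l))) ?R < ennreal (1 / 2 ^ n)"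
      using less by (intro exI[of _ ?bs] conjI) (simp_all only:)
  qed
qed

end
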